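(* Let $d\ge3$ and $\omega\in\Omega$. Suppose that $(\mathcal C_\infty(\omega),\mathcal O(\omega))$ satisfies the volume regularity and Sobolev assumption (G), and suppose there exist $p,q\in(1,\infty]$ with $1/p+1/q<2/d'$ and $C_{\mathrm{int}}<\infty$ such that, for every $x\in\mathcal C_\infty(\omega)$, there exists $N_{10}(\omega,x)<\infty$ such that $$\sup_{n\ge N_{10}(\omega,x)}\max\Big\{\|\mu^\omega\|_{p,B^\omega(x,n)},\ \|\nu^\omega\|_{q,B^\omega(x,n)},\ \|\kappa^\omega\|_{p,B^\omega(x,n)},\ \|1/\kappa^\omega\|_{1,B^\omega(x,n)}\Big\}\le C_{\mathrm{int}}.$$ Then there exist $\lambda=\lambda(d)\in(0,1)$, $\gamma=\gamma(d',p,q)\in(1,\infty)$ and $c_{26}=c_{26}(d',p,q,C_{\mathrm{int}})\in(0,\infty)$ such that the following holds. For any $x\in\mathcal C_\infty(\omega)$ there exists $N_{11}(\omega,x)<\infty$ such that for all $y\in\mathcal C_\infty(\omega)$ with $\rho^\omega(x,y)\ge N_{11}(\omega,x)$ and all $h\in[0,1]$, $$g^\omega(x,y)\le c_{26}\,F_\gamma\big(h\,\rho^\omega(x,y)^2\big)\,\rho^\omega(x,y)^{2-d}\sup_{z\in B^\omega(x,n)^c}e^{-\lambda\sqrt h\,d^\omega_\kappa(x,z)},$$ where $n=\rho^\omega(x,y)/4$ and $F_\gamma(r)=(1+r)^\gamma(1+1/r)^{1/2}$.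
   Context: This is a deterministic statement for a fixed configuration $\omega$, i.e. for fixed conductances $a^\omega:E_d\to[0,\infty)$ on the nearest-neighbour edges $E_d$ of $\mathbb{Z}^d$ and fixed killing rates $\kappa^\omega:\mathbb{Z}^d\to(0,\infty)$. An edge is open if $a^\omega(e)>0$; $\mathcal O(\omega)$ is the set of open edges, $x\sim y$ means $\{x,y\}\in\mathcal O(\omega)$. It is assumed that there is a unique infinite cluster $\mathcal C_\infty(\omega)$ of open edges and that it contains the origin. $\rho^\omega$ is the graph distance on $(\mathcal C_\infty(\omega),\mathcal O(\omega))$, $B^\omega(x,r)=\{y\in\mathcal C_\infty(\omega):\rho^\omega(x,y)\le\lfloor r\rfloor\}$, and complements are taken in $\mathcal C_\infty(\omega)$. $\mu^\omega(x)=\sum_{y\sim x}a^\omega(x,y)$, $\nu^\omega(x)=\sum_{y\sim x}a^\omega(x,y)^{-1}$. For finite non-empty $A$: $\|f\|_{p,A}=\big(\frac1{|A|}\sum_{x\in A}|f(x)|^p\big)^{1/p}$ for $p<\infty$ and $\|f\|_{\infty,A}=\max_A|f|$. (G) There exist $C_{\mathrm{reg}},C_{S_1}\in[1,\infty)$ and $d'\ge d$ such that for all $x\in\mathcal C_\infty(\omega)$: (i) there is $N_4(\omega,x)<\infty$ with $C_{\mathrm{reg}}^{-1}n^d\le|B^\omega(x,n)|\le C_{\mathrm{reg}}n^d$ for all $n\ge N_4(\omega,x)$; (ii) there is $N_5(\omega,x)<\infty$ such that for all $n\ge N_5(\omega,x)$ and every $u:\mathcal C_\infty(\omega)\to\mathbb{R}$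 with support in $B^\omega(x,n)$, $\|u\|_{d'/(d'-1),B^\omega(x,n)}\le C_{S_1}\frac{n}{|B^\omega(x,n)|}\sum_{y,z\in\mathcal C_\infty(\omega),\{y,z\}\in\mathcal O(\omega)}|u(y)-u(z)|$. The constants $d,C_{\mathrm{reg}},C_{S_1}$ are regarded as fixed and constants may depend on them. For $h\in[0,1]$, $X$ is the continuous-time Markov chain on $\mathcal C_\infty(\omega)$ (with cemetery state) with generator $(\mathcal L^\omega f)(x)=\sum_{y\sim x}a^\omega(x,y)(f(y)-f(x))-h\kappa^\omega(x)f(x)$, i.e. jumping from $x$ to $y$ at rate $a^\omega(x,y)$ and killed at $x$ at rate $h\kappa^\omega(x)$, with killing time $\zeta$ and law $\mathrm P^\omega_x$. Green's function: $g^\omega(x,y)=\int_0^\infty\mathrm P^\omega_x[X_t=y,t<\zeta]\,dt$ (depending on $h$). Distance: $d^\omega_\kappa(x,y)=\inf_\gamma\sum_{i=0}^{l_\gamma-1}\big(1\wedge\frac{\kappa^\omega(z_i)\wedge\kappa^\omega(z_{i+1})}{a^\omega(z_i,z_{i+1})}\big)^{1/2}$, the infimum over nearest-neighbour paths $\gamma=(z_0,\dots,z_{l_\gamma})$ in $\mathcal C_\infty(\omega)$ along open edges from $x$ to $y$. Convention: $F_\gamma(0)=+\infty$. *)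

theory Defs
  imports "HOL-Probability.Probability"
begin

section \<open>Conductance configurations on the integer lattice\<close>

text \<open>
  The lattice of dimension \<open>d\<close> is the type \<open>int ^ 'd\<close> with \<open>CARD('d) = d\<close>. A configuration
  is a pair \<open>a\<close>, \<open>\<kappa>\<close>; conductances are functions of the unordered edge \<open>{x, y}\<close>, so they
  are symmetric by construction, and only their values on nearest-neighbour edges are ever used.
\<close>

definition nn_edges :: "(int ^ 'd) set set" where
  "nn_edges = {{x, y} |x y. (\<Sum>i\<in>UNIV. \<bar>x $ i - y $ i\<bar>) = 1}"

definition open_edges :: "((int ^ 'd) set \<Rightarrow> real) \<Rightarrow> (int ^ 'd) set set" where
  "open_edges a = {e \<in> nn_edges. 0 < a e}"

definition adj :: "((int ^ 'd) set \<Rightarrow> real) \<Rightarrow> int ^ 'd \<Rightarrow> int ^ 'd \<Rightarrow> bool" where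
  "adj a x y \<longleftrightarrow> {x, y} \<in> open_edges a"

definition clusters :: "((int ^ 'd) set \<Rightarrow> real) \<Rightarrow> (int ^ 'd) set set" where
  "clusters a = range (\<lambda>x. {y. (adj a)\<^sup>*\<^sup>* x y})"

definition infinite_cluster :: "((int ^ 'd) set \<Rightarrow> real) \<Rightarrow> (int ^ 'd) set" where
  "infinite_cluster a = (THE C. C \<in> clusters a \<and> infinite C)"

definition configuration :: "((int ^ 'd) set \<Rightarrow> real) \<Rightarrow> (int ^ 'd \<Rightarrow> real) \<Rightarrow> bool" where
  "configuration a \<kappa> \<longleftrightarrow>
     (\<forall>e\<in>nn_edges. 0 \<le> a e) \<and> (\<forall>x. 0 < \<kappa> x) \<and>
     (\<exists>!C. C \<in> clusters a \<and> infinite C) \<and> 0 \<in> infinite_cluster a"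

text \<open>A path \<open>(z\<^sub>0, \<dots>, z\<^sub>l)\<close> is the list of its \<open>l + 1\<close> vertices.\<close>

definition open_paths :: "((int ^ 'd) set \<Rightarrow> real) \<Rightarrow> int ^ 'd \<Rightarrow> int ^ 'd \<Rightarrow> (int ^ 'd) list set" where
  "open_paths a x y =
     {zs. zs \<noteq> [] \<and> hd zs = x \<and> last zs = y \<and> set zs \<subseteq> infinite_cluster a \<and>
          (\<forall>i < length zs - 1. adj a (zs ! i) (zs ! Suc i))}"

definition graph_dist :: "((int ^ 'd) set \<Rightarrow> real) \<Rightarrow> int ^ 'd \<Rightarrow> int ^ 'd \<Rightarrow> nat" where
  "graph_dist a x y = (LEAST l. \<exists>zs\<in>open_paths a x y. length zs = Suc l)"

definition graph_ball :: "((int ^ 'd) set \<Rightarrow> real) \<Rightarrow> int ^ 'd \<Rightarrow> real \<Rightarrow> (int ^ 'd) set" where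
  "graph_ball a x r = {y \<in> infinite_cluster a. int (graph_dist a x y) \<le> \<lfloor>r\<rfloor>}"

definition mu :: "((int ^ 'd) set \<Rightarrow> real) \<Rightarrow> int ^ 'd \<Rightarrow> real" where
  "mu a x = (\<Sum>y | adj a x y. a {x, y})"

definition nu :: "((int ^ 'd) set \<Rightarrow> real) \<Rightarrow> int ^ 'd \<Rightarrow> real" where
  "nu a x = (\<Sum>y | adj a x y. 1 / a {x, y})"


section \<open>Averaged norms, volume regularity and Sobolev inequality\<close>

definition avg_norm :: "ereal \<Rightarrow> ('v \<Rightarrow> real) \<Rightarrow> 'v set \<Rightarrow> real" where
  "avg_norm p f A =
     (if p = \<infinity> then Max ((\<lambda>x. \<bar>f x\<bar>) ` A)
      else ((\<Sum>x\<in>A. \<bar>f x\<bar> powr real_of_ereal p) / real (card A)) powr (1 / real_of_ereal p))"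

text \<open>
  The gradient sum in the Sobolev inequality runs over ordered pairs. It has only finitely many
  nonzero terms, but its index set is infinite, hence the use of \<open>infsum\<close>.
\<close>

definition volume_Sobolev_regular ::
    "((int ^ 'd) set \<Rightarrow> real) \<Rightarrow> real \<Rightarrow> real \<Rightarrow> real \<Rightarrow> bool" where
  "volume_Sobolev_regular a C_reg C_S d' \<longleftrightarrow>
     1 \<le> C_reg \<and> 1 \<le> C_S \<and> real CARD('d) \<le> d' \<and>
     (\<forall>x\<in>infinite_cluster a.
        (\<exists>N. \<forall>n\<ge>N.
           inverse C_reg * real n ^ CARD('d) \<le> real (card (graph_ball a x (real n))) \<and>
           real (card (graph_ball a x (real n))) \<le> C_reg * real n ^ CARD('d)) \<and>
        (\<exists>N. \<forall>n\<ge>N. \<forall>u :: int ^ 'd \<Rightarrow> real.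
           (\<forall>y\<in>infinite_cluster a - graph_ball a x (real n). u y = 0) \<longrightarrow>
           avg_norm (ereal (d' / (d' - 1))) u (graph_ball a x (real n))
             \<le> C_S * (real n / real (card (graph_ball a x (real n)))) *
               (\<Sum>\<^sub>\<infinity>(y, z)\<in>{(y, z). y \<in> infinite_cluster a \<and> z \<in> infinite_cluster a \<and>
                                {y, z} \<in> open_edges a}. \<bar>u y - u z\<bar>)))"

definition integrable_config ::
    "((int ^ 'd) set \<Rightarrow> real) \<Rightarrow> (int ^ 'd \<Rightarrow> real) \<Rightarrow> ereal \<Rightarrow> ereal \<Rightarrow> real \<Rightarrow> bool" where
  "integrable_config a \<kappa> p q C_int \<longleftrightarrow>
     (\<forall>x\<in>infinite_cluster a. \<exists>N :: nat.
        (SUP n\<in>{N..}. ereal (Max {avg_norm p (mu a) (graph_ball a x (real n)),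
                                   avg_norm q (nu a) (graph_ball a x (real n)),
                                   avg_norm p \<kappa> (graph_ball a x (real n)),
                                   avg_norm 1 (\<lambda>y. 1 / \<kappa> y) (graph_ball a x (real n))}))
          \<le> ereal C_int)"


section \<open>The random walk with killing and its Green's function\<close>

text \<open>
  The chain with generator
  \<open>(L f) x = (\<Sum>y | adj a x y. a {x, y} * (f y - f x)) - h * \<kappa> x * f x\<close> is realised through its
  jump chain and holding times: at \<open>x\<close> it waits an exponential time of parameter
  \<open>exit_rate a \<kappa> h x\<close> and then moves to a neighbour \<open>y\<close>, or to the cemetery \<open>None\<close>, with
  probability proportional to \<open>a {x, y}\<close>, respectively \<open>h * \<kappa> x\<close>.
\<close>

definition exit_rate :: "((int ^ 'd) set \<Rightarrow> real) \<Rightarrow> (int ^ 'd \<Rightarrow> real) \<Rightarrow> real \<Rightarrow> int ^ 'd \<Rightarrow> real" where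
  "exit_rate a \<kappa> h x = mu a x + h * \<kappa> x"

definition jump_prob ::
    "((int ^ 'd) set \<Rightarrow> real) \<Rightarrow> (int ^ 'd \<Rightarrow> real) \<Rightarrow> real \<Rightarrow> int ^ 'd \<Rightarrow> (int ^ 'd) option \<Rightarrow> real" where
  "jump_prob a \<kappa> h x s =
     (case s of None \<Rightarrow> h * \<kappa> x / exit_rate a \<kappa> h x
      | Some y \<Rightarrow> if adj a x y then a {x, y} / exit_rate a \<kappa> h x else 0)"

definition jump_pmf ::
    "((int ^ 'd) set \<Rightarrow> real) \<Rightarrow> (int ^ 'd \<Rightarrow> real) \<Rightarrow> real \<Rightarrow> int ^ 'd \<Rightarrow> (int ^ 'd) option pmf" where
  "jump_pmf a \<kappa> h x = embed_pmf (jump_prob a \<kappa> h x)"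

text \<open>
  The sample space carries independent variables: for every step \<open>k\<close> and site \<open>x\<close> a successor of
  \<open>x\<close>, to be used if the chain is at \<open>x\<close> after \<open>k\<close> jumps, and for every \<open>k\<close> a standard
  exponential variable.
\<close>

type_synonym 'd sample = "(nat \<times> (int ^ 'd) \<Rightarrow> (int ^ 'd) option) \<times> (nat \<Rightarrow> real)"

definition walk_space ::
    "((int ^ 'd) set \<Rightarrow> real) \<Rightarrow> (int ^ 'd \<Rightarrow> real) \<Rightarrow> real \<Rightarrow> 'd sample measure" where
  "walk_space a \<kappa> h =
     PiM UNIV (\<lambda>(k, x). measure_pmf (jump_pmf a \<kappa> h x)) \<Otimes>\<^sub>M
     PiM UNIV (\<lambda>k. density lborel (\<lambda>s. ennreal (exponential_density 1 s)))"

primrec jump_chain :: "int ^ 'd \<Rightarrow> nat \<Rightarrow> 'd sample \<Rightarrow> (int ^ 'd) option" where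
  "jump_chain x 0 w = Some x"
| "jump_chain x (Suc k) w = Option.bind (jump_chain x k w) (\<lambda>z. fst w (k, z))"

text \<open>Holding times in the absorbing cemetery are irrelevant; they get rate \<open>1\<close>.\<close>

definition jump_time ::
    "((int ^ 'd) set \<Rightarrow> real) \<Rightarrow> (int ^ 'd \<Rightarrow> real) \<Rightarrow> real \<Rightarrow> int ^ 'd \<Rightarrow> nat \<Rightarrow> 'd sample \<Rightarrow> real" where
  "jump_time a \<kappa> h x k w =
     (\<Sum>i<k. snd w i / (case jump_chain x i w of None \<Rightarrow> 1 | Some z \<Rightarrow> exit_rate a \<kappa> h z))"

text \<open>
  After its jump times are exhausted (explosion) the walk is put into the cemetery, which gives
  the minimal chain. Since the cemetery is absorbing, \<open>walk a \<kappa> h x t w = Some y\<close>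
  says both that the walk is at \<open>y\<close> at time \<open>t\<close> and that it has not been killed by time \<open>t\<close>.
\<close>

definition walk ::
    "((int ^ 'd) set \<Rightarrow> real) \<Rightarrow> (int ^ 'd \<Rightarrow> real) \<Rightarrow> real \<Rightarrow> int ^ 'd \<Rightarrow> real \<Rightarrow> 'd sample \<Rightarrow>
     (int ^ 'd) option" where
  "walk a \<kappa> h x t w =
     (if \<exists>k. t < jump_time a \<kappa> h x (Suc k) w
      then jump_chain x (LEAST k. t < jump_time a \<kappa> h x (Suc k) w) w
      else None)"

definition green ::
    "((int ^ 'd) set \<Rightarrow> real) \<Rightarrow> (int ^ 'd \<Rightarrow> real) \<Rightarrow> real \<Rightarrow> int ^ 'd \<Rightarrow> int ^ 'd \<Rightarrow> ennreal" where
  "green a \<kappa> h x y =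
     (\<integral>\<^sup>+t\<in>{0..}. emeasure (walk_space a \<kappa> h)
                   {w \<in> space (walk_space a \<kappa> h). walk a \<kappa> h x t w = Some y} \<partial>lborel)"


text \<open>
  The encodings above are not degenerate: the jump probabilities do form a probability mass
  function wherever the exit rate is positive (in particular on the infinite cluster), and the
  events in the definition of \<open>green\<close> are measurable.
\<close>

lemma finite_adj: "finite {y :: int ^ 'd. adj a x y}"
proof (rule finite_subset)
  show "{y. adj a x y} \<subseteq> vec_lambda ` (PiE UNIV (\<lambda>i. {x $ i - 1..x $ i + 1}))"
  proof
    fix y assume "y \<in> {y. adj a x y}"
    then obtain u v where uv: "{x, y} = {u, v}" "(\<Sum>i\<in>UNIV. \<bar>u $ i - v $ i\<bar>) = 1"
      by (auto simp: adj_def open_edges_def nn_edges_def)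
    have "(\<Sum>i\<in>UNIV. \<bar>x $ i - y $ i\<bar>) = 1"
      using uv by (auto simp: doubleton_eq_iff abs_minus_commute)
    moreover have "\<bar>x $ i - y $ i\<bar> \<le> (\<Sum>i\<in>UNIV. \<bar>x $ i - y $ i\<bar>)" for i
      by (rule member_le_sum) simp_all
    ultimately have *: "\<bar>x $ i - y $ i\<bar> \<le> 1" for i
      by simp
    have "y $ i \<in> {x $ i - 1..x $ i + 1}" for i
      using *[of i] by (auto simp: abs_le_iff)
    then have "vec_nth y \<in> PiE UNIV (\<lambda>i. {x $ i - 1..x $ i + 1})" by auto
    then show "y \<in> vec_lambda ` (PiE UNIV (\<lambda>i. {x $ i - 1..x $ i + 1}))"
      by (rule image_eqI[rotated]) (simp add: vec_nth_inverse)
  qed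
qed (simp add: finite_PiE)

lemma pmf_jump_pmf:
  assumes "0 \<le> h" "0 \<le> \<kappa> x" "0 < exit_rate a \<kappa> h x"
  shows "pmf (jump_pmf a \<kappa> h x) s = jump_prob a \<kappa> h x s"
  unfolding jump_pmf_def
proof (rule pmf_embed_pmf)
  let ?A = "insert None (Some ` {y. adj a x y})"
  show nn: "0 \<le> jump_prob a \<kappa> h x s" for s
    using assms by (auto simp: jump_prob_def adj_def open_edges_def split: option.splits)
  have "(\<integral>\<^sup>+s. ennreal (jump_prob a \<kappa> h x s) \<partial>count_space UNIV)
      = (\<Sum>s\<in>?A. ennreal (jump_prob a \<kappa> h x s))"
    by (rule nn_integral_count_space') (auto simp: finite_adj jump_prob_def split: option.splits)
  also have "\<dots> = ennreal (\<Sum>s\<in>?A. jump_prob a \<kappa> h x s)"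
    by (rule sum_ennreal) (rule nn)
  also have "(\<Sum>s\<in>?A. jump_prob a \<kappa> h x s)
      = h * \<kappa> x / exit_rate a \<kappa> h x + (\<Sum>y | adj a x y. a {x, y} / exit_rate a \<kappa> h x)"
    by (subst sum.insert) (auto simp: finite_adj sum.reindex jump_prob_def)
  also have "\<dots> = exit_rate a \<kappa> h x / exit_rate a \<kappa> h x"
    by (simp only: exit_rate_def mu_def sum_divide_distrib add_divide_distrib add.commute)
  also have "\<dots> = 1"
    using assms by simp
  finally show "(\<integral>\<^sup>+s. ennreal (jump_prob a \<kappa> h x s) \<partial>count_space UNIV) = 1" by simp
qed

lemma measurable_jump_chain[measurable]:
  "jump_chain x k \<in> measurable (walk_space a \<kappa> h) (count_space UNIV)"
proof (induction k)
  case 0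
  have "jump_chain x 0 = (\<lambda>w. Some x)" by (rule ext) simp
  then show ?case by simp
next
  case (Suc k)
  have [measurable]: "(\<lambda>w. fst w (k, z)) \<in> measurable (walk_space a \<kappa> h) (count_space UNIV)" for z
    unfolding walk_space_def
    by (rule measurable_compose[OF measurable_fst])
       (rule measurable_compose[OF measurable_component_singleton[where i="(k,z)"]], auto)
  have *: "(\<lambda>w. case s of None \<Rightarrow> None | Some z \<Rightarrow> fst w (k, z))
      \<in> measurable (walk_space a \<kappa> h) (count_space UNIV)" for s
    by (cases s) simp_all
  have "(\<lambda>w. (\<lambda>s w. case s of None \<Rightarrow> None | Some z \<Rightarrow> fst w (k, z)) (jump_chain x k w) w)
      \<in> measurable (walk_space a \<kappa> h) (count_space UNIV)"
    by (rule measurable_compose_countable'[where I = UNIV, OF * Suc]) simp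
  also have "(\<lambda>w. (\<lambda>s w. case s of None \<Rightarrow> None | Some z \<Rightarrow> fst w (k, z)) (jump_chain x k w) w)
      = jump_chain x (Suc k)"
    by (rule ext) (simp split: option.split)
  finally show ?case .
qed

lemma measurable_jump_time[measurable]:
  "jump_time a \<kappa> h x k \<in> borel_measurable (walk_space a \<kappa> h)"
proof -
  have [measurable]: "(\<lambda>w. snd w i) \<in> borel_measurable (walk_space a \<kappa> h)" for i
    unfolding walk_space_def
    by (rule measurable_compose[OF measurable_snd])
       (rule measurable_compose[OF measurable_component_singleton[where i=i]], auto)
  have [measurable]: "(\<lambda>w. case jump_chain x i w of None \<Rightarrow> 1 | Some z \<Rightarrow> exit_rate a \<kappa> h z)
      \<in> borel_measurable (walk_space a \<kappa> h)" for i
    by (rule measurable_compose[OF measurable_jump_chain]) simp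
  show ?thesis
    unfolding jump_time_def[abs_def] by (intro borel_measurable_sum borel_measurable_divide) measurable
qed

lemma measurable_walk: "walk a \<kappa> h x t \<in> measurable (walk_space a \<kappa> h) (count_space UNIV)"
proof -
  have lt: "Measurable.pred (walk_space a \<kappa> h) (\<lambda>w. t < jump_time a \<kappa> h x (Suc k) w)" for k
    by (intro borel_measurable_const measurable_jump_time borel_measurable_pred_less)
  have ex: "Measurable.pred (walk_space a \<kappa> h) (\<lambda>w. \<exists>k. t < jump_time a \<kappa> h x (Suc k) w)"
    by (intro pred_intros_countable lt)
  have least: "(\<lambda>w. LEAST k. t < jump_time a \<kappa> h x (Suc k) w)
      \<in> measurable (walk_space a \<kappa> h) (count_space UNIV)"
    by (rule measurable_Least) (rule lt)
  have "(\<lambda>w. jump_chain x (LEAST k. t < jump_time a \<kappa> h x (Suc k) w) w)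
      \<in> measurable (walk_space a \<kappa> h) (count_space UNIV)"
    by (rule measurable_compose_countable'[where I = UNIV, OF measurable_jump_chain least]) simp
  then show ?thesis
    unfolding walk_def[abs_def]
    by (intro measurable_If ex[unfolded pred_def] measurable_const) simp_all
qed

lemma prob_space_walk_space: "prob_space (walk_space a \<kappa> h)"
  unfolding walk_space_def
  by (intro prob_space_pair prob_space_PiM)
     (auto split: prod.splits intro: prob_space_measure_pmf prob_space_exponential_density)


section \<open>The killing distance and the correction factor\<close>

definition kappa_dist ::
    "((int ^ 'd) set \<Rightarrow> real) \<Rightarrow> (int ^ 'd \<Rightarrow> real) \<Rightarrow> int ^ 'd \<Rightarrow> int ^ 'd \<Rightarrow> real" where
  "kappa_dist a \<kappa> x y =
     (INF zs\<in>open_paths a x y. \<Sum>i<length zs - 1.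
        sqrt (min 1 (min (\<kappa> (zs ! i)) (\<kappa> (zs ! Suc i)) / a {zs ! i, zs ! Suc i})))"

definition F :: "real \<Rightarrow> real \<Rightarrow> ennreal" where
  "F \<gamma> r = (if r = 0 then \<infinity> else ennreal ((1 + r) powr \<gamma> * (1 + 1 / r) powr (1 / 2)))"

end

theory Submission
  imports Defs
begin
text \<open>
  Exhausting the cluster by finite balls reduces the claim to the Green kernel of a finite matrix.
  The local Sobolev inequality and the bound on \<open>\<nu>\<close> give an energy Sobolev inequality;
  Moser iteration, with the bound on \<open>\<mu>\<close>, then bounds a nonnegative subharmonic function at
  a point by its average over a ball of radius \<open>R\<close> inside a ball of radius \<open>N\<close>, with a constant
  polynomial in \<open>N / R\<close>. Applied in both variables, this bounds \<open>g(x, y)\<close> by a double average of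
  the kernel over balls around \<open>x\<close> and \<open>y\<close>. All balls lie in balls centred at \<open>x\<close>, so regularity
  near \<open>y\<close> is never needed.

  Write \<open>l\<close> for the distance of \<open>x\<close> and \<open>y\<close> and \<open>r = h * l ^ 2\<close>. If \<open>r \<ge> 1\<close>, the ball around \<open>x\<close> is
  taken of radius of order \<open>1 / sqrt h\<close>. The weight \<open>exp (- lam * sqrt h * kappa_dist x z)\<close> is bounded
  below there, so Agmon's \<open>L\<^sup>2\<close> estimate, where the killing absorbs the gradient of the weight,
  yields the exponential factor, and the loss from the small radius is a power of \<open>r\<close>.
  If \<open>r \<le> 1\<close>, the exponential factor is bounded below and only \<open>r powr (-1/2)\<close> may be lost; here the
  double average is estimated separately for the kernel of a ball of intermediate radius
  \<open>l * r powr (-1/4)\<close> and for the remainder, which is harmonic in that ball.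
\<close>

section \<open>Inequalities for powers, averages and exponentials\<close>

text \<open>The mean value inequality bounds a value by an average of the first power, not of the
  square. Only in this form do the bounds in the two variables compose to a plain double sum of the
  kernel, and such a sum over \<open>X\<close> and \<open>Y\<close> is the sum over \<open>X\<close>
  of the solution with source the indicator of \<open>Y\<close>, which energy methods reach. No
  pointwise lower bound on \<open>\<kappa>\<close> is available. Agmon's estimate carries the weight
  \<open>h * \<kappa>\<close>, so Cauchy-Schwarz at the source and at the target leaves only sums of
  \<open>1 / (h * \<kappa>)\<close> over balls, which the average of \<open>1 / \<kappa>\<close>
  controls. The price is a factor \<open>1 / h = l ^ 2 / r\<close>: harmless for
  \<open>r \<ge> 1\<close>, but for \<open>r \<le> 1\<close> too large by
  \<open>r powr (-1/2)\<close>. The kernel of a ball of radius \<open>R\<close> avoids this price,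
  since Poincare bounds its double average by order \<open>R ^ 2 / l ^ d\<close>. The remainder has
  no pole in that ball, so it may be averaged at scale \<open>R\<close>, and \<open>1 / h\<close>
  gets divided by \<open>R ^ d\<close> instead of \<open>l ^ d\<close>. The radius
  \<open>l * r powr (-1/4)\<close> makes the first bound equal to the target; for the second,
  \<open>R ^ d \<ge> R ^ 2 * l ^ (d - 2)\<close> is then enough.\<close>

lemma powr_tangent_le:
  fixes v w \<alpha> :: real
  assumes "1 \<le> \<alpha>" "0 \<le> v" "0 \<le> w"
  shows "w powr \<alpha> + \<alpha> * w powr (\<alpha> - 1) * (v - w) \<le> v powr \<alpha>"
proof (cases "w = 0 \<or> \<alpha> = 1")
  case True
  then show ?thesis using assms by auto
next
  case False
  then have w: "0 < w" and \<alpha>: "1 < \<alpha>" using assms by auto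
  define q where "q = \<alpha> / (\<alpha> - 1)"
  have q: "1 < q" "1 / \<alpha> + 1 / q = 1" using \<alpha> by (auto simp: q_def field_simps)
  have "v * w powr (\<alpha> - 1) \<le> v powr \<alpha> / \<alpha> + (w powr (\<alpha> - 1)) powr q / q"
    using Youngs_inequality[OF \<alpha> q assms(2), of "w powr (\<alpha> - 1)"] by simp
  also have "(w powr (\<alpha> - 1)) powr q = w powr \<alpha>"
    using \<alpha> by (simp add: powr_powr q_def)
  also have "v powr \<alpha> / \<alpha> + w powr \<alpha> / q = (v powr \<alpha> + (\<alpha> - 1) * w powr \<alpha>) / \<alpha>"
    using \<alpha> by (simp add: q_def field_simps)
  finally have "\<alpha> * (v * w powr (\<alpha> - 1)) \<le> v powr \<alpha> + (\<alpha> - 1) * w powr \<alpha>"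
    using \<alpha> by (simp add: field_simps)
  moreover have "w powr (\<alpha> - 1) * w = w powr \<alpha>"
    using w by (simp add: powr_diff)
  ultimately show ?thesis by (simp add: algebra_simps)
qed

text \<open>A chain rule for powers: the tangent inequality at either end bounds the difference of
  one sign, and the sum of the two slopes covers both signs.\<close>

lemma abs_powr_diff_le:
  fixes x y s :: real
  assumes "1 \<le> s"
  shows "\<bar>\<bar>x\<bar> powr s - \<bar>y\<bar> powr s\<bar>
    \<le> s * (\<bar>x\<bar> powr (s - 1) + \<bar>y\<bar> powr (s - 1)) * \<bar>x - y\<bar>"
proof -
  have *: "X powr s - Y powr s \<le> s * (X powr (s - 1) + Y powr (s - 1)) * \<bar>x - y\<bar>"
    if "0 \<le> X" "0 \<le> Y" "\<bar>X - Y\<bar> \<le> \<bar>x - y\<bar>" for X Y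
  proof -
    have "X powr s - Y powr s \<le> s * X powr (s - 1) * (X - Y)"
      using powr_tangent_le[OF assms that(2) that(1)] by (simp add: algebra_simps)
    also have "\<dots> \<le> s * X powr (s - 1) * \<bar>x - y\<bar>"
      using assms that by (intro mult_left_mono) auto
    also have "\<dots> \<le> s * (X powr (s - 1) + Y powr (s - 1)) * \<bar>x - y\<bar>"
      using assms by (intro mult_right_mono mult_left_mono) auto
    finally show ?thesis .
  qed
  show ?thesis
    using *[of "\<bar>x\<bar>" "\<bar>y\<bar>"] *[of "\<bar>y\<bar>" "\<bar>x\<bar>"] abs_triangle_ineq3[of x y]
    by (simp add: abs_minus_commute add.commute abs_le_iff[of "_ powr _ - _"])
qed

section \<open>Hoelder, Jensen and nesting inequalities for normalised sums\<close>

lemma sum_mult_le_Holder: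
  fixes f g :: "'v \<Rightarrow> real"
  assumes fin: "finite A" and pq: "1 < p" "1 < q" "1 / p + 1 / q = 1"
    and nn: "\<And>x. x \<in> A \<Longrightarrow> 0 \<le> f x" "\<And>x. x \<in> A \<Longrightarrow> 0 \<le> g x"
  shows "(\<Sum>x\<in>A. f x * g x)
    \<le> (\<Sum>x\<in>A. f x powr p) powr (1 / p) * (\<Sum>x\<in>A. g x powr q) powr (1 / q)"
proof -
  define X where "X = (\<Sum>x\<in>A. f x powr p)"
  define Y where "Y = (\<Sum>x\<in>A. g x powr q)"
  have XY: "0 \<le> X" "0 \<le> Y" unfolding X_def Y_def by (auto intro: sum_nonneg)
  show ?thesis
  proof (cases "X = 0 \<or> Y = 0")
    case True
    then have "f x * g x = 0" if "x \<in> A" for x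
      using that fin pq unfolding X_def Y_def by (auto simp: sum_nonneg_eq_0_iff)
    then have "(\<Sum>x\<in>A. f x * g x) = 0" by (intro sum.neutral ballI)
    then show ?thesis by simp
  next
    case False
    then have XY': "0 < X" "0 < Y" using XY by auto
    define a where "a = X powr (1 / p)"
    define b where "b = Y powr (1 / q)"
    have ab: "0 < a" "0 < b" using XY' by (auto simp: a_def b_def)
    have ap: "a powr p = X" and bq: "b powr q = Y"
      using XY' pq by (auto simp: a_def b_def powr_powr)
    have "(\<Sum>x\<in>A. f x / a * (g x / b)) \<le> (\<Sum>x\<in>A. (f x / a) powr p / p + (g x / b) powr q / q)"
      using nn ab by (intro sum_mono Youngs_inequality pq) auto
    also have "\<dots> = (\<Sum>x\<in>A. f x powr p / X / p + g x powr q / Y / q)"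
      using nn ab ap bq by (intro sum.cong) (auto simp: powr_divide)
    also have "\<dots> = X / X / p + Y / Y / q"
      by (simp add: sum.distrib sum_divide_distrib[symmetric] X_def Y_def)
    also have "\<dots> = 1" using XY' pq by simp
    finally have "(\<Sum>x\<in>A. f x * g x) / (a * b) \<le> 1"
      by (simp add: sum_divide_distrib field_simps)
    then show ?thesis using ab by (simp add: field_simps a_def b_def X_def Y_def)
  qed
qed

lemma avg_mult_le_Holder:
  fixes f g :: "'v \<Rightarrow> real"
  assumes fin: "finite A" and b: "0 < b" and pq: "1 < p" "1 < q" "1 / p + 1 / q = 1"
    and nn: "\<And>x. x \<in> A \<Longrightarrow> 0 \<le> f x" "\<And>x. x \<in> A \<Longrightarrow> 0 \<le> g x"
  shows "(\<Sum>x\<in>A. f x * g x) / b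
    \<le> ((\<Sum>x\<in>A. f x powr p) / b) powr (1 / p) * ((\<Sum>x\<in>A. g x powr q) / b) powr (1 / q)"
proof -
  have "b powr (1 / p) * b powr (1 / q) = b"
    using b pq by (simp add: powr_add[symmetric])
  then have "((\<Sum>x\<in>A. f x powr p) / b) powr (1 / p) * ((\<Sum>x\<in>A. g x powr q) / b) powr (1 / q)
     = ((\<Sum>x\<in>A. f x powr p) powr (1 / p) * (\<Sum>x\<in>A. g x powr q) powr (1 / q)) / b"
    using b by (simp add: powr_divide sum_nonneg field_simps)
  then show ?thesis
    using sum_mult_le_Holder[OF fin pq nn] b by (simp add: divide_right_mono)
qed

lemma avg_powr_le_avg_powr:
  fixes f :: "'v \<Rightarrow> real"
  assumes fin: "finite A" and s: "1 \<le> s" and nn: "\<And>x. x \<in> A \<Longrightarrow> 0 \<le> f x" and b: "real (card A) \<le> b" "0 < b"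
  shows "(\<Sum>x\<in>A. f x) / b \<le> ((\<Sum>x\<in>A. f x powr s) / b) powr (1 / s)"
proof (cases "s = 1")
  case True
  then show ?thesis using nn b by (simp add: sum_nonneg)
next
  case False
  then have s: "1 < s" using s by auto
  define q where "q = s / (s - 1)"
  have q: "1 < q" "1 / s + 1 / q = 1" using s by (auto simp: q_def field_simps)
  have "(\<Sum>x\<in>A. f x * 1) / b
    \<le> ((\<Sum>x\<in>A. f x powr s) / b) powr (1 / s) * ((\<Sum>x\<in>A. 1 powr q) / b) powr (1 / q)"
    using nn by (intro avg_mult_le_Holder fin b s q) auto
  also have "\<dots> \<le> ((\<Sum>x\<in>A. f x powr s) / b) powr (1 / s) * 1"
    using q b by (intro mult_left_mono) (auto intro!: powr_le1)
  finally show ?thesis by simp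
qed

text \<open>Every single \<open>f x\<close> is at most the \<open>s\<close>-norm \<open>M\<close>,
  so the surplus power \<open>t - s\<close> can be taken out as a power of \<open>M\<close>.\<close>

lemma sum_powr_le_sum_powr:
  fixes f :: "'v \<Rightarrow> real"
  assumes fin: "finite A" and st: "0 < s" "s \<le> t" and nn: "\<And>x. x \<in> A \<Longrightarrow> 0 \<le> f x"
  shows "(\<Sum>x\<in>A. f x powr t) powr (1 / t) \<le> (\<Sum>x\<in>A. f x powr s) powr (1 / s)"
proof -
  define X where "X = (\<Sum>x\<in>A. f x powr s)"
  define M where "M = X powr (1 / s)"
  have X: "0 \<le> X" by (auto simp: X_def intro: sum_nonneg)
  have M: "0 \<le> M" "M powr s = X" using st X by (auto simp: M_def powr_powr)
  have "f x powr t \<le> M powr (t - s) * f x powr s" if "x \<in> A" for x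
  proof (cases "f x = 0")
    case False
    then have fx: "0 < f x" using nn[OF that] by auto
    have "f x powr s \<le> X" unfolding X_def using fin that by (intro member_le_sum) auto
    then have "(f x powr s) powr (1 / s) \<le> M" unfolding M_def using st by (intro powr_mono2) auto
    then have "f x \<le> M" using fx st by (simp add: powr_powr)
    then have "f x powr (t - s) \<le> M powr (t - s)" using fx st by (intro powr_mono2) auto
    then have "f x powr (t - s) * f x powr s \<le> M powr (t - s) * f x powr s"
      by (intro mult_right_mono) auto
    then show ?thesis using fx by (simp add: powr_add[symmetric])
  qed (use st in simp)
  then have "(\<Sum>x\<in>A. f x powr t) \<le> (\<Sum>x\<in>A. M powr (t - s) * f x powr s)" by (rule sum_mono)
  also have "\<dots> = M powr (t - s) * M powr s" by (simp add: sum_distrib_left[symmetric] X_def[symmetric] M)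
  also have "\<dots> = M powr t" by (simp add: powr_add[symmetric])
  finally have "(\<Sum>x\<in>A. f x powr t) powr (1 / t) \<le> (M powr t) powr (1 / t)"
    using st by (intro powr_mono2) (auto intro: sum_nonneg)
  also have "\<dots> = M" using st M by (simp add: powr_powr)
  finally show ?thesis by (simp add: M_def X_def)
qed

text \<open>The right-hand side is a product of the two values because the product rule for the
  energy produces exactly such a term. The constant is \<open>exp 1 \<le> 3\<close>, the price of
  replacing the larger exponential by the smaller one.\<close>

lemma exp_diff_squared_le:
  fixes s t :: real
  assumes "\<bar>s - t\<bar> \<le> 1"
  shows "(exp s - exp t)\<^sup>2 \<le> 3 * (s - t)\<^sup>2 * (exp s * exp t)"
proof -
  have *: "(exp s - exp t)\<^sup>2 \<le> 3 * (s - t)\<^sup>2 * (exp s * exp t)" if "t \<le> s" "s \<le> t + 1" for s t :: real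
  proof -
    have "1 + (t - s) \<le> exp (t - s)" by (rule exp_ge_add_one_self)
    then have "exp s * (1 - exp (t - s)) \<le> exp s * (s - t)" by (intro mult_left_mono) (linarith, simp)
    then have "exp s - exp t \<le> exp s * (s - t)" by (simp add: algebra_simps exp_add[symmetric])
    then have "(exp s - exp t)\<^sup>2 \<le> (exp s * (s - t))\<^sup>2" using that by (intro power_mono) auto
    also have "\<dots> = (s - t)\<^sup>2 * (exp s * exp s)" by (simp add: power2_eq_square)
    also have "\<dots> \<le> (s - t)\<^sup>2 * (exp s * (3 * exp t))"
    proof (intro mult_left_mono)
      have "exp s \<le> exp (1 + t)" using that by simp
      also have "\<dots> = exp 1 * exp t" by (rule exp_add)
      also have "\<dots> \<le> 3 * exp t" using exp_le by (intro mult_right_mono) auto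
      finally show "exp s \<le> 3 * exp t" .
    qed simp_all
    finally show ?thesis by (simp add: algebra_simps)
  qed
  show ?thesis
  proof (cases "t \<le> s")
    case True then show ?thesis using * assms by auto
  next
    case False then show ?thesis using *[of s t] assms
      by (simp add: power2_commute mult.commute)
  qed
qed

section \<open>Energy forms and the Sobolev inequality\<close>

locale weighted_graph =
  fixes V :: "'v set" and c :: "'v \<Rightarrow> 'v \<Rightarrow> real"
  assumes finite_V: "finite V"
    and c_nonneg: "0 \<le> c y z"
    and c_sym: "c y z = c z y"
begin

text \<open>The sum runs over ordered pairs and is thus twice the usual Dirichlet form; this
  explains the factors 2 below.\<close>

definition energy :: "('v \<Rightarrow> real) \<Rightarrow> real" where
  "energy w = (\<Sum>y\<in>V. \<Sum>z\<in>V. c y z * (w y - w z)\<^sup>2)"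

definition laplace :: "('v \<Rightarrow> real) \<Rightarrow> 'v \<Rightarrow> real" where
  "laplace u y = (\<Sum>z\<in>V. c y z * (u z - u y))"

lemma energy_nonneg: "0 \<le> energy w"
  unfolding energy_def by (intro sum_nonneg mult_nonneg_nonneg c_nonneg) auto

lemma summation_by_parts:
  "(\<Sum>y\<in>V. \<Sum>z\<in>V. c y z * ((u y - u z) * (v y - v z))) = - 2 * (\<Sum>y\<in>V. v y * laplace u y)"
proof -
  have 1: "(\<Sum>y\<in>V. \<Sum>z\<in>V. c y z * (u y - u z) * v y) = - (\<Sum>y\<in>V. v y * laplace u y)"
    unfolding laplace_def sum_negf[symmetric] sum_distrib_left
    by (intro sum.cong refl) (simp add: algebra_simps)
  have 2: "(\<Sum>y\<in>V. \<Sum>z\<in>V. c y z * (u z - u y) * v z) = (\<Sum>y\<in>V. \<Sum>z\<in>V. c y z * (u y - u z) * v y)"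
    by (subst sum.swap) (simp add: c_sym)
  have "(\<Sum>y\<in>V. \<Sum>z\<in>V. c y z * ((u y - u z) * (v y - v z)))
     = (\<Sum>y\<in>V. \<Sum>z\<in>V. c y z * (u y - u z) * v y) + (\<Sum>y\<in>V. \<Sum>z\<in>V. c y z * (u z - u y) * v z)"
    unfolding sum.distrib[symmetric] by (intro sum.cong refl) (simp add: algebra_simps)
  then show ?thesis using 1 2 by simp
qed

text \<open>An exact product rule, the common root of two estimates: the Caccioppoli inequality
  drops the last term by its sign, Agmon's estimate drops the energy on the left.\<close>

lemma energy_mult:
  "energy (\<lambda>y. \<eta> y * U y)
    = (\<Sum>y\<in>V. \<Sum>z\<in>V. c y z * (U y * U z * (\<eta> y - \<eta> z)\<^sup>2)) - 2 * (\<Sum>y\<in>V. (\<eta> y)\<^sup>2 * U y * laplace U y)"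
proof -
  have "energy (\<lambda>y. \<eta> y * U y)
    = (\<Sum>y\<in>V. \<Sum>z\<in>V. c y z * (U y * U z * (\<eta> y - \<eta> z)\<^sup>2))
      + (\<Sum>y\<in>V. \<Sum>z\<in>V. c y z * ((U y - U z) * ((\<eta> y)\<^sup>2 * U y - (\<eta> z)\<^sup>2 * U z)))"
    unfolding energy_def sum.distrib[symmetric]
    by (intro sum.cong refl) (simp add: algebra_simps power2_eq_square)
  then show ?thesis using summation_by_parts[of U "\<lambda>y. (\<eta> y)\<^sup>2 * U y"] by simp
qed

text \<open>Caccioppoli's inequality. Subharmonicity is required only where the cutoff does not
  vanish.\<close>

lemma energy_cutoff_le:
  assumes "\<And>y. y \<in> V \<Longrightarrow> 0 \<le> U y" "\<And>y. y \<in> V \<Longrightarrow> \<eta> y \<noteq> 0 \<Longrightarrow> 0 \<le> laplace U y"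
  shows "energy (\<lambda>y. \<eta> y * U y) \<le> (\<Sum>y\<in>V. \<Sum>z\<in>V. c y z * (U y * U z * (\<eta> y - \<eta> z)\<^sup>2))"
proof -
  have "0 \<le> (\<Sum>y\<in>V. (\<eta> y)\<^sup>2 * U y * laplace U y)"
  proof (rule sum_nonneg)
    fix y assume "y \<in> V"
    then show "0 \<le> (\<eta> y)\<^sup>2 * U y * laplace U y"
      using assms[of y] by (cases "\<eta> y = 0") auto
  qed
  then show ?thesis by (simp add: energy_mult)
qed

text \<open>Powers of a subharmonic function are subharmonic, so the Moser iteration needs no
  exponent-dependent energy estimate.\<close>

lemma laplace_powr_nonneg:
  assumes "1 \<le> \<alpha>" "y \<in> V" "\<And>z. z \<in> V \<Longrightarrow> 0 \<le> u z" "0 \<le> laplace u y"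
  shows "0 \<le> laplace (\<lambda>z. u z powr \<alpha>) y"
proof -
  have "0 \<le> \<alpha> * u y powr (\<alpha> - 1) * laplace u y"
    using assms by simp
  also have "\<dots> = (\<Sum>z\<in>V. c y z * (\<alpha> * u y powr (\<alpha> - 1) * (u z - u y)))"
    by (simp add: laplace_def sum_distrib_left algebra_simps)
  also have "\<dots> \<le> laplace (\<lambda>z. u z powr \<alpha>) y"
    unfolding laplace_def
  proof (intro sum_mono mult_left_mono c_nonneg)
    fix z assume "z \<in> V"
    then show "\<alpha> * u y powr (\<alpha> - 1) * (u z - u y) \<le> u z powr \<alpha> - u y powr \<alpha>"
      using powr_tangent_le[of \<alpha> "u z" "u y"] assms by simp
  qed
  finally show ?thesis .
qed

text \<open>The Sobolev inequality for sums of absolute gradients is applied to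
  \<open>\<bar>w\<bar> powr s\<close>. Cauchy-Schwarz splits the gradient into the energy of
  \<open>w\<close> and a sum of \<open>\<bar>w\<bar> powr (2 * (s - 1))\<close> weighted by inverse
  conductances; Hoelder with exponent \<open>q\<close> removes the weight. The value of
  \<open>\<rho>\<close> makes the power \<open>2 * \<rho>\<close> appear on both sides, so that the
  average \<open>Y\<close> can be divided out.\<close>

lemma energy_Sobolev:
  assumes B: "B \<subseteq> V" "B \<noteq> {}" and d': "2 < d'" and q: "1 < q" and \<rho>: "1 / \<rho> = 1 - 2 / d' + 1 / q" "1 \<le> \<rho>"
    and b: "b = real (card B)" and C: "0 \<le> CS" "0 \<le> C2" "0 \<le> N"
    and Sob: "\<And>v. (\<And>y. y \<notin> B \<Longrightarrow> v y = 0) \<Longrightarrow>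
      ((\<Sum>y\<in>B. \<bar>v y\<bar> powr (d' / (d' - 1))) / b) powr (1 / (d' / (d' - 1)))
        \<le> CS * (N / b) * (\<Sum>y\<in>V. \<Sum>z\<in>V. if 0 < c y z then \<bar>v y - v z\<bar> else 0)"
    and nu: "((\<Sum>y\<in>B. (\<Sum>z\<in>V. 1 / c y z) powr q) / b) powr (1 / q) \<le> C2"
    and w: "\<And>y. y \<notin> B \<Longrightarrow> w y = 0"
  shows "((\<Sum>y\<in>B. \<bar>w y\<bar> powr (2 * \<rho>)) / b) powr (1 / \<rho>)
    \<le> (4 * \<rho> * CS)\<^sup>2 * C2 * (N\<^sup>2 / b) * energy w"
proof -
  define \<tau> where "\<tau> = d' / (d' - 1)"
  \<comment> \<open>Chosen so that \<open>s * \<tau> = 2 * \<rho>\<close>; the formula for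
    \<open>\<rho>\<close> then also gives \<open>2 * (s - 1) * q' = 2 * \<rho>\<close>.\<close>
  define s where "s = 2 * \<rho> / \<tau>"
  define q' where "q' = q / (q - 1)"
  define Y where "Y = (\<Sum>y\<in>B. \<bar>w y\<bar> powr (2 * \<rho>)) / b"
  define n where "n y = (\<Sum>z\<in>V. 1 / c y z)" for y
  define Z where "Z = (\<Sum>y\<in>V. \<Sum>z\<in>V. if 0 < c y z then \<bar>w y\<bar> powr (s - 1) * \<bar>w y - w z\<bar> else 0)"
  have finB: "finite B" using B finite_V finite_subset by blast
  have bpos: "0 < b" using B finB by (simp add: b card_gt_0_iff)
  have q': "1 < q'" "1 / q + 1 / q' = 1" using q by (auto simp: q'_def field_simps)
  have \<tau>: "1 < \<tau>" "1 / \<tau> = 1 - 1 / d'" using d' by (auto simp: \<tau>_def field_simps)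
  have s_eq: "s = 2 * \<rho> * (1 - 1 / d')" using \<tau> by (simp add: s_def divide_inverse)
  have "\<rho> * (1 - 2 / d' + 1 / q) = 1" unfolding \<rho>(1)[symmetric] using \<rho>(2) by simp
  moreover have "\<rho> / q' = \<rho> * (1 - 1 / q)" using q'(2) by (metis add_diff_cancel_left' times_divide_eq_right mult.right_neutral)
  ultimately have s1: "s - 1 = \<rho> / q'" using s_eq by (simp add: algebra_simps)
  have "0 < \<rho> / q'" using \<rho> q' by simp
  then have s: "1 < s" using s1 by linarith
  have "1 / d' > 0" using d' by simp
  then have s2: "s \<le> 2 * \<rho>" using s_eq \<rho> by (simp add: mult_le_cancel_left1)
  have s\<tau>: "s * \<tau> = 2 * \<rho>" using \<tau> by (simp add: s_def)
  have Z0: "0 \<le> Z" unfolding Z_def by (intro sum_nonneg) auto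
  have Y0: "0 \<le> Y" unfolding Y_def using bpos by (intro divide_nonneg_nonneg sum_nonneg) auto
  have grad: "(\<Sum>y\<in>V. \<Sum>z\<in>V. if 0 < c y z then \<bar>\<bar>w y\<bar> powr s - \<bar>w z\<bar> powr s\<bar> else 0) \<le> 2 * s * Z"
  proof -
    have "(\<Sum>y\<in>V. \<Sum>z\<in>V. if 0 < c y z then \<bar>\<bar>w y\<bar> powr s - \<bar>w z\<bar> powr s\<bar> else 0)
      \<le> (\<Sum>y\<in>V. \<Sum>z\<in>V. s * (if 0 < c y z then \<bar>w y\<bar> powr (s - 1) * \<bar>w y - w z\<bar> else 0)
                     + s * (if 0 < c z y then \<bar>w z\<bar> powr (s - 1) * \<bar>w z - w y\<bar> else 0))"
    proof (intro sum_mono)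
      fix y z
      show "(if 0 < c y z then \<bar>\<bar>w y\<bar> powr s - \<bar>w z\<bar> powr s\<bar> else 0)
        \<le> s * (if 0 < c y z then \<bar>w y\<bar> powr (s - 1) * \<bar>w y - w z\<bar> else 0)
          + s * (if 0 < c z y then \<bar>w z\<bar> powr (s - 1) * \<bar>w z - w y\<bar> else 0)"
        using abs_powr_diff_le[of s "w y" "w z"] s
        by (auto simp: c_sym[of z y] abs_minus_commute[of "w z"] algebra_simps)
    qed
    also have "\<dots> = s * Z + s * (\<Sum>y\<in>V. \<Sum>z\<in>V. if 0 < c z y then \<bar>w z\<bar> powr (s - 1) * \<bar>w z - w y\<bar> else 0)"
      by (simp only: sum.distrib sum_distrib_left[symmetric] Z_def)
    also have "(\<Sum>y\<in>V. \<Sum>z\<in>V. if 0 < c z y then \<bar>w z\<bar> powr (s - 1) * \<bar>w z - w y\<bar> else 0) = Z"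
      unfolding Z_def by (rule sum.swap)
    finally show ?thesis by (simp add: algebra_simps)
  qed
  have Zsq: "Z\<^sup>2 \<le> energy w * (\<Sum>y\<in>B. n y * \<bar>w y\<bar> powr (2 * (s - 1)))"
  proof -
    have "Z = (\<Sum>(y, z)\<in>V\<times>V. (sqrt (c y z) * \<bar>w y - w z\<bar>) * (\<bar>w y\<bar> powr (s - 1) / sqrt (c y z)))"
      unfolding Z_def sum.cartesian_product
      by (intro sum.cong refl) (use c_nonneg in \<open>auto simp: less_le\<close>)
    then have "Z\<^sup>2 \<le> (\<Sum>(y, z)\<in>V\<times>V. (sqrt (c y z) * \<bar>w y - w z\<bar>)\<^sup>2)
      * (\<Sum>(y, z)\<in>V\<times>V. (\<bar>w y\<bar> powr (s - 1) / sqrt (c y z))\<^sup>2)"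
      using Cauchy_Schwarz_ineq_sum[of "\<lambda>(y, z). sqrt (c y z) * \<bar>w y - w z\<bar>"
          "\<lambda>(y, z). \<bar>w y\<bar> powr (s - 1) / sqrt (c y z)" "V \<times> V"]
      by (simp add: case_prod_beta)
    also have "(\<Sum>(y, z)\<in>V\<times>V. (sqrt (c y z) * \<bar>w y - w z\<bar>)\<^sup>2) = energy w"
      unfolding energy_def sum.cartesian_product using c_nonneg
      by (intro sum.cong refl) (auto simp: power_mult_distrib)
    also have "(\<Sum>(y, z)\<in>V\<times>V. (\<bar>w y\<bar> powr (s - 1) / sqrt (c y z))\<^sup>2)
      = (\<Sum>y\<in>V. n y * \<bar>w y\<bar> powr (2 * (s - 1)))"
      unfolding n_def sum_distrib_right sum.cartesian_product using c_nonneg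
      by (intro sum.cong refl)
         (auto simp: power_divide powr_add[symmetric] power2_eq_square[of "_ powr _"])
    also have "\<dots> = (\<Sum>y\<in>B. n y * \<bar>w y\<bar> powr (2 * (s - 1)))"
      using w B by (intro sum.mono_neutral_right finite_V) auto
    finally show ?thesis .
  qed
  have "(\<Sum>y\<in>B. n y * \<bar>w y\<bar> powr (2 * (s - 1))) / b
    \<le> ((\<Sum>y\<in>B. n y powr q) / b) powr (1 / q) * ((\<Sum>y\<in>B. (\<bar>w y\<bar> powr (2 * (s - 1))) powr q') / b) powr (1 / q')"
    using q q' bpos c_nonneg by (intro avg_mult_le_Holder finB) (auto simp: n_def intro!: sum_nonneg)
  also have "(\<Sum>y\<in>B. (\<bar>w y\<bar> powr (2 * (s - 1))) powr q') / b = Y"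
    using q' s1 by (simp add: powr_powr Y_def)
  also have "((\<Sum>y\<in>B. n y powr q) / b) powr (1 / q) * Y powr (1 / q') \<le> C2 * Y powr (1 / q')"
    using nu by (intro mult_right_mono) (auto simp: n_def)
  finally have nw: "(\<Sum>y\<in>B. n y * \<bar>w y\<bar> powr (2 * (s - 1))) \<le> b * (C2 * Y powr (1 / q'))"
    using bpos by (simp add: field_simps)
  have "Y powr (1 / \<tau>) = ((\<Sum>y\<in>B. \<bar>\<bar>w y\<bar> powr s\<bar> powr \<tau>) / b) powr (1 / \<tau>)"
    by (simp add: Y_def powr_powr s\<tau>)
  also have "\<dots> \<le> CS * (N / b) * (\<Sum>y\<in>V. \<Sum>z\<in>V. if 0 < c y z then \<bar>\<bar>w y\<bar> powr s - \<bar>w z\<bar> powr s\<bar> else 0)"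
    using s w unfolding \<tau>_def by (intro Sob) auto
  also have "\<dots> \<le> CS * (N / b) * (2 * s * Z)"
    using C bpos by (intro mult_left_mono grad) auto
  finally have "(Y powr (1 / \<tau>))\<^sup>2 \<le> (CS * (N / b) * (2 * s * Z))\<^sup>2"
    by (intro power_mono) auto
  also have "\<dots> = (2 * s * CS * (N / b))\<^sup>2 * Z\<^sup>2"
    by (simp add: power2_eq_square)
  also have "\<dots> \<le> (2 * s * CS * (N / b))\<^sup>2 * (energy w * (b * (C2 * Y powr (1 / q'))))"
    using Zsq nw energy_nonneg[of w] by (intro mult_left_mono order_trans[OF Zsq]) auto
  also have "\<dots> = ((2 * s * CS)\<^sup>2 * C2 * (N\<^sup>2 / b) * energy w) * Y powr (1 / q')"
    using bpos by (simp add: power_mult_distrib power_divide power2_eq_square)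
  finally have main: "(Y powr (1 / \<tau>))\<^sup>2 \<le> ((2 * s * CS)\<^sup>2 * C2 * (N\<^sup>2 / b) * energy w) * Y powr (1 / q')" .
  have "Y powr (1 / \<rho>) \<le> (2 * s * CS)\<^sup>2 * C2 * (N\<^sup>2 / b) * energy w"
  proof (cases "Y = 0")
    case True
    then show ?thesis using C bpos energy_nonneg[of w] by simp
  next
    case False
    then have Y: "0 < Y" using Y0 by simp
    have "(Y powr (1 / \<tau>))\<^sup>2 = Y powr (1 / \<tau> + 1 / \<tau>)"
      by (simp only: power2_eq_square powr_add)
    \<comment> \<open>The two powers of \<open>Y\<close> differ by exactly
      \<open>1 / \<rho>\<close>, the power wanted on the left.\<close>
    also have "1 / \<tau> + 1 / \<tau> = 1 / \<rho> + 1 / q'"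
      using \<tau> \<rho> q' by simp
    finally have "Y powr (1 / \<rho>) * Y powr (1 / q')
      \<le> ((2 * s * CS)\<^sup>2 * C2 * (N\<^sup>2 / b) * energy w) * Y powr (1 / q')"
      using main by (simp add: powr_add)
    then show ?thesis by (rule mult_right_le_imp_le) (use Y in simp)
  qed
  also have "(2 * s * CS)\<^sup>2 * C2 * (N\<^sup>2 / b) * energy w \<le> (4 * \<rho> * CS)\<^sup>2 * C2 * (N\<^sup>2 / b) * energy w"
    using s s2 C bpos energy_nonneg[of w]
    by (intro mult_right_mono power_mono) auto
  finally show ?thesis by (simp add: Y_def)
qed

end

section \<open>Moser iteration\<close>

text \<open>With \<open>\<sigma> = P / \<rho>\<close> this is \<open>2 * P\<close> times the
  geometric sum \<open>1 / (1 - \<sigma>)\<close>: the sum collects the powers of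
  \<open>N / R\<close> over all iteration steps, and \<open>2 * P\<close> is the cost of passing
  from an average of \<open>2 * P\<close>-th powers to one of first powers.\<close>

definition moser_exp :: "real \<Rightarrow> real \<Rightarrow> real" where
  "moser_exp P \<rho> = 2 * P / (1 - P / \<rho>)"

text \<open>The factors \<open>K powr (s / 2)\<close> and \<open>2 powr s\<^sup>2\<close> accumulate
  in the iteration; \<open>2 powr (2 * P * s)\<close> is lost when the shell up to the boundary is
  halved in \<open>mean_value\<close>.\<close>

definition moser_const :: "real \<Rightarrow> real \<Rightarrow> real \<Rightarrow> real" where
  "moser_const K P \<rho> = (let s = 1 / (1 - P / \<rho>) in
     (K powr (s / 2) * 2 powr (s\<^sup>2) * 2 powr (2 * P * s)) powr (2 * P))"

text \<open>Exactly the data that the iteration consumes. The two lower bounds on \<open>K\<close>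
  serve wide and thin shells respectively, and \<open>vol\<close> is what pays for the thin
  ones.\<close>

locale regular_ball = weighted_graph V c for V :: "'v set" and c :: "'v \<Rightarrow> 'v \<Rightarrow> real" +
  fixes B :: "'v set" and N b p P \<rho> CS C2 C3 K :: real
  assumes B: "B \<subseteq> V" "B \<noteq> {}" and b: "b = real (card B)" and N: "1 \<le> N"
    and p: "1 < p" "1 < P" "1 / p + 1 / P = 1" and \<rho>: "P < \<rho>"
    and nonneg: "0 \<le> CS" "0 \<le> C2" "0 \<le> C3"
    and K: "1 \<le> K" "4 * CS * C2 \<le> K" "4 * C3 \<le> K"
    and Sobolev: "(\<And>y. y \<notin> B \<Longrightarrow> w y = 0) \<Longrightarrow>
      ((\<Sum>y\<in>B. \<bar>w y\<bar> powr (2 * \<rho>)) / b) powr (1 / \<rho>) \<le> CS * (N\<^sup>2 / b) * energy w"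
    and mu: "((\<Sum>y\<in>B. (\<Sum>z\<in>V. c y z) powr p) / b) powr (1 / p) \<le> C2"
    and vol: "b powr (1 / P - 1 / \<rho>) \<le> C3 * N\<^sup>2"
begin

lemma finite_B: "finite B" using B finite_V finite_subset by blast

lemma b_pos: "0 < b" using B finite_B by (simp add: b card_gt_0_iff)

end

text \<open>\<open>\<delta>\<close> stands for the distance from the point of interest, which need
  not be the centre of \<open>B\<close>; it suffices that its sublevel set of radius
  \<open>R\<close> lies in \<open>B\<close>.\<close>

locale subharmonic = regular_ball V c B N b p P \<rho> CS C2 C3 K
  for V :: "'v set" and c :: "'v \<Rightarrow> 'v \<Rightarrow> real" and B N b p P \<rho> CS C2 C3 K +
  fixes \<delta> u :: "'v \<Rightarrow> real" and R :: real
  assumes \<delta>_nonneg: "y \<in> V \<Longrightarrow> 0 \<le> \<delta> y"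
    and \<delta>_lipschitz: "y \<in> V \<Longrightarrow> z \<in> V \<Longrightarrow> 0 < c y z \<Longrightarrow> \<bar>\<delta> y - \<delta> z\<bar> \<le> 1"
    and R: "0 < R" "R \<le> N"
    and u_nonneg: "y \<in> V \<Longrightarrow> 0 \<le> u y"
    and u_sub: "y \<in> V \<Longrightarrow> \<delta> y \<le> R \<Longrightarrow> y \<in> B \<and> 0 \<le> laplace u y"
begin

definition S :: "real \<Rightarrow> 'v set" where
  "S r = {y \<in> V. \<delta> y \<le> r}"

text \<open>All averages are divided by the volume of \<open>B\<close>, not of \<open>S r\<close>,
  so no volume bound for the small sets enters.\<close>

definition avg :: "real \<Rightarrow> real \<Rightarrow> real" where
  "avg r t = (\<Sum>y\<in>S r. u y powr t) / b"

lemma finite_S: "finite (S r)" using finite_V by (simp add: S_def)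

lemma S_subset_B: "r \<le> R \<Longrightarrow> S r \<subseteq> B" using u_sub by (force simp: S_def)

lemma S_mono: "r \<le> r' \<Longrightarrow> S r \<subseteq> S r'" by (auto simp: S_def)

lemma avg_nonneg: "0 \<le> avg r t"
  using b_pos by (auto simp: avg_def intro!: divide_nonneg_nonneg sum_nonneg)

section \<open>Gain of integrability in one step\<close>

text \<open>With \<open>U = u powr (t / (2 * P))\<close> the Sobolev inequality bounds the average
  of \<open>U powr (2 * \<rho>)\<close> by the energy of the cut-off \<open>U\<close>; Caccioppoli
  and Hoelder with the row sums of \<open>c\<close> bound that energy by the average of
  \<open>U powr (2 * P)\<close>. The exponent of \<open>u\<close> grows by
  \<open>\<rho> / P > 1\<close>.\<close>

lemma moser_step_large:
  assumes r: "r + 2 \<le> r'" "r' \<le> R" and t: "2 * P \<le> t"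
  shows "avg r (\<rho> / P * t) powr (1 / \<rho>) \<le> 4 * CS * C2 * (N / (r' - r))\<^sup>2 * avg r' t powr (1 / P)"
proof -
  define \<Delta> where "\<Delta> = r' - r"
  define \<alpha> where "\<alpha> = t / (2 * P)"
  define U where "U y = u y powr \<alpha>" for y
  \<comment> \<open>The cutoff dies at \<open>r' - 1\<close> rather than \<open>r'\<close>, so that
    an edge along which it varies has both ends in \<open>S r'\<close>. The slope
    \<open>1 / (\<Delta> - 1)\<close> is at most \<open>2 / \<Delta>\<close> because
    \<open>\<Delta> \<ge> 2\<close>.\<close>
  define \<eta> where "\<eta> y = (if y \<in> V then max 0 (min 1 ((r' - 1 - \<delta> y) / (\<Delta> - 1))) else 0)" for y
  define J where "J y = (if y \<in> S r' then (U y)\<^sup>2 else 0)" for y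
  have \<Delta>: "2 \<le> \<Delta>" using r by (simp add: \<Delta>_def)
  have P0: "0 < P" "0 < \<rho>" using p \<rho> by auto
  have \<alpha>: "1 \<le> \<alpha>" using t P0 by (simp add: \<alpha>_def)
  have supp: "y \<in> S (r' - 1)" if "\<eta> y \<noteq> 0" for y
    using that \<Delta> by (auto simp: \<eta>_def S_def max_def min_def field_simps split: if_splits)
  have \<eta>1: "\<eta> y = 1" if "y \<in> S r" for y
    using that \<Delta> by (auto simp: \<eta>_def S_def \<Delta>_def)
  have lip: "\<bar>\<eta> y - \<eta> z\<bar> \<le> 2 / \<Delta>" if "y \<in> V" "z \<in> V" "0 < c y z" for y z
  proof -
    have "\<bar>\<eta> y - \<eta> z\<bar> \<le> \<bar>(r' - 1 - \<delta> y) / (\<Delta> - 1) - (r' - 1 - \<delta> z) / (\<Delta> - 1)\<bar>"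
      using that by (simp add: \<eta>_def)
    also have "\<dots> = \<bar>\<delta> z - \<delta> y\<bar> / (\<Delta> - 1)"
      using \<Delta> by (simp add: diff_divide_distrib[symmetric] abs_divide)
    also have "\<dots> \<le> 1 / (\<Delta> - 1)"
      using \<delta>_lipschitz[OF that] \<Delta> by (intro divide_right_mono) auto
    also have "\<dots> \<le> 2 / \<Delta>" using \<Delta> by (simp add: field_simps)
    finally show ?thesis .
  qed
  have "energy (\<lambda>y. \<eta> y * U y) \<le> (\<Sum>y\<in>V. \<Sum>z\<in>V. c y z * (U y * U z * (\<eta> y - \<eta> z)\<^sup>2))"
  proof (rule energy_cutoff_le)
    fix y assume y: "y \<in> V" "\<eta> y \<noteq> 0"
    then have "\<delta> y \<le> R" using supp[of y] r by (auto simp: S_def)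
    then show "0 \<le> laplace U y"
      unfolding U_def[abs_def] using y u_sub \<alpha> u_nonneg by (intro laplace_powr_nonneg) auto
  qed (simp add: U_def)
  also have "\<dots> \<le> (\<Sum>y\<in>V. \<Sum>z\<in>V. c y z * ((2 / \<Delta>)\<^sup>2 * ((J y + J z) / 2)))"
  proof (intro sum_mono)
    fix y z assume yz: "y \<in> V" "z \<in> V"
    show "c y z * (U y * U z * (\<eta> y - \<eta> z)\<^sup>2) \<le> c y z * ((2 / \<Delta>)\<^sup>2 * ((J y + J z) / 2))"
    proof (cases "0 < c y z \<and> \<eta> y \<noteq> \<eta> z")
      case False
      then show ?thesis using c_nonneg[of y z] by (auto simp: J_def not_less)
    next
      case True
      then have "\<eta> y \<noteq> 0 \<or> \<eta> z \<noteq> 0" by auto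
      then have "y \<in> S r' \<and> z \<in> S r'"
        using supp[of y] supp[of z] \<delta>_lipschitz[of y z] True yz by (elim disjE) (auto simp: S_def)
      then have J: "J y = (U y)\<^sup>2" "J z = (U z)\<^sup>2" by (auto simp: J_def)
      have "U y * U z \<le> (J y + J z) / 2"
        unfolding J using sum_squares_bound[of "U y" "U z"] by simp
      moreover have "(\<eta> y - \<eta> z)\<^sup>2 \<le> (2 / \<Delta>)\<^sup>2"
        using lip[OF yz] True \<Delta> power_mono[of "\<bar>\<eta> y - \<eta> z\<bar>" "2 / \<Delta>" 2] by simp
      ultimately have "U y * U z * (\<eta> y - \<eta> z)\<^sup>2 \<le> (J y + J z) / 2 * (2 / \<Delta>)\<^sup>2"
        by (intro mult_mono) (auto simp: J)
      then show ?thesis using c_nonneg by (intro mult_left_mono) (auto simp: mult.commute)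
    qed
  qed
  also have "\<dots> = (2 / \<Delta>)\<^sup>2 * (\<Sum>y\<in>B. (\<Sum>z\<in>V. c y z) * J y)"
  proof -
    have "(\<Sum>y\<in>V. \<Sum>z\<in>V. c y z * J z) = (\<Sum>y\<in>V. \<Sum>z\<in>V. c y z * J y)"
      by (subst sum.swap) (simp add: c_sym)
    moreover have "c y z * ((2 / \<Delta>)\<^sup>2 * ((J y + J z) / 2))
      = (2 / \<Delta>)\<^sup>2 / 2 * (c y z * J y) + (2 / \<Delta>)\<^sup>2 / 2 * (c y z * J z)" for y z
      by (simp add: algebra_simps)
    ultimately have "(\<Sum>y\<in>V. \<Sum>z\<in>V. c y z * ((2 / \<Delta>)\<^sup>2 * ((J y + J z) / 2))) = (2 / \<Delta>)\<^sup>2 * (\<Sum>y\<in>V. \<Sum>z\<in>V. c y z * J y)"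
      by (simp only: sum.distrib sum_distrib_left[symmetric])
    also have "(\<Sum>y\<in>V. \<Sum>z\<in>V. c y z * J y) = (\<Sum>y\<in>B. (\<Sum>z\<in>V. c y z) * J y)"
      unfolding sum_distrib_right using B S_subset_B[of r'] r
      by (intro sum.mono_neutral_right finite_V) (auto simp: J_def)
    finally show ?thesis .
  qed
  finally have en: "energy (\<lambda>y. \<eta> y * U y) \<le> (2 / \<Delta>)\<^sup>2 * (\<Sum>y\<in>B. (\<Sum>z\<in>V. c y z) * J y)" .
  have "(\<Sum>y\<in>B. (\<Sum>z\<in>V. c y z) * J y) / b
    \<le> ((\<Sum>y\<in>B. (\<Sum>z\<in>V. c y z) powr p) / b) powr (1 / p) * ((\<Sum>y\<in>B. J y powr P) / b) powr (1 / P)"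
    using p b_pos c_nonneg by (intro avg_mult_le_Holder finite_B) (auto simp: J_def intro!: sum_nonneg)
  also have "\<dots> \<le> C2 * ((\<Sum>y\<in>B. J y powr P) / b) powr (1 / P)"
    using mu by (intro mult_right_mono) auto
  also have "(\<Sum>y\<in>B. J y powr P) = (\<Sum>y\<in>S r'. u y powr t)"
  proof -
    have "(\<Sum>y\<in>B. J y powr P) = (\<Sum>y\<in>S r'. J y powr P)"
      using S_subset_B[of r'] r by (intro sum.mono_neutral_right finite_B) (auto simp: J_def)
    also have "\<dots> = (\<Sum>y\<in>S r'. u y powr t)"
    proof (intro sum.cong refl)
      fix y assume "y \<in> S r'"
      then have "J y powr P = (u y powr (\<alpha> + \<alpha>)) powr P"
        by (simp only: J_def U_def power2_eq_square powr_add if_True)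
      also have "\<dots> = u y powr t" using P0 by (simp add: powr_powr \<alpha>_def)
      finally show "J y powr P = u y powr t" .
    qed
    finally show ?thesis .
  qed
  finally have hol: "(\<Sum>y\<in>B. (\<Sum>z\<in>V. c y z) * J y) / b \<le> C2 * avg r' t powr (1 / P)"
    by (simp add: avg_def)
  have "avg r (\<rho> / P * t) \<le> (\<Sum>y\<in>B. \<bar>\<eta> y * U y\<bar> powr (2 * \<rho>)) / b"
  proof -
    have "(\<Sum>y\<in>S r. u y powr (\<rho> / P * t)) = (\<Sum>y\<in>S r. \<bar>\<eta> y * U y\<bar> powr (2 * \<rho>))"
      using P0 by (intro sum.cong refl) (simp add: \<eta>1 U_def powr_powr \<alpha>_def mult.commute)
    also have "\<dots> \<le> (\<Sum>y\<in>B. \<bar>\<eta> y * U y\<bar> powr (2 * \<rho>))"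
      using S_subset_B[of r] r by (intro sum_mono2 finite_B) auto
    finally show ?thesis using b_pos by (simp add: avg_def divide_right_mono)
  qed
  then have "avg r (\<rho> / P * t) powr (1 / \<rho>) \<le> ((\<Sum>y\<in>B. \<bar>\<eta> y * U y\<bar> powr (2 * \<rho>)) / b) powr (1 / \<rho>)"
    using P0 avg_nonneg by (intro powr_mono2) auto
  also have "\<dots> \<le> CS * (N\<^sup>2 / b) * energy (\<lambda>y. \<eta> y * U y)"
  proof (rule Sobolev)
    fix y assume "y \<notin> B"
    then have "y \<notin> S (r' - 1)" using S_subset_B[of "r' - 1"] r by auto
    then show "\<eta> y * U y = 0" using supp[of y] by auto
  qed
  also have "\<dots> \<le> CS * (N\<^sup>2 / b) * ((2 / \<Delta>)\<^sup>2 * (\<Sum>y\<in>B. (\<Sum>z\<in>V. c y z) * J y))"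
    using nonneg b_pos by (intro mult_left_mono en) auto
  also have "\<dots> = CS * N\<^sup>2 * (2 / \<Delta>)\<^sup>2 * ((\<Sum>y\<in>B. (\<Sum>z\<in>V. c y z) * J y) / b)"
    by simp
  also have "\<dots> \<le> CS * N\<^sup>2 * (2 / \<Delta>)\<^sup>2 * (C2 * avg r' t powr (1 / P))"
    using nonneg by (intro mult_left_mono hol) auto
  also have "\<dots> = 4 * CS * C2 * (N / \<Delta>)\<^sup>2 * avg r' t powr (1 / P)"
    by (simp add: power_divide)
  finally show ?thesis by (simp add: \<Delta>_def)
qed

text \<open>On shells thinner than two lattice steps no cutoff is available, but there the inclusion of
  sequence spaces suffices.\<close>

lemma moser_step_small:
  assumes r: "r < r'" "r' < r + 2" "r' \<le> R" and t: "2 * P \<le> t"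
  shows "avg r (\<rho> / P * t) powr (1 / \<rho>) \<le> 4 * C3 * (N / (r' - r))\<^sup>2 * avg r' t powr (1 / P)"
proof -
  define f where "f y = u y powr (t / P)" for y
  have P0: "0 < P" "0 < \<rho>" using p \<rho> by auto
  have fP: "f y powr P = u y powr t" "f y powr \<rho> = u y powr (\<rho> / P * t)" for y
    using P0 by (auto simp: f_def powr_powr mult.commute)
  have "(\<Sum>y\<in>S r. f y powr \<rho>) powr (1 / \<rho>) \<le> (\<Sum>y\<in>S r. f y powr P) powr (1 / P)"
    using P0 \<rho> by (intro sum_powr_le_sum_powr finite_S) (auto simp: f_def)
  also have "\<dots> \<le> (\<Sum>y\<in>S r'. f y powr P) powr (1 / P)"
    using P0 S_mono[of r r'] r by (intro powr_mono2 sum_mono2 finite_S sum_nonneg) auto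
  finally have *: "(\<Sum>y\<in>S r. f y powr \<rho>) powr (1 / \<rho>) \<le> (\<Sum>y\<in>S r'. f y powr P) powr (1 / P)" .
  have "avg r (\<rho> / P * t) powr (1 / \<rho>) = (\<Sum>y\<in>S r. f y powr \<rho>) powr (1 / \<rho>) / b powr (1 / \<rho>)"
    using b_pos by (simp add: avg_def fP powr_divide sum_nonneg)
  also have "\<dots> \<le> (\<Sum>y\<in>S r'. f y powr P) powr (1 / P) / b powr (1 / \<rho>)"
    using * by (intro divide_right_mono) auto
  also have "\<dots> = b powr (1 / P - 1 / \<rho>) * avg r' t powr (1 / P)"
    using b_pos by (simp add: avg_def fP powr_divide sum_nonneg powr_diff)
  also have "\<dots> \<le> (C3 * N\<^sup>2) * avg r' t powr (1 / P)"
    using vol by (intro mult_right_mono) auto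
  also have "\<dots> \<le> 4 * C3 * (N / (r' - r))\<^sup>2 * avg r' t powr (1 / P)"
  proof (intro mult_right_mono)
    have "(r' - r)\<^sup>2 \<le> 2\<^sup>2" using r by (intro power_mono) auto
    then have "N\<^sup>2 * (r' - r)\<^sup>2 \<le> N\<^sup>2 * 4" by (intro mult_left_mono) auto
    then have "N\<^sup>2 \<le> 4 * (N\<^sup>2 / (r' - r)\<^sup>2)" using r by (simp add: field_simps)
    then show "C3 * N\<^sup>2 \<le> 4 * C3 * (N / (r' - r))\<^sup>2"
      using nonneg mult_left_mono[of "N\<^sup>2" "4 * (N\<^sup>2 / (r' - r)\<^sup>2)" C3] by (simp add: power_divide algebra_simps)
  qed auto
  finally show ?thesis .
qed

lemma moser_step:
  assumes r: "r < r'" "r' \<le> R" and t: "2 * P \<le> t"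
  shows "avg r (\<rho> / P * t) powr (1 / \<rho>) \<le> K * (N / (r' - r))\<^sup>2 * avg r' t powr (1 / P)"
proof -
  have *: "c1 * (N / (r' - r))\<^sup>2 * avg r' t powr (1 / P) \<le> K * (N / (r' - r))\<^sup>2 * avg r' t powr (1 / P)"
    if "c1 \<le> K" for c1
    using that by (intro mult_right_mono) auto
  show ?thesis
  proof (cases "r + 2 \<le> r'")
    case True
    show ?thesis by (rule order_trans[OF moser_step_large[OF True r(2) t] *[OF K(2)]])
  next
    case False
    then have "r' < r + 2" by simp
    then show ?thesis by (rule order_trans[OF moser_step_small[OF r(1) _ r(2) t] *[OF K(3)]])
  qed
qed

section \<open>Iteration and the mean value inequality for first powers\<close>

text \<open>Radii decrease geometrically while exponents grow by the factor
  \<open>1 / \<sigma>\<close>. The step with index \<open>k\<close> enters with the power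
  \<open>\<sigma> ^ k / 2\<close>, which keeps the product of all constants bounded.\<close>

lemma moser_iterate:
  assumes r: "r < r'" "r' \<le> R" "0 \<le> r"
  defines "\<sigma> \<equiv> P / \<rho>"
  shows "avg (r + (r' - r) / 2 ^ k) (2 * P / \<sigma> ^ k) powr (\<sigma> ^ k / (2 * P))
    \<le> (K * (N / (r' - r))\<^sup>2) powr ((\<Sum>j<k. \<sigma> ^ j) / 2) * 2 powr (\<Sum>j<k. real (Suc j) * \<sigma> ^ j)
      * avg r' (2 * P) powr (1 / (2 * P))"
proof (induction k)
  case 0
  have "0 < K * (N / (r' - r))\<^sup>2" using K N r by simp
  then show ?case using K N r by simp
next
  case (Suc k)
  define X where "X = K * (N / (r' - r))\<^sup>2"
  define \<Delta> where "\<Delta> = r' - r"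
  define rk where "rk = r + \<Delta> / 2 ^ k"
  define rk' where "rk' = r + \<Delta> / 2 ^ Suc k"
  define t where "t = 2 * P / \<sigma> ^ k"
  have P0: "0 < P" "0 < \<rho>" using p \<rho> by auto
  have \<sigma>: "0 < \<sigma>" "\<sigma> < 1" using P0 \<rho> by (auto simp: \<sigma>_def)
  have \<Delta>: "0 < \<Delta>" using r by (simp add: \<Delta>_def)
  have X: "0 < X" using K N r by (simp add: X_def)
  have rr: "rk' < rk" "rk - rk' = \<Delta> / 2 ^ Suc k"
    using \<Delta> by (auto simp: rk_def rk'_def field_simps)
  have "\<Delta> / 2 ^ k \<le> \<Delta> / 1" using \<Delta> by (intro divide_left_mono) auto
  then have rkR: "rk \<le> R" using r by (simp add: rk_def \<Delta>_def)
  have \<sigma>k: "0 < \<sigma> ^ k" "\<sigma> ^ k \<le> 1" using \<sigma> by (auto intro: power_le_one)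
  have t: "2 * P \<le> t" using P0 \<sigma>k by (simp add: t_def le_divide_eq)
  have t': "\<rho> / P * t = 2 * P / \<sigma> ^ Suc k" using P0 by (simp add: t_def \<sigma>_def)
  have "avg rk' (\<rho> / P * t) powr (1 / \<rho>) \<le> K * (N / (rk - rk'))\<^sup>2 * avg rk t powr (1 / P)"
    using rr rkR t by (intro moser_step)
  \<comment> \<open>The gap halves with each step, so its inverse square quadruples; after raising
    to \<open>\<sigma> ^ k / 2\<close> this is the power \<open>Suc k * \<sigma> ^ k\<close> of
    2.\<close>
  also have "K * (N / (rk - rk'))\<^sup>2 = X * 4 ^ Suc k"
  proof -
    have "N / (rk - rk') = N / \<Delta> * 2 ^ Suc k" unfolding rr(2) by simp
    moreover have "((2::real) ^ Suc k)\<^sup>2 = 4 ^ Suc k"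
      by (subst power_mult[symmetric], subst mult.commute, subst power_mult) simp
    ultimately show ?thesis by (simp only: X_def \<Delta>_def power_mult_distrib mult.assoc)
  qed
  finally have "(avg rk' (\<rho> / P * t) powr (1 / \<rho>)) powr (\<sigma> ^ k / 2)
      \<le> (X * 4 ^ Suc k * avg rk t powr (1 / P)) powr (\<sigma> ^ k / 2)"
    using \<sigma>k by (intro powr_mono2) auto
  also have "\<dots> = X powr (\<sigma> ^ k / 2) * (4 ^ Suc k) powr (\<sigma> ^ k / 2) * avg rk t powr (\<sigma> ^ k / (2 * P))"
    using X by (simp add: powr_mult powr_powr mult.commute)
  also have "(4 ^ Suc k :: real) = (2 powr 2) powr real (Suc k)"
    by (subst powr_realpow) simp_all
  also have "(2 powr 2) powr real (Suc k) = 2 powr (2 * real (Suc k))"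
    by (simp only: powr_powr)
  also have "(2 powr (2 * real (Suc k))) powr (\<sigma> ^ k / 2) = 2 powr (real (Suc k) * \<sigma> ^ k)"
  proof -
    have "2 * real (Suc k) * (\<sigma> ^ k / 2) = real (Suc k) * \<sigma> ^ k" by (simp add: field_simps)
    then show ?thesis by (simp only: powr_powr)
  qed
  also have "(avg rk' (\<rho> / P * t) powr (1 / \<rho>)) powr (\<sigma> ^ k / 2) = avg rk' (2 * P / \<sigma> ^ Suc k) powr (\<sigma> ^ Suc k / (2 * P))"
    unfolding t' using P0 by (simp add: powr_powr \<sigma>_def)
  finally have "avg rk' (2 * P / \<sigma> ^ Suc k) powr (\<sigma> ^ Suc k / (2 * P))
    \<le> X powr (\<sigma> ^ k / 2) * 2 powr (real (Suc k) * \<sigma> ^ k) * avg rk t powr (\<sigma> ^ k / (2 * P))" .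
  also have "\<dots> \<le> X powr (\<sigma> ^ k / 2) * 2 powr (real (Suc k) * \<sigma> ^ k) *
     (X powr ((\<Sum>j<k. \<sigma> ^ j) / 2) * 2 powr (\<Sum>j<k. real (Suc j) * \<sigma> ^ j)
      * avg r' (2 * P) powr (1 / (2 * P)))"
  proof (intro mult_left_mono)
    show "avg rk t powr (\<sigma> ^ k / (2 * P)) \<le> X powr ((\<Sum>j<k. \<sigma> ^ j) / 2)
      * 2 powr (\<Sum>j<k. real (Suc j) * \<sigma> ^ j) * avg r' (2 * P) powr (1 / (2 * P))"
      using Suc.IH unfolding X_def rk_def t_def \<Delta>_def .
  qed simp
  also have "\<dots> = X powr ((\<Sum>j<Suc k. \<sigma> ^ j) / 2) * 2 powr (\<Sum>j<Suc k. real (Suc j) * \<sigma> ^ j)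
      * avg r' (2 * P) powr (1 / (2 * P))"
    by (simp only: sum.lessThan_Suc add_divide_distrib powr_add mult_ac)
  finally show ?case unfolding X_def rk'_def \<Delta>_def .
qed

text \<open>A single term is at most the whole sum, so \<open>u z\<close> is at most the iterated
  average up to \<open>b powr (\<sigma> ^ k / (2 * P))\<close>, and this factor tends to 1. The
  point \<open>z\<close> may lie anywhere in \<open>S r\<close>, as needed for the maximum in
  \<open>mean_value\<close>.\<close>

lemma local_max_le:
  assumes r: "r < r'" "r' \<le> R" "0 \<le> r" and z: "z \<in> S r"
  defines "s \<equiv> 1 / (1 - P / \<rho>)"
  shows "u z \<le> K powr (s / 2) * 2 powr (s\<^sup>2) * (N / (r' - r)) powr s * avg r' (2 * P) powr (1 / (2 * P))"
proof -
  define \<sigma> where "\<sigma> = P / \<rho>"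
  define X where "X = K * (N / (r' - r))\<^sup>2"
  define M where "M = X powr (s / 2) * 2 powr (s\<^sup>2) * avg r' (2 * P) powr (1 / (2 * P))"
  have P0: "0 < P" "0 < \<rho>" using p \<rho> by auto
  have \<sigma>: "0 < \<sigma>" "\<sigma> < 1" using P0 \<rho> by (auto simp: \<sigma>_def)
  \<comment> \<open>Having \<open>1 \<le> X\<close> permits replacing the partial sums in the
    exponents by their limits \<open>s\<close> and \<open>s\<^sup>2\<close>.\<close>
  have "1 \<le> N / (r' - r)" using r R by simp
  then have X: "1 \<le> X" using K mult_mono[of 1 K 1 "(N / (r' - r))\<^sup>2"] by (simp add: X_def)
  have g1: "(\<Sum>j<k. \<sigma> ^ j) \<le> s" for k
    using sum_le_suminf[OF summable_geometric, of \<sigma> "{..<k}"] \<sigma> suminf_geometric[of \<sigma>]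
    by (simp add: s_def \<sigma>_def[symmetric])
  have gs: "(\<lambda>n. real (Suc n) * \<sigma> ^ n) sums (1 / (1 - \<sigma>)\<^sup>2)"
    using geometric_deriv_sums[of \<sigma>] \<sigma> by simp
  have g2: "(\<Sum>j<k. real (Suc j) * \<sigma> ^ j) \<le> s\<^sup>2" for k
    using sum_le_suminf[OF sums_summable[OF gs], of "{..<k}"] \<sigma> sums_unique[OF gs]
    by (simp add: s_def \<sigma>_def[symmetric] power_divide)
  have bound: "u z \<le> b powr (\<sigma> ^ k / (2 * P)) * M" for k
  proof -
    define t where "t = 2 * P / \<sigma> ^ k"
    define rk where "rk = r + (r' - r) / 2 ^ k"
    have \<sigma>k: "0 < \<sigma> ^ k" using \<sigma> by simp
    have t: "0 < t" "1 / t = \<sigma> ^ k / (2 * P)" using P0 \<sigma>k by (auto simp: t_def)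
    have "0 \<le> (r' - r) / 2 ^ k" using r by simp
    moreover have "\<delta> z \<le> r" "z \<in> V" using z by (auto simp: S_def)
    ultimately have "\<delta> z \<le> rk" unfolding rk_def by linarith
    then have zS: "z \<in> S rk" using \<open>z \<in> V\<close> by (simp add: S_def)
    then have "u z powr t \<le> (\<Sum>y\<in>S rk. u y powr t)"
      by (intro member_le_sum finite_S) auto
    then have "u z powr t \<le> b * avg rk t" using b_pos by (simp add: avg_def)
    then have "(u z powr t) powr (1 / t) \<le> (b * avg rk t) powr (1 / t)"
      using t(1) by (intro powr_mono2) auto
    also have "(u z powr t) powr (1 / t) = u z"
      using t(1) u_nonneg z by (auto simp: powr_powr S_def)
    also have "(b * avg rk t) powr (1 / t) = b powr (\<sigma> ^ k / (2 * P)) * avg rk t powr (\<sigma> ^ k / (2 * P))"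
      using b_pos avg_nonneg unfolding t(2) by (simp add: powr_mult)
    also have "avg rk t powr (\<sigma> ^ k / (2 * P)) \<le> X powr ((\<Sum>j<k. \<sigma> ^ j) / 2) * 2 powr (\<Sum>j<k. real (Suc j) * \<sigma> ^ j)
      * avg r' (2 * P) powr (1 / (2 * P))"
      unfolding \<sigma>_def X_def rk_def t_def by (rule moser_iterate[OF r])
    also have "\<dots> \<le> M"
      unfolding M_def using g1[of k] g2[of k] X
      by (intro mult_right_mono mult_mono powr_mono) auto
    finally show ?thesis using b_pos by (simp add: mult_left_mono)
  qed
  have "(\<lambda>k. b powr (\<sigma> ^ k / (2 * P)) * M) \<longlonglongrightarrow> b powr (0 / (2 * P)) * M"
    using b_pos \<sigma> P0 by (intro tendsto_intros LIMSEQ_power_zero) auto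
  then have "u z \<le> b powr (0 / (2 * P)) * M"
    by (rule LIMSEQ_le_const) (use bound in auto)
  moreover have "X powr (s / 2) = K powr (s / 2) * (N / (r' - r)) powr s"
  proof -
    have pos: "0 < N / (r' - r)" using r R by simp
    have "((N / (r' - r))\<^sup>2) powr (s / 2) = (N / (r' - r)) powr (2 * (s / 2))"
      by (simp only: powr_powr[symmetric] powr_numeral[OF order_less_imp_le[OF pos]])
    then show ?thesis unfolding X_def using K by (subst powr_mult) simp_all
  qed
  ultimately show ?thesis using b_pos by (simp add: M_def mult_ac)
qed

text \<open>Instead of a second iteration, \<open>u\<close> is weighted by a power of the relative
  distance to the boundary and evaluated at a maximum point \<open>z\<close> of the product. There
  the local bound reads \<open>T \<le> E * T powr (1 - \<theta>)\<close>, with the powers of the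
  boundary distance cancelling, and \<open>T\<close> can be solved for.\<close>

lemma mean_value:
  assumes x: "x \<in> V" "\<delta> x = 0"
  shows "u x \<le> moser_const K P \<rho> * (N / R) powr moser_exp P \<rho> * ((\<Sum>y\<in>S R. u y) / b)"
proof -
  define s where "s = 1 / (1 - P / \<rho>)"
  define \<theta> where "\<theta> = 1 / (2 * P)"
  \<comment> \<open>The solution of \<open>s + \<beta> * (1 - \<theta>) = \<beta>\<close>, the
    condition for the powers of \<open>R / \<Delta>\<close> to cancel.\<close>
  define \<beta> where "\<beta> = s / \<theta>"
  define C0 where "C0 = K powr (s / 2) * 2 powr (s\<^sup>2)"
  define A where "A = (\<Sum>y\<in>S R. u y) / b"
  define f where "f z = u z * ((R - \<delta> z) / R) powr \<beta>" for z
  define T where "T = Max (f ` S R)"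
  define E where "E = C0 * 2 powr \<beta> * (N / R) powr s * A powr \<theta>"
  have P0: "0 < P" "0 < \<rho>" using p \<rho> by auto
  have s: "0 < s" using P0 \<rho> by (simp add: s_def)
  have \<theta>: "0 < \<theta>" "\<theta> < 1" using p by (auto simp: \<theta>_def)
  have \<beta>: "0 < \<beta>" using s \<theta> by (simp add: \<beta>_def)
  have C0: "0 < C0" using K by (simp add: C0_def)
  have A0: "0 \<le> A" unfolding A_def using b_pos u_nonneg by (intro divide_nonneg_nonneg sum_nonneg) (auto simp: S_def)
  have xS: "x \<in> S R" using x R by (simp add: S_def)
  have fT: "f z \<le> T" if "z \<in> S R" for z
    unfolding T_def using that finite_S by (intro Max_ge) auto
  have "T \<in> f ` S R" unfolding T_def using xS finite_S by (intro Max_in) auto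
  then obtain z where z: "z \<in> S R" "T = f z" by auto
  have ux: "u x \<le> T" using fT[OF xS] x R by (simp add: f_def)
  have "T \<le> E powr (1 / \<theta>)"
  proof (cases "T \<le> 0")
    case True
    then show ?thesis by (meson order_trans powr_ge_zero)
  next
    case False
    then have T: "0 < T" by simp
    have "\<delta> z \<noteq> R" using T z(2) \<beta> R by (auto simp: f_def)
    then have zR: "\<delta> z < R" "0 \<le> \<delta> z" "z \<in> S (\<delta> z)" using z(1) \<delta>_nonneg by (auto simp: S_def)
    \<comment> \<open>Halfway to the boundary: the shell around \<open>z\<close> and the rest up to
      \<open>R\<close> have equal width \<open>\<Delta>\<close>.\<close>
    define r' where "r' = (R + \<delta> z) / 2"
    define \<Delta> where "\<Delta> = r' - \<delta> z"
    have \<Delta>: "0 < \<Delta>" "R - r' = \<Delta>" "R - \<delta> z = 2 * \<Delta>" using zR by (auto simp: \<Delta>_def r'_def field_simps)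
    have r': "\<delta> z < r'" "r' \<le> R" using zR by (auto simp: r'_def)
    have maxu: "u y \<le> T * (R / \<Delta>) powr \<beta>" if "y \<in> S r'" for y
    proof -
      have "u y * (\<Delta> / R) powr \<beta> \<le> f y"
        unfolding f_def using that \<Delta> R \<beta> u_nonneg
        by (intro mult_left_mono powr_mono2 divide_right_mono) (auto simp: S_def)
      also have "\<dots> \<le> T" using that r' S_mono[of r' R] by (intro fT) auto
      finally show ?thesis using \<Delta> R by (simp add: powr_divide field_simps)
    qed
    \<comment> \<open>Interpolation: all but one of the \<open>2 * P\<close> powers of
      \<open>u\<close> are replaced by the bound that maximality of \<open>T\<close> gives on
      \<open>S r'\<close>.\<close>
    have "avg r' (2 * P) \<le> (T * (R / \<Delta>) powr \<beta>) powr (2 * P - 1) * A"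
    proof -
      have "(\<Sum>y\<in>S r'. u y powr (2 * P)) \<le> (\<Sum>y\<in>S r'. (T * (R / \<Delta>) powr \<beta>) powr (2 * P - 1) * u y)"
      proof (intro sum_mono)
        fix y assume y: "y \<in> S r'"
        then have uy: "0 \<le> u y" using u_nonneg by (auto simp: S_def)
        have "u y powr (2 * P) = u y powr (2 * P - 1) * u y"
          using uy by (cases "u y = 0") (auto simp: powr_diff)
        also have "\<dots> \<le> (T * (R / \<Delta>) powr \<beta>) powr (2 * P - 1) * u y"
          using uy maxu[OF y] p by (intro mult_right_mono powr_mono2) auto
        finally show "u y powr (2 * P) \<le> (T * (R / \<Delta>) powr \<beta>) powr (2 * P - 1) * u y" .
      qed
      also have "\<dots> = (T * (R / \<Delta>) powr \<beta>) powr (2 * P - 1) * (\<Sum>y\<in>S r'. u y)"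
        by (simp add: sum_distrib_left)
      also have "\<dots> \<le> (T * (R / \<Delta>) powr \<beta>) powr (2 * P - 1) * (\<Sum>y\<in>S R. u y)"
        using S_mono[of r' R] r' u_nonneg by (intro mult_left_mono sum_mono2 finite_S) (auto simp: S_def)
      finally show ?thesis using b_pos by (simp add: avg_def A_def divide_right_mono)
    qed
    then have "avg r' (2 * P) powr \<theta> \<le> ((T * (R / \<Delta>) powr \<beta>) powr (2 * P - 1) * A) powr \<theta>"
      using \<theta> avg_nonneg by (intro powr_mono2) auto
    also have "\<dots> = (T * (R / \<Delta>) powr \<beta>) powr (1 - \<theta>) * A powr \<theta>"
    proof -
      have "(2 * P - 1) * \<theta> = 1 - \<theta>" using P0 by (simp add: \<theta>_def field_simps)
      moreover have "(Q powr (2 * P - 1) * A) powr \<theta> = Q powr ((2 * P - 1) * \<theta>) * A powr \<theta>" for Q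
        using A0 by (simp add: powr_mult powr_powr)
      ultimately show ?thesis by simp
    qed
    also have "\<dots> = T powr (1 - \<theta>) * (R / \<Delta>) powr (\<beta> * (1 - \<theta>)) * A powr \<theta>"
      using T by (simp add: powr_mult powr_powr)
    finally have av: "avg r' (2 * P) powr \<theta> \<le> T powr (1 - \<theta>) * (R / \<Delta>) powr (\<beta> * (1 - \<theta>)) * A powr \<theta>" .
    have "u z \<le> C0 * (N / \<Delta>) powr s * avg r' (2 * P) powr \<theta>"
      using local_max_le[OF r' zR(2,3)] by (simp add: C0_def s_def \<theta>_def \<Delta>_def)
    also have "\<dots> \<le> C0 * (N / \<Delta>) powr s * (T powr (1 - \<theta>) * (R / \<Delta>) powr (\<beta> * (1 - \<theta>)) * A powr \<theta>)"
      using C0 by (intro mult_left_mono av) auto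
    also have "(N / \<Delta>) powr s = (N / R) powr s * (R / \<Delta>) powr s"
      using R \<Delta> by (simp add: powr_divide)
    finally have uz: "u z \<le> C0 * (N / R) powr s * A powr \<theta> * T powr (1 - \<theta>) * ((R / \<Delta>) powr s * (R / \<Delta>) powr (\<beta> * (1 - \<theta>)))"
      by (simp add: mult_ac)
    have "s + \<beta> * (1 - \<theta>) = \<beta>" using \<theta> by (simp add: \<beta>_def field_simps)
    then have "(R / \<Delta>) powr s * (R / \<Delta>) powr (\<beta> * (1 - \<theta>)) = (R / \<Delta>) powr \<beta>"
      by (simp add: powr_add[symmetric])
    with uz have uz: "u z \<le> C0 * (N / R) powr s * A powr \<theta> * T powr (1 - \<theta>) * (R / \<Delta>) powr \<beta>" by simp
    have "T = u z * (2 powr \<beta> * (\<Delta> / R) powr \<beta>)"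
      using \<Delta> R by (simp add: z(2) f_def powr_mult[symmetric] )
    also have "\<dots> \<le> C0 * (N / R) powr s * A powr \<theta> * T powr (1 - \<theta>) * (R / \<Delta>) powr \<beta> * (2 powr \<beta> * (\<Delta> / R) powr \<beta>)"
      by (intro mult_right_mono uz) auto
    also have "\<dots> = E * T powr (1 - \<theta>) * ((R / \<Delta>) powr \<beta> * (\<Delta> / R) powr \<beta>)"
      by (simp add: E_def mult_ac)
    also have "(R / \<Delta>) powr \<beta> * (\<Delta> / R) powr \<beta> = 1"
      using \<Delta> R by (simp add: powr_divide)
    finally have "T powr \<theta> * T powr (1 - \<theta>) \<le> E * T powr (1 - \<theta>)"
      using T by (simp add: powr_add[symmetric])
    then have "T powr \<theta> \<le> E" by (rule mult_right_le_imp_le) (use T in simp)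
    then have "(T powr \<theta>) powr (1 / \<theta>) \<le> E powr (1 / \<theta>)"
      using \<theta> by (intro powr_mono2) auto
    then show ?thesis using \<theta> T by (simp add: powr_powr)
  qed
  also have "E powr (1 / \<theta>) = (C0 * 2 powr \<beta>) powr (2 * P) * (N / R) powr moser_exp P \<rho> * A"
  proof -
    have "s * (2 * P) = moser_exp P \<rho>" by (simp add: s_def moser_exp_def)
    then show ?thesis
      using A0 C0 P0 by (simp add: E_def \<theta>_def powr_mult powr_powr)
  qed
  also have "(C0 * 2 powr \<beta>) powr (2 * P) = moser_const K P \<rho>"
    by (simp add: moser_const_def Let_def C0_def \<beta>_def s_def \<theta>_def mult_ac)
  finally show ?thesis using ux by (simp add: A_def)
qed

end

section \<open>Green kernels of finite sets\<close>

text \<open>The walk on the finite set \<open>V\<close> has exit rates \<open>m\<close>; the excess of \<open>m\<close> over the total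
  conductance inside \<open>V\<close> acts as killing.\<close>

locale killed_graph = weighted_graph V c for V :: "'v set" and c :: "'v \<Rightarrow> 'v \<Rightarrow> real" +
  fixes m :: "'v \<Rightarrow> real"
  assumes killing: "z \<in> V \<Longrightarrow> (\<Sum>w\<in>V. c z w) < m z"
begin

text \<open>Jacobi iteration from zero for the Green kernel of \<open>W\<close> with pole
  \<open>y\<close> and zero values outside \<open>W\<close>. The rate \<open>m\<close> is not
  adapted to \<open>W\<close>, so leaving \<open>W\<close> acts as killing, and kernels of nested
  sets become comparable term by term.\<close>

primrec green_iter :: "'v set \<Rightarrow> 'v \<Rightarrow> nat \<Rightarrow> 'v \<Rightarrow> real" where
  "green_iter W y 0 z = 0"
| "green_iter W y (Suc j) z =
    (if z \<in> W then ((if z = y then 1 else 0) + (\<Sum>w\<in>W. c z w * green_iter W y j w)) / m z else 0)"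

definition finite_green :: "'v set \<Rightarrow> 'v \<Rightarrow> 'v \<Rightarrow> real" where
  "finite_green W y z = lim (\<lambda>j. green_iter W y j z)"

lemma m_pos: "z \<in> V \<Longrightarrow> 0 < m z"
  using killing[of z] sum_nonneg[of V "c z"] c_nonneg by (meson le_less_trans)

section \<open>Convergence, monotonicity and symmetry of the kernels\<close>

lemma green_iter_nonneg: "W \<subseteq> V \<Longrightarrow> 0 \<le> green_iter W y j z"
proof (induction j arbitrary: z)
  case (Suc j)
  then have "0 \<le> (\<Sum>w\<in>W. c z w * green_iter W y j w)"
    by (intro sum_nonneg mult_nonneg_nonneg c_nonneg) auto
  moreover have "0 \<le> m z" if "z \<in> W" using m_pos[of z] that Suc.prems by auto
  ultimately show ?case by auto
qed simp

lemma green_iter_mono_set: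
  assumes "W \<subseteq> W'" "W' \<subseteq> V"
  shows "green_iter W y j z \<le> green_iter W' y j z"
proof (induction j arbitrary: z)
  case (Suc j)
  show ?case
  proof (cases "z \<in> W")
    case True
    have "(\<Sum>w\<in>W. c z w * green_iter W y j w) \<le> (\<Sum>w\<in>W. c z w * green_iter W' y j w)"
      by (intro sum_mono mult_left_mono Suc c_nonneg)
    also have "\<dots> \<le> (\<Sum>w\<in>W'. c z w * green_iter W' y j w)"
      using assms finite_V finite_subset green_iter_nonneg c_nonneg by (intro sum_mono2) auto
    finally show ?thesis using True assms m_pos[of z] by (auto intro!: divide_right_mono)
  next
    case False
    then show ?thesis using green_iter_nonneg[OF assms(2), of y "Suc j" z] by simp
  qed
qed simp

lemma green_iter_mono: "W \<subseteq> V \<Longrightarrow> green_iter W y j z \<le> green_iter W y (Suc j) z"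
proof (induction j arbitrary: z)
  case 0
  then show ?case using green_iter_nonneg[OF 0, of y "Suc 0" z] by simp
next
  case (Suc j)
  have "(\<Sum>w\<in>W. c z w * green_iter W y j w) \<le> (\<Sum>w\<in>W. c z w * green_iter W y (Suc j) w)"
    by (intro sum_mono mult_left_mono Suc c_nonneg)
  then show ?case using m_pos[of z] Suc.prems
    by (auto simp del: green_iter.simps simp: green_iter.simps(2)[of _ _ "Suc j"] green_iter.simps(2)[of _ _ j z] intro!: divide_right_mono)
qed

text \<open>On a finite set the killing has a positive minimum \<open>\<epsilon>\<close>, and the
  constant \<open>1 / \<epsilon>\<close> is a supersolution. The bound depends on \<open>V\<close>
  and serves convergence only.\<close>

lemma green_iter_bounded:
  assumes W: "W \<subseteq> V"
  shows "\<exists>M. \<forall>j z. green_iter W y j z \<le> M"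
proof (cases "V = {}")
  case True
  then have "green_iter W y j z \<le> 0" for j z
    using W by (cases j) auto
  then show ?thesis by blast
next
  case False
  define \<epsilon> where "\<epsilon> = Min ((\<lambda>z. m z - (\<Sum>w\<in>V. c z w)) ` V)"
  have "\<epsilon> \<in> (\<lambda>z. m z - (\<Sum>w\<in>V. c z w)) ` V"
    unfolding \<epsilon>_def using False finite_V by (intro Min_in) auto
  then have \<epsilon>: "0 < \<epsilon>" using killing by auto
  have \<epsilon>_le: "(\<Sum>w\<in>W. c z w) \<le> m z - \<epsilon>" if "z \<in> V" for z
  proof -
    have "\<epsilon> \<le> m z - (\<Sum>w\<in>V. c z w)"
      unfolding \<epsilon>_def using that finite_V by (intro Min_le) auto
    moreover have "(\<Sum>w\<in>W. c z w) \<le> (\<Sum>w\<in>V. c z w)"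
      using W finite_V c_nonneg by (intro sum_mono2) auto
    ultimately show ?thesis by simp
  qed
  have "green_iter W y j z \<le> 1 / \<epsilon>" for j z
  proof (induction j arbitrary: z)
    case (Suc j)
    show ?case
    proof (cases "z \<in> W")
      case True
      then have z: "z \<in> V" using W by auto
      have "(\<Sum>w\<in>W. c z w * green_iter W y j w) \<le> (\<Sum>w\<in>W. c z w * (1 / \<epsilon>))"
        by (intro sum_mono mult_left_mono Suc c_nonneg)
      also have "\<dots> = (\<Sum>w\<in>W. c z w) / \<epsilon>" by (simp add: sum_divide_distrib)
      also have "\<dots> \<le> (m z - \<epsilon>) / \<epsilon>" using \<epsilon> \<epsilon>_le[OF z] by (intro divide_right_mono) auto
      finally have *: "(\<Sum>w\<in>W. c z w * green_iter W y j w) \<le> (m z - \<epsilon>) / \<epsilon>" .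
      have "(if z = y then 1 else 0) \<le> (1 :: real)" by simp
      then have "(if z = y then 1 else 0) + (\<Sum>w\<in>W. c z w * green_iter W y j w) \<le> 1 + (m z - \<epsilon>) / \<epsilon>"
        using * by (rule add_mono)
      also have "\<dots> = m z / \<epsilon>" using \<epsilon> by (simp add: field_simps)
      finally have "((if z = y then 1 else 0) + (\<Sum>w\<in>W. c z w * green_iter W y j w)) / m z \<le> m z / \<epsilon> / m z"
        using m_pos[OF z] by (intro divide_right_mono) auto
      then show ?thesis using True m_pos[OF z] by simp
    qed (use \<epsilon> in simp)
  qed (use \<epsilon> in simp)
  then show ?thesis by blast
qed

lemma green_iter_tendsto:
  assumes W: "W \<subseteq> V"
  shows "(\<lambda>j. green_iter W y j z) \<longlonglongrightarrow> finite_green W y z"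
proof -
  obtain M where "\<And>j z. green_iter W y j z \<le> M" using green_iter_bounded[OF W] by blast
  moreover have "incseq (\<lambda>j. green_iter W y j z)"
    by (intro incseq_SucI green_iter_mono W)
  ultimately have "convergent (\<lambda>j. green_iter W y j z)"
    by (metis incseq_convergent convergentI)
  then show ?thesis by (simp add: finite_green_def convergent_LIMSEQ_iff)
qed

lemma finite_green_nonneg: "W \<subseteq> V \<Longrightarrow> 0 \<le> finite_green W y z"
  by (rule LIMSEQ_le_const[OF green_iter_tendsto]) (auto intro: green_iter_nonneg)

lemma finite_green_mono:
  "W \<subseteq> W' \<Longrightarrow> W' \<subseteq> V \<Longrightarrow> finite_green W y z \<le> finite_green W' y z"
  by (rule LIMSEQ_le[OF green_iter_tendsto green_iter_tendsto]) (auto intro: green_iter_mono_set)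

lemma finite_green_outside: "W \<subseteq> V \<Longrightarrow> z \<notin> W \<Longrightarrow> finite_green W y z = 0"
proof -
  assume *: "W \<subseteq> V" "z \<notin> W"
  have "green_iter W y j z = 0" for j using * by (cases j) auto
  then have "(\<lambda>j. green_iter W y j z) \<longlonglongrightarrow> 0" by simp
  then show ?thesis using green_iter_tendsto[OF *(1)] LIMSEQ_unique by blast
qed

lemma finite_green_eq:
  assumes W: "W \<subseteq> V" and z: "z \<in> W"
  shows "m z * finite_green W y z = (if z = y then 1 else 0) + (\<Sum>w\<in>V. c z w * finite_green W y w)"
proof -
  have m: "0 < m z" using m_pos z W by auto
  have "(\<lambda>j. m z * green_iter W y (Suc j) z) \<longlonglongrightarrow> m z * finite_green W y z"
    by (intro tendsto_intros LIMSEQ_Suc[OF green_iter_tendsto] W)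
  moreover have "m z * green_iter W y (Suc j) z
      = (if z = y then 1 else 0) + (\<Sum>w\<in>W. c z w * green_iter W y j w)" for j
    using z m by simp
  moreover have "(\<lambda>j. (if z = y then 1 else 0) + (\<Sum>w\<in>W. c z w * green_iter W y j w))
     \<longlonglongrightarrow> (if z = y then 1 else 0) + (\<Sum>w\<in>W. c z w * finite_green W y w)"
    by (intro tendsto_intros green_iter_tendsto W)
  ultimately have "m z * finite_green W y z = (if z = y then 1 else 0) + (\<Sum>w\<in>W. c z w * finite_green W y w)"
    by (simp only: LIMSEQ_unique)
  also have "(\<Sum>w\<in>W. c z w * finite_green W y w) = (\<Sum>w\<in>V. c z w * finite_green W y w)"
    using W finite_V finite_green_outside by (intro sum.mono_neutral_left) auto
  finally show ?thesis .
qed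

text \<open>The sum of \<open>finite_green W y * m * finite_green W z\<close> is expanded by the
  equation of either factor; the conductance terms agree because \<open>c\<close> is symmetric,
  leaving the two values.\<close>

lemma finite_green_sym:
  assumes W: "W \<subseteq> V" and yz: "y \<in> W" "z \<in> W"
  shows "finite_green W y z = finite_green W z y"
proof -
  have finW: "finite W" using W finite_V finite_subset by auto
  have *: "(\<Sum>x\<in>W. finite_green W a x * (m x * finite_green W b x))
    = finite_green W a b + (\<Sum>x\<in>V. \<Sum>w\<in>V. finite_green W a x * c x w * finite_green W b w)"
    if "b \<in> W" for a b
  proof -
    have "(\<Sum>x\<in>W. finite_green W a x * (m x * finite_green W b x))
      = (\<Sum>x\<in>W. (if x = b then finite_green W a x else 0)
           + (\<Sum>w\<in>V. finite_green W a x * c x w * finite_green W b w))"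
      by (intro sum.cong refl) (simp add: finite_green_eq[OF W] algebra_simps sum_distrib_left)
    also have "\<dots> = finite_green W a b + (\<Sum>x\<in>W. \<Sum>w\<in>V. finite_green W a x * c x w * finite_green W b w)"
      using that finW by (simp add: sum.distrib sum.delta')
    also have "(\<Sum>x\<in>W. \<Sum>w\<in>V. finite_green W a x * c x w * finite_green W b w)
      = (\<Sum>x\<in>V. \<Sum>w\<in>V. finite_green W a x * c x w * finite_green W b w)"
      using W finite_V finite_green_outside by (intro sum.mono_neutral_left) auto
    finally show ?thesis .
  qed
  have "(\<Sum>x\<in>V. \<Sum>w\<in>V. finite_green W y x * c x w * finite_green W z w)
    = (\<Sum>x\<in>V. \<Sum>w\<in>V. finite_green W z x * c x w * finite_green W y w)"
    by (subst sum.swap) (simp add: c_sym mult_ac)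
  moreover have "(\<Sum>x\<in>W. finite_green W y x * (m x * finite_green W z x))
    = (\<Sum>x\<in>W. finite_green W z x * (m x * finite_green W y x))"
    by (simp add: mult_ac)
  ultimately show ?thesis using *[OF yz(2), of y] *[OF yz(1), of z] by simp
qed

lemma finite_green_pole_outside: "W \<subseteq> V \<Longrightarrow> y \<notin> W \<Longrightarrow> finite_green W y z = 0"
proof -
  assume *: "W \<subseteq> V" "y \<notin> W"
  have "green_iter W y j z = 0" for j z
    by (induction j arbitrary: z) (use * in auto)
  then have "(\<lambda>j. green_iter W y j z) \<longlonglongrightarrow> 0" by simp
  then show ?thesis using green_iter_tendsto[OF *(1)] LIMSEQ_unique by blast
qed

lemma finite_green_commute: "W \<subseteq> V \<Longrightarrow> finite_green W y z = finite_green W z y"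
  using finite_green_sym finite_green_outside finite_green_pole_outside by metis

lemma laplace_eq:
  assumes "m z * f z = s + (\<Sum>w\<in>V. c z w * f w)"
  shows "laplace f z = (m z - (\<Sum>w\<in>V. c z w)) * f z - s"
  using assms by (simp add: laplace_def algebra_simps sum_subtractf sum_distrib_left)

text \<open>Killing helps: off its pole, a nonnegative solution of the killed equation is
  subharmonic for the operator without killing, so the mean value inequality applies to it.\<close>

lemma laplace_nonneg_of_harmonic:
  assumes "z \<in> V" "0 \<le> f z" "m z * f z = (\<Sum>w\<in>V. c z w * f w)"
  shows "0 \<le> laplace f z"
  using laplace_eq[of z f 0] assms killing[of z] by simp

section \<open>Bounds for double sums of the kernel\<close>

definition potential :: "'v set \<Rightarrow> 'v set \<Rightarrow> 'v \<Rightarrow> real" where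
  "potential W Y z = (\<Sum>y\<in>Y. finite_green W y z)"

lemma potential_nonneg: "W \<subseteq> V \<Longrightarrow> 0 \<le> potential W Y z"
  by (auto simp: potential_def intro!: sum_nonneg finite_green_nonneg)

lemma potential_eq:
  assumes "W \<subseteq> V" "z \<in> W" "finite Y"
  shows "m z * potential W Y z = (if z \<in> Y then 1 else 0) + (\<Sum>w\<in>V. c z w * potential W Y w)"
proof -
  have "m z * potential W Y z
    = (\<Sum>y\<in>Y. (if z = y then 1 else 0) + (\<Sum>w\<in>V. c z w * finite_green W y w))"
    using assms by (simp add: potential_def sum_distrib_left finite_green_eq)
  also have "\<dots> = (if z \<in> Y then 1 else 0) + (\<Sum>y\<in>Y. \<Sum>w\<in>V. c z w * finite_green W y w)"
    using assms by (simp add: sum.distrib)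
  also have "(\<Sum>y\<in>Y. \<Sum>w\<in>V. c z w * finite_green W y w) = (\<Sum>w\<in>V. c z w * potential W Y w)"
    by (subst sum.swap) (simp add: potential_def sum_distrib_left)
  finally show ?thesis .
qed

lemma potential_outside: "W \<subseteq> V \<Longrightarrow> z \<notin> W \<Longrightarrow> potential W Y z = 0"
  by (simp add: potential_def finite_green_outside)

text \<open>Agmon's weighted energy estimate: the weight may grow as long as its gradient is dominated
  by the killing.\<close>

lemma Agmon:
  assumes \<theta>: "\<And>z. z \<in> V \<Longrightarrow> 0 < \<theta> z" "\<And>z. z \<in> V \<Longrightarrow> \<theta> z + (\<Sum>w\<in>V. c z w) \<le> m z"
    and \<phi>: "\<And>z. 0 < \<phi> z"
    and grad: "\<And>y z. y \<in> V \<Longrightarrow> z \<in> V \<Longrightarrow> c y z * (\<phi> y - \<phi> z)\<^sup>2 \<le> \<epsilon> * min (\<theta> y) (\<theta> z) * (\<phi> y * \<phi> z)"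
    and deg: "\<And>y. y \<in> V \<Longrightarrow> real (card {z \<in> V. 0 < c y z}) \<le> D" and \<epsilon>: "0 \<le> \<epsilon>" "\<epsilon> * D \<le> 1"
    and Y: "Y \<subseteq> V"
  shows "(\<Sum>z\<in>V. \<theta> z * (\<phi> z * potential V Y z)\<^sup>2) \<le> 4 * (\<Sum>y\<in>Y. (\<phi> y)\<^sup>2 / \<theta> y)"
proof -
  define f where "f = potential V Y"
  define Q where "Q = (\<Sum>z\<in>V. \<theta> z * (\<phi> z * f z)\<^sup>2)"
  define J where "J z = \<theta> z * (\<phi> z * f z)\<^sup>2" for z
  have f0: "0 \<le> f z" for z by (simp add: f_def potential_nonneg)
  have finY: "finite Y" using Y finite_V finite_subset by auto
  have J0: "0 \<le> J z" if "z \<in> V" for z using \<theta>(1)[OF that] by (simp add: J_def)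
  have lap: "laplace f z = (m z - (\<Sum>w\<in>V. c z w)) * f z - (if z \<in> Y then 1 else 0)" if "z \<in> V" for z
    by (rule laplace_eq) (use potential_eq[of V z Y] that finY in \<open>simp add: f_def\<close>)
  \<comment> \<open>The equation of \<open>f\<close>, tested against
    \<open>\<phi>\<^sup>2 * f\<close>, with the killing bounded below by
    \<open>\<theta>\<close>.\<close>
  have "Q - (\<Sum>y\<in>Y. (\<phi> y)\<^sup>2 * f y) \<le> (\<Sum>y\<in>V. (\<phi> y)\<^sup>2 * f y * laplace f y)"
  proof -
    have "(\<Sum>y\<in>Y. (\<phi> y)\<^sup>2 * f y) = (\<Sum>y\<in>V. if y \<in> Y then (\<phi> y)\<^sup>2 * f y else 0)"
      using Y finite_V by (simp add: sum.If_cases Int_absorb1)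
    then have "Q - (\<Sum>y\<in>Y. (\<phi> y)\<^sup>2 * f y)
      = (\<Sum>y\<in>V. (\<phi> y)\<^sup>2 * f y * (\<theta> y * f y - (if y \<in> Y then 1 else 0)))"
      by (simp add: Q_def sum_subtractf[symmetric])
         (intro sum.cong refl, simp add: algebra_simps power2_eq_square)
    also have "\<dots> \<le> (\<Sum>y\<in>V. (\<phi> y)\<^sup>2 * f y * laplace f y)"
    proof (intro sum_mono mult_left_mono)
      fix y assume y: "y \<in> V"
      have "\<theta> y * f y \<le> (m y - (\<Sum>w\<in>V. c y w)) * f y"
        using \<theta>(2)[OF y] f0 by (intro mult_right_mono) auto
      then show "\<theta> y * f y - (if y \<in> Y then 1 else 0) \<le> laplace f y"
        by (simp add: lap[OF y])
    qed (use f0 in auto)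
    finally show ?thesis .
  qed
  \<comment> \<open>The energy of \<open>\<phi> * f\<close> is nonnegative, so only the gradient of
    the weight remains. Each vertex is counted at most \<open>D\<close> times, and
    \<open>\<epsilon> * D \<le> 1\<close> lets half of \<open>Q\<close> absorb it.\<close>
  moreover have "2 * (\<Sum>y\<in>V. (\<phi> y)\<^sup>2 * f y * laplace f y) \<le> Q"
  proof -
    have "2 * (\<Sum>y\<in>V. (\<phi> y)\<^sup>2 * f y * laplace f y)
      \<le> (\<Sum>y\<in>V. \<Sum>z\<in>V. c y z * (f y * f z * (\<phi> y - \<phi> z)\<^sup>2))"
      using energy_mult[of \<phi> f] energy_nonneg[of "\<lambda>y. \<phi> y * f y"] by simp
    also have "\<dots> \<le> (\<Sum>y\<in>V. \<Sum>z\<in>V. (if 0 < c y z then \<epsilon> / 2 * J y else 0) + (if 0 < c z y then \<epsilon> / 2 * J z else 0))"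
    proof (intro sum_mono)
      fix y z assume yz: "y \<in> V" "z \<in> V"
      show "c y z * (f y * f z * (\<phi> y - \<phi> z)\<^sup>2)
        \<le> (if 0 < c y z then \<epsilon> / 2 * J y else 0) + (if 0 < c z y then \<epsilon> / 2 * J z else 0)"
      proof (cases "0 < c y z")
        case True
        have "c y z * (f y * f z * (\<phi> y - \<phi> z)\<^sup>2) = f y * f z * (c y z * (\<phi> y - \<phi> z)\<^sup>2)" by simp
        also have "\<dots> \<le> f y * f z * (\<epsilon> * min (\<theta> y) (\<theta> z) * (\<phi> y * \<phi> z))"
          using f0 by (intro mult_left_mono grad yz) auto
        also have "\<dots> = \<epsilon> * (min (\<theta> y) (\<theta> z) * ((\<phi> y * f y) * (\<phi> z * f z)))" by simp
        also have "\<dots> \<le> \<epsilon> * ((J y + J z) / 2)"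
        proof (intro mult_left_mono \<epsilon>)
          have "min (\<theta> y) (\<theta> z) * ((\<phi> y * f y) * (\<phi> z * f z))
            \<le> min (\<theta> y) (\<theta> z) * (((\<phi> y * f y)\<^sup>2 + (\<phi> z * f z)\<^sup>2) / 2)"
            using sum_squares_bound[of "\<phi> y * f y" "\<phi> z * f z"] \<theta>(1)[OF yz(1)] \<theta>(1)[OF yz(2)]
            by (intro mult_left_mono) auto
          also have "\<dots> \<le> (J y + J z) / 2"
          proof -
            have "min (\<theta> y) (\<theta> z) * (\<phi> y * f y)\<^sup>2 \<le> J y" "min (\<theta> y) (\<theta> z) * (\<phi> z * f z)\<^sup>2 \<le> J z"
              unfolding J_def by (intro mult_right_mono; simp)+
            then show ?thesis by (simp add: distrib_left)
          qed
          finally show "min (\<theta> y) (\<theta> z) * ((\<phi> y * f y) * (\<phi> z * f z)) \<le> (J y + J z) / 2" .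
        qed
        finally show ?thesis using True c_sym[of y z] by (simp add: algebra_simps)
      next
        case False
        then show ?thesis using c_nonneg[of y z] c_sym[of y z] by (simp add: not_less)
      qed
    qed
    also have "\<dots> = 2 * (\<Sum>y\<in>V. \<Sum>z\<in>V. if 0 < c y z then \<epsilon> / 2 * J y else 0)"
    proof -
      have "(\<Sum>y\<in>V. \<Sum>z\<in>V. if 0 < c z y then \<epsilon> / 2 * J z else 0) = (\<Sum>y\<in>V. \<Sum>z\<in>V. if 0 < c y z then \<epsilon> / 2 * J y else 0)"
        by (rule sum.swap)
      then show ?thesis by (simp only: sum.distrib)
    qed
    also have "(\<Sum>y\<in>V. \<Sum>z\<in>V. if 0 < c y z then \<epsilon> / 2 * J y else 0)
      = (\<Sum>y\<in>V. real (card {z \<in> V. 0 < c y z}) * (\<epsilon> / 2 * J y))"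
      using finite_V by (simp add: sum.If_cases Int_def)
    also have "\<dots> \<le> (\<Sum>y\<in>V. D * (\<epsilon> / 2 * J y))"
      using J0 \<epsilon> by (intro sum_mono mult_right_mono deg) auto
    also have "2 * (\<Sum>y\<in>V. D * (\<epsilon> / 2 * J y)) = (\<epsilon> * D) * Q"
      by (simp add: sum_distrib_left Q_def J_def mult_ac)
    also have "\<dots> \<le> 1 * Q" using \<epsilon> J0 by (intro mult_right_mono) (auto simp: Q_def J_def intro!: sum_nonneg)
    finally show ?thesis by simp
  qed
  ultimately have Q1: "Q \<le> 2 * (\<Sum>y\<in>Y. (\<phi> y)\<^sup>2 * f y)" by simp
  have Q0: "0 \<le> Q" using J0 by (auto simp: Q_def J_def intro!: sum_nonneg)
  have "(\<Sum>y\<in>Y. (\<phi> y)\<^sup>2 * f y)\<^sup>2 = (\<Sum>y\<in>Y. (sqrt (\<theta> y) * (\<phi> y * f y)) * (\<phi> y / sqrt (\<theta> y)))\<^sup>2"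
  proof -
    have "(\<phi> y)\<^sup>2 * f y = (sqrt (\<theta> y) * (\<phi> y * f y)) * (\<phi> y / sqrt (\<theta> y))" if "y \<in> Y" for y
      using \<theta>(1)[of y] that Y by (auto simp: power2_eq_square)
    then show ?thesis by simp
  qed
  also have "\<dots> \<le> (\<Sum>y\<in>Y. (sqrt (\<theta> y) * (\<phi> y * f y))\<^sup>2) * (\<Sum>y\<in>Y. (\<phi> y / sqrt (\<theta> y))\<^sup>2)"
    by (rule Cauchy_Schwarz_ineq_sum)
  also have "(\<Sum>y\<in>Y. (sqrt (\<theta> y) * (\<phi> y * f y))\<^sup>2) = (\<Sum>y\<in>Y. J y)"
    using \<theta>(1) Y by (intro sum.cong refl) (auto simp: power_mult_distrib J_def less_imp_le subset_iff)
  also have "(\<Sum>y\<in>Y. (\<phi> y / sqrt (\<theta> y))\<^sup>2) = (\<Sum>y\<in>Y. (\<phi> y)\<^sup>2 / \<theta> y)"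
    using \<theta>(1) Y by (intro sum.cong refl) (auto simp: power_divide less_imp_le subset_iff)
  also have "(\<Sum>y\<in>Y. J y) * (\<Sum>y\<in>Y. (\<phi> y)\<^sup>2 / \<theta> y) \<le> Q * (\<Sum>y\<in>Y. (\<phi> y)\<^sup>2 / \<theta> y)"
  proof (intro mult_right_mono sum_nonneg)
    show "(\<Sum>y\<in>Y. J y) \<le> Q" unfolding Q_def J_def[symmetric] using Y J0 finite_V by (intro sum_mono2) auto
  qed (use \<theta>(1) Y in \<open>auto simp: less_imp_le subset_iff\<close>)
  finally have "(\<Sum>y\<in>Y. (\<phi> y)\<^sup>2 * f y)\<^sup>2 \<le> Q * (\<Sum>y\<in>Y. (\<phi> y)\<^sup>2 / \<theta> y)" .
  moreover have "Q\<^sup>2 \<le> (2 * (\<Sum>y\<in>Y. (\<phi> y)\<^sup>2 * f y))\<^sup>2" using Q0 Q1 by (intro power_mono) auto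
  ultimately have "Q * Q \<le> Q * (4 * (\<Sum>y\<in>Y. (\<phi> y)\<^sup>2 / \<theta> y))"
    by (simp add: power2_eq_square)
  then have "Q \<le> 4 * (\<Sum>y\<in>Y. (\<phi> y)\<^sup>2 / \<theta> y)"
  proof (cases "Q = 0")
    case True
    then show ?thesis using \<theta>(1) Y by (auto intro!: mult_nonneg_nonneg sum_nonneg simp: less_imp_le subset_iff)
  next
    case False
    then show ?thesis using \<open>Q * Q \<le> _\<close> Q0 by (simp add: mult_le_cancel_left)
  qed
  then show ?thesis by (simp add: Q_def f_def)
qed

text \<open>Cauchy-Schwarz on \<open>X\<close>, dual to the one used on \<open>Y\<close> in Agmon's
  estimate. Both factors contain \<open>\<theta>\<close> only through
  \<open>1 / \<theta>\<close>.\<close>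

lemma potential_sum_le_Agmon:
  assumes \<theta>: "\<And>z. z \<in> V \<Longrightarrow> 0 < \<theta> z" "\<And>z. z \<in> V \<Longrightarrow> \<theta> z + (\<Sum>w\<in>V. c z w) \<le> m z"
    and \<phi>: "\<And>z. 0 < \<phi> z"
    and grad: "\<And>y z. y \<in> V \<Longrightarrow> z \<in> V \<Longrightarrow> c y z * (\<phi> y - \<phi> z)\<^sup>2 \<le> \<epsilon> * min (\<theta> y) (\<theta> z) * (\<phi> y * \<phi> z)"
    and deg: "\<And>y. y \<in> V \<Longrightarrow> real (card {z \<in> V. 0 < c y z}) \<le> D" and \<epsilon>: "0 \<le> \<epsilon>" "\<epsilon> * D \<le> 1"
    and XY: "X \<subseteq> V" "Y \<subseteq> V"
  shows "(\<Sum>x\<in>X. potential V Y x)\<^sup>2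
    \<le> 4 * (\<Sum>y\<in>Y. (\<phi> y)\<^sup>2 / \<theta> y) * (\<Sum>x\<in>X. 1 / ((\<phi> x)\<^sup>2 * \<theta> x))"
proof -
  define f where "f = potential V Y"
  have "(\<Sum>x\<in>X. f x)\<^sup>2 = (\<Sum>x\<in>X. (sqrt (\<theta> x) * (\<phi> x * f x)) * (1 / (\<phi> x * sqrt (\<theta> x))))\<^sup>2"
  proof -
    have "f x = (sqrt (\<theta> x) * (\<phi> x * f x)) * (1 / (\<phi> x * sqrt (\<theta> x)))" if "x \<in> X" for x
      using \<theta>(1)[of x] \<phi>[of x] that XY by auto
    then show ?thesis by simp
  qed
  also have "\<dots> \<le> (\<Sum>x\<in>X. (sqrt (\<theta> x) * (\<phi> x * f x))\<^sup>2) * (\<Sum>x\<in>X. (1 / (\<phi> x * sqrt (\<theta> x)))\<^sup>2)"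
    by (rule Cauchy_Schwarz_ineq_sum)
  also have "(\<Sum>x\<in>X. (sqrt (\<theta> x) * (\<phi> x * f x))\<^sup>2) = (\<Sum>x\<in>X. \<theta> x * (\<phi> x * f x)\<^sup>2)"
    using \<theta>(1) XY by (intro sum.cong refl) (auto simp: power_mult_distrib less_imp_le subset_iff)
  also have "(\<Sum>x\<in>X. (1 / (\<phi> x * sqrt (\<theta> x)))\<^sup>2) = (\<Sum>x\<in>X. 1 / ((\<phi> x)\<^sup>2 * \<theta> x))"
    using \<theta>(1) XY by (intro sum.cong refl) (auto simp: power_divide power_mult_distrib less_imp_le subset_iff)
  also have "(\<Sum>x\<in>X. \<theta> x * (\<phi> x * f x)\<^sup>2) * (\<Sum>x\<in>X. 1 / ((\<phi> x)\<^sup>2 * \<theta> x))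
    \<le> 4 * (\<Sum>y\<in>Y. (\<phi> y)\<^sup>2 / \<theta> y) * (\<Sum>x\<in>X. 1 / ((\<phi> x)\<^sup>2 * \<theta> x))"
  proof (intro mult_right_mono sum_nonneg)
    have "(\<Sum>x\<in>X. \<theta> x * (\<phi> x * f x)\<^sup>2) \<le> (\<Sum>x\<in>V. \<theta> x * (\<phi> x * f x)\<^sup>2)"
      using XY \<theta>(1) finite_V by (intro sum_mono2) (auto simp: less_imp_le)
    also have "\<dots> \<le> 4 * (\<Sum>y\<in>Y. (\<phi> y)\<^sup>2 / \<theta> y)"
      unfolding f_def by (rule Agmon[OF \<theta> \<phi> grad deg \<epsilon> XY(2)])
    finally show "(\<Sum>x\<in>X. \<theta> x * (\<phi> x * f x)\<^sup>2) \<le> 4 * (\<Sum>y\<in>Y. (\<phi> y)\<^sup>2 / \<theta> y)" .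
  qed (use \<theta>(1) XY in \<open>auto simp: less_imp_le subset_iff\<close>)
  finally show ?thesis by (simp add: f_def)
qed

text \<open>The equation tested against its own solution; the killing has a good sign and is
  dropped.\<close>

lemma energy_potential_le:
  assumes W: "W \<subseteq> V" and Y: "Y \<subseteq> V"
  shows "energy (potential W Y) \<le> 2 * (\<Sum>y\<in>Y. potential W Y y)"
proof -
  define f where "f = potential W Y"
  have finY: "finite Y" using Y finite_V finite_subset by auto
  have f0: "0 \<le> f z" for z using W by (simp add: f_def potential_nonneg)
  have "energy f = - 2 * (\<Sum>y\<in>V. f y * laplace f y)"
    unfolding energy_def summation_by_parts[symmetric] by (simp add: power2_eq_square)
  also have "\<dots> = 2 * (\<Sum>y\<in>V. - (f y * laplace f y))" by (simp add: sum_negf)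
  also have "\<dots> \<le> 2 * (\<Sum>y\<in>V. if y \<in> Y then f y else 0)"
  proof (intro mult_left_mono sum_mono)
    fix y assume y: "y \<in> V"
    show "- (f y * laplace f y) \<le> (if y \<in> Y then f y else 0)"
    proof (cases "y \<in> W")
      case True
      have lap: "laplace f y = (m y - (\<Sum>w\<in>V. c y w)) * f y - (if y \<in> Y then 1 else 0)"
        by (rule laplace_eq) (use potential_eq[OF W True finY] in \<open>simp add: f_def\<close>)
      have "- (f y * laplace f y) = (if y \<in> Y then f y else 0) - (m y - (\<Sum>w\<in>V. c y w)) * (f y)\<^sup>2"
        unfolding lap by (simp add: algebra_simps power2_eq_square)
      then show ?thesis using killing[OF y] by simp
    next
      case False
      then have "f y = 0" using W by (simp add: f_def potential_outside)
      then show ?thesis by simp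
    qed
  qed simp
  also have "(\<Sum>y\<in>V. if y \<in> Y then f y else 0) = (\<Sum>y\<in>Y. f y)"
    using Y finite_V by (simp add: sum.If_cases Int_absorb1)
  finally show ?thesis by (simp add: f_def)
qed

text \<open>The counterpart of the Agmon bound when the domain, not the killing, provides
  coercivity: Poincare bounds \<open>Q\<close> by the sum of the potential over its source, and
  Cauchy-Schwarz bounds that sum by \<open>sqrt Q\<close> again.\<close>

lemma potential_sum_le_Poincare:
  assumes W: "W \<subseteq> V" and XY: "X \<subseteq> W" "Y \<subseteq> W" and C: "0 \<le> C"
    and Poincare: "(\<Sum>z\<in>W. (potential W Y z)\<^sup>2) \<le> C * energy (potential W Y)"
  shows "(\<Sum>x\<in>X. potential W Y x)\<^sup>2 \<le> 4 * C\<^sup>2 * real (card X) * real (card Y)"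
proof -
  define f where "f = potential W Y"
  define Q where "Q = (\<Sum>z\<in>W. (f z)\<^sup>2)"
  have finW: "finite W" using W finite_V finite_subset by auto
  have f0: "0 \<le> f z" for z using W by (simp add: f_def potential_nonneg)
  have Q0: "0 \<le> Q" by (simp add: Q_def sum_nonneg)
  have CS: "(\<Sum>x\<in>X. f x)\<^sup>2 \<le> real (card X) * Q" if "X \<subseteq> W" for X
  proof -
    have "(\<Sum>x\<in>X. 1 * f x)\<^sup>2 \<le> (\<Sum>x\<in>X. 1\<^sup>2) * (\<Sum>x\<in>X. (f x)\<^sup>2)"
      by (rule Cauchy_Schwarz_ineq_sum)
    also have "\<dots> \<le> real (card X) * Q"
      unfolding Q_def using that finW by (auto intro!: mult_left_mono sum_mono2)
    finally show ?thesis by simp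
  qed
  have "Q \<le> C * (2 * (\<Sum>y\<in>Y. f y))"
    using Poincare energy_potential_le[OF W, of Y] XY W C
    unfolding Q_def f_def by (meson mult_left_mono order_trans subset_trans)
  then have "Q\<^sup>2 \<le> (C * (2 * (\<Sum>y\<in>Y. f y)))\<^sup>2" using Q0 by (rule power_mono)
  also have "\<dots> = 4 * C\<^sup>2 * (\<Sum>y\<in>Y. f y)\<^sup>2" by (simp add: power_mult_distrib)
  also have "\<dots> \<le> 4 * C\<^sup>2 * (real (card Y) * Q)" using CS[OF XY(2)] by (intro mult_left_mono) auto
  finally have *: "Q * Q \<le> Q * (4 * C\<^sup>2 * real (card Y))" by (simp add: power2_eq_square mult_ac)
  have "Q \<le> 4 * C\<^sup>2 * real (card Y)"
  proof (cases "Q = 0")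
    case False
    then have "0 < Q" using Q0 by simp
    then show ?thesis using * by (auto dest: mult_left_le_imp_le)
  qed simp
  then have "real (card X) * Q \<le> real (card X) * (4 * C\<^sup>2 * real (card Y))" by (intro mult_left_mono) auto
  then show ?thesis using CS[OF XY(1)] by (simp add: f_def mult_ac)
qed

end

section \<open>The infinite cluster and its distances\<close>

lemma adj_sym: "adj a x y \<longleftrightarrow> adj a y x"
  by (simp add: adj_def insert_commute)

lemma adj_pos: "adj a x y \<Longrightarrow> 0 < a {x, y}"
  by (simp add: adj_def open_edges_def)

text \<open>Neighbours lie in a box of side three. This crude bound makes the decay rate depend on
  the dimension alone.\<close>

lemma card_adj_le: "card {y :: int ^ 'd. adj a x y} \<le> 3 ^ CARD('d :: finite)"
proof -
  have "{y. adj a x y} \<subseteq> vec_lambda ` (PiE UNIV (\<lambda>i. {x $ i - 1..x $ i + 1}))"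
  proof
    fix y assume "y \<in> {y. adj a x y}"
    then obtain u v where uv: "{x, y} = {u, v}" "(\<Sum>i\<in>UNIV. \<bar>u $ i - v $ i\<bar>) = 1"
      by (auto simp: adj_def open_edges_def nn_edges_def)
    have "(\<Sum>i\<in>UNIV. \<bar>x $ i - y $ i\<bar>) = 1"
      using uv by (auto simp: doubleton_eq_iff abs_minus_commute)
    moreover have "\<bar>x $ i - y $ i\<bar> \<le> (\<Sum>i\<in>UNIV. \<bar>x $ i - y $ i\<bar>)" for i
      by (rule member_le_sum) simp_all
    ultimately have "\<bar>x $ i - y $ i\<bar> \<le> 1" for i by simp
    then have "y $ i \<in> {x $ i - 1..x $ i + 1}" for i
      by (metis abs_le_D1 abs_le_D2 atLeastAtMost_iff diff_le_eq add.commute minus_diff_eq le_diff_eq)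
    then have "vec_nth y \<in> PiE UNIV (\<lambda>i. {x $ i - 1..x $ i + 1})" by auto
    then show "y \<in> vec_lambda ` (PiE UNIV (\<lambda>i. {x $ i - 1..x $ i + 1}))"
      by (rule image_eqI[rotated]) (simp add: vec_nth_inverse)
  qed
  then have "card {y. adj a x y} \<le> card (vec_lambda ` (PiE UNIV (\<lambda>i. {x $ i - 1..x $ i + 1})))"
    by (intro card_mono finite_imageI finite_PiE) auto
  also have "\<dots> \<le> card (PiE (UNIV :: 'd set) (\<lambda>i. {x $ i - 1..x $ i + 1}))"
    by (intro card_image_le finite_PiE) auto
  also have "\<dots> = 3 ^ CARD('d)"
    by (simp add: card_PiE)
  finally show ?thesis .
qed

text \<open>A total symmetric kernel, as \<open>weighted_graph\<close> expects. Because
  \<open>1 / 0 = 0\<close>, sums of its inverses see open edges only.\<close>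

definition cond :: "((int ^ 'd) set \<Rightarrow> real) \<Rightarrow> int ^ 'd \<Rightarrow> int ^ 'd \<Rightarrow> real" where
  "cond a x y = (if adj a x y then a {x, y} else 0)"

lemma cond_nonneg: "0 \<le> cond a x y"
  by (auto simp: cond_def dest: adj_pos)

lemma cond_sym: "cond a x y = cond a y x"
  by (simp add: cond_def adj_sym[of a x y] insert_commute)

lemma cond_pos_iff: "0 < cond a x y \<longleftrightarrow> adj a x y"
  by (auto simp: cond_def dest: adj_pos)

lemma sum_cond_le_mu: "finite V \<Longrightarrow> (\<Sum>z\<in>V. cond a y z) \<le> mu a y"
proof -
  assume V: "finite V"
  have "(\<Sum>z\<in>V. cond a y z) = (\<Sum>z\<in>V \<inter> {z. adj a y z}. a {y, z})"
    using V by (simp add: cond_def sum.If_cases)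
  also have "\<dots> \<le> mu a y"
    unfolding mu_def using finite_adj by (intro sum_mono2) (auto dest: adj_pos)
  finally show ?thesis .
qed

lemma sum_inverse_cond_le_nu: "finite V \<Longrightarrow> (\<Sum>z\<in>V. 1 / cond a y z) \<le> nu a y"
proof -
  assume V: "finite V"
  have "(\<Sum>z\<in>V. 1 / cond a y z) = (\<Sum>z\<in>V. if adj a y z then 1 / a {y, z} else 0)"
    by (intro sum.cong) (auto simp: cond_def)
  also have "\<dots> = (\<Sum>z\<in>V \<inter> {z. adj a y z}. 1 / a {y, z})"
    using V by (simp add: sum.If_cases)
  also have "\<dots> \<le> nu a y"
    unfolding nu_def using finite_adj by (intro sum_mono2) (auto dest: adj_pos)
  finally show ?thesis .
qed

locale cluster =
  fixes a :: "(int ^ 'd :: finite) set \<Rightarrow> real" and \<kappa> :: "int ^ 'd \<Rightarrow> real"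
  assumes conf: "configuration a \<kappa>"
begin

abbreviation "\<C> \<equiv> infinite_cluster a"
abbreviation "\<rho> \<equiv> graph_dist a"

lemma \<kappa>_pos: "0 < \<kappa> x"
  using conf by (simp add: configuration_def)

lemma cluster_in_clusters: "\<C> \<in> clusters a"
proof -
  have "\<exists>!C. C \<in> clusters a \<and> infinite C" using conf by (simp add: configuration_def)
  from theI'[OF this] show ?thesis unfolding infinite_cluster_def by blast
qed

lemma cluster_adj: "x \<in> \<C> \<Longrightarrow> adj a x y \<Longrightarrow> y \<in> \<C>"
proof -
  assume xy: "x \<in> \<C>" "adj a x y"
  obtain o' where o': "\<C> = {y. (adj a)\<^sup>*\<^sup>* o' y}" using cluster_in_clusters by (auto simp: clusters_def)
  show ?thesis using xy unfolding o' by auto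
qed

lemma cluster_connected: "x \<in> \<C> \<Longrightarrow> y \<in> \<C> \<Longrightarrow> (adj a)\<^sup>*\<^sup>* x y"
proof -
  assume xy: "x \<in> \<C>" "y \<in> \<C>"
  obtain o' where o': "\<C> = {y. (adj a)\<^sup>*\<^sup>* o' y}" using cluster_in_clusters by (auto simp: clusters_def)
  have "symp (adj a)" using adj_sym by (auto intro!: sympI)
  then have "(adj a)\<^sup>*\<^sup>* x o'" using xy(1) unfolding o' by (metis mem_Collect_eq symp_rtranclp sympD)
  moreover have "(adj a)\<^sup>*\<^sup>* o' y" using xy(2) unfolding o' by auto
  ultimately show ?thesis by (rule rtranclp_trans)
qed

text \<open>Replaces vertex lists by relational powers, whose composition gives the triangle
  inequality and symmetry of the distance.\<close>

lemma open_paths_iff: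
  assumes "x \<in> \<C>"
  shows "(\<exists>zs\<in>open_paths a x y. length zs = Suc l) \<longleftrightarrow> (adj a ^^ l) x y"
proof
  assume "\<exists>zs\<in>open_paths a x y. length zs = Suc l"
  then obtain zs where zs: "zs \<in> open_paths a x y" "length zs = Suc l" by auto
  then have "zs ! 0 = x" "zs ! l = y" "\<forall>i<l. adj a (zs ! i) (zs ! Suc i)"
    by (auto simp: open_paths_def hd_conv_nth last_conv_nth)
  then show "(adj a ^^ l) x y" unfolding relpowp_fun_conv by blast
next
  assume "(adj a ^^ l) x y"
  then obtain f where f: "f 0 = x" "f l = y" "\<And>i. i < l \<Longrightarrow> adj a (f i) (f (Suc i))"
    unfolding relpowp_fun_conv by blast
  have "f i \<in> \<C>" if "i \<le> l" for i
    using that by (induction i) (use f assms cluster_adj in \<open>auto simp: Suc_le_eq\<close>)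
  then have "map f [0..<Suc l] \<in> open_paths a x y"
    using f by (auto simp: open_paths_def hd_map last_map nth_append less_Suc_eq_le simp del: upt_Suc)
  then show "\<exists>zs\<in>open_paths a x y. length zs = Suc l" by (intro bexI) auto
qed

lemma graph_dist_eq: "x \<in> \<C> \<Longrightarrow> \<rho> x y = (LEAST l. (adj a ^^ l) x y)"
  by (simp add: graph_dist_def open_paths_iff)

lemma graph_dist_le: "x \<in> \<C> \<Longrightarrow> (adj a ^^ l) x y \<Longrightarrow> \<rho> x y \<le> l"
  by (simp add: graph_dist_eq Least_le)

lemma graph_dist_relpowp: "x \<in> \<C> \<Longrightarrow> y \<in> \<C> \<Longrightarrow> (adj a ^^ \<rho> x y) x y"
proof -
  assume xy: "x \<in> \<C>" "y \<in> \<C>"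
  have "\<exists>l. (adj a ^^ l) x y" using cluster_connected[OF xy] by (simp add: rtranclp_imp_relpowp)
  then show ?thesis unfolding graph_dist_eq[OF xy(1)] by (rule LeastI_ex)
qed

lemma graph_dist_self: "x \<in> \<C> \<Longrightarrow> \<rho> x x = 0"
  using graph_dist_le[of x 0 x] by simp

lemma graph_dist_triangle: "x \<in> \<C> \<Longrightarrow> y \<in> \<C> \<Longrightarrow> z \<in> \<C> \<Longrightarrow> \<rho> x z \<le> \<rho> x y + \<rho> y z"
  by (intro graph_dist_le) (auto simp: relpowp_add intro!: relcomppI graph_dist_relpowp)

lemma graph_dist_sym: "x \<in> \<C> \<Longrightarrow> y \<in> \<C> \<Longrightarrow> \<rho> x y = \<rho> y x"
proof -
  have *: "(adj a ^^ l) x y \<Longrightarrow> (adj a ^^ l) y x" for l x y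
  proof (induction l arbitrary: y)
    case (Suc l)
    then obtain z where "(adj a ^^ l) x z" "adj a z y" by auto
    then show ?case using Suc.IH adj_sym relpowp_Suc_I2 by metis
  qed simp
  assume "x \<in> \<C>" "y \<in> \<C>"
  then show ?thesis using graph_dist_le graph_dist_relpowp * by (intro antisym) blast+
qed

lemma graph_dist_adj: "adj a y z \<Longrightarrow> y \<in> \<C> \<Longrightarrow> \<rho> y z \<le> 1"
  by (rule graph_dist_le) auto

lemma graph_dist_lipschitz:
  assumes "x \<in> \<C>" "y \<in> \<C>" "adj a y z"
  shows "\<bar>real (\<rho> x y) - real (\<rho> x z)\<bar> \<le> 1"
proof -
  have z: "z \<in> \<C>" using assms cluster_adj by blast
  have "\<rho> x z \<le> \<rho> x y + \<rho> y z" "\<rho> x y \<le> \<rho> x z + \<rho> z y"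
    using assms z by (auto intro: graph_dist_triangle)
  moreover have "\<rho> y z \<le> 1" "\<rho> z y \<le> 1"
    using assms z graph_dist_adj adj_sym[of a y z] by auto
  ultimately show ?thesis by linarith
qed

lemma graph_ball_eq: "graph_ball a x r = {y \<in> \<C>. real (\<rho> x y) \<le> r}"
  unfolding graph_ball_def by (simp add: le_floor_iff)

section \<open>The killing distance along paths\<close>

abbreviation "step_weight y z \<equiv> sqrt (min 1 (min (\<kappa> y) (\<kappa> z) / a {y, z}))"

lemma step_weight_bounds: "adj a y z \<Longrightarrow> 0 \<le> step_weight y z \<and> step_weight y z \<le> 1"
  using \<kappa>_pos[of y] \<kappa>_pos[of z] adj_pos[of a y z] by (auto intro!: divide_nonneg_pos simp: less_imp_le)

definition path_weight :: "(int ^ 'd) list \<Rightarrow> real" where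
  "path_weight zs = (\<Sum>i<length zs - 1. step_weight (zs ! i) (zs ! Suc i))"

lemma kappa_dist_eq: "kappa_dist a \<kappa> x y = (INF zs\<in>open_paths a x y. path_weight zs)"
  by (simp add: kappa_dist_def path_weight_def)

lemma path_weight_nonneg: "zs \<in> open_paths a x y \<Longrightarrow> 0 \<le> path_weight zs"
  unfolding path_weight_def
  by (intro sum_nonneg) (use step_weight_bounds in \<open>auto simp: open_paths_def\<close>)

lemma path_weight_bdd: "bdd_below (path_weight ` open_paths a x y)"
  by (rule bdd_belowI[of _ 0]) (use path_weight_nonneg in auto)

lemma kappa_dist_le: "zs \<in> open_paths a x y \<Longrightarrow> kappa_dist a \<kappa> x y \<le> path_weight zs"
  unfolding kappa_dist_eq by (rule cINF_lower[OF path_weight_bdd])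

lemma open_paths_nonempty: "x \<in> \<C> \<Longrightarrow> y \<in> \<C> \<Longrightarrow> \<exists>zs\<in>open_paths a x y. length zs = Suc (\<rho> x y)"
  by (simp add: open_paths_iff graph_dist_relpowp)

lemma kappa_dist_nonneg: "x \<in> \<C> \<Longrightarrow> y \<in> \<C> \<Longrightarrow> 0 \<le> kappa_dist a \<kappa> x y"
  unfolding kappa_dist_eq
  by (rule cINF_greatest) (use open_paths_nonempty[of x y] path_weight_nonneg in auto)

text \<open>Steps weigh at most 1. Hence the exponential weight is bounded below on balls of radius
  of order \<open>1 / sqrt h\<close> around \<open>x\<close>.\<close>

lemma kappa_dist_le_graph_dist: "x \<in> \<C> \<Longrightarrow> y \<in> \<C> \<Longrightarrow> kappa_dist a \<kappa> x y \<le> real (\<rho> x y)"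
proof -
  assume "x \<in> \<C>" "y \<in> \<C>"
  then obtain zs where zs: "zs \<in> open_paths a x y" "length zs = Suc (\<rho> x y)"
    using open_paths_nonempty by blast
  have "path_weight zs \<le> (\<Sum>i<length zs - 1. 1)"
    unfolding path_weight_def using zs(1) step_weight_bounds
    by (intro sum_mono) (auto simp: open_paths_def)
  then show ?thesis using kappa_dist_le[OF zs(1)] zs(2) by simp
qed

lemma kappa_dist_step:
  assumes "x \<in> \<C>" "y \<in> \<C>" "adj a y z"
  shows "kappa_dist a \<kappa> x z \<le> kappa_dist a \<kappa> x y + step_weight y z"
proof -
  have z: "z \<in> \<C>" using assms cluster_adj by blast
  have "kappa_dist a \<kappa> x z - step_weight y z \<le> kappa_dist a \<kappa> x y"
    unfolding kappa_dist_eq[of x y]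
  proof (rule cINF_greatest)
    show "open_paths a x y \<noteq> {}" using open_paths_nonempty[of x y] assms by auto
    fix zs assume zs: "zs \<in> open_paths a x y"
    then have ne: "zs \<noteq> []" and last: "zs ! (length zs - 1) = y" by (auto simp: open_paths_def last_conv_nth)
    have "adj a ((zs @ [z]) ! i) ((zs @ [z]) ! Suc i)" if "i < length zs" for i
    proof (cases "Suc i = length zs")
      case True
      then have "i = length zs - 1" by simp
      then show ?thesis using True last assms that by (simp add: nth_append)
    next
      case False
      then show ?thesis using that zs by (auto simp: nth_append open_paths_def)
    qed
    then have p: "zs @ [z] \<in> open_paths a x z" using zs z ne by (auto simp: open_paths_def)
    obtain n where n: "length zs = Suc n" using ne by (cases zs) auto
    have "path_weight (zs @ [z]) = path_weight zs + step_weight y z"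
      using n last unfolding path_weight_def by (simp add: nth_append)
    then show "kappa_dist a \<kappa> x z - step_weight y z \<le> path_weight zs" using kappa_dist_le[OF p] by simp
  qed
  then show ?thesis by simp
qed

text \<open>Makes this distance admissible in Agmon's estimate: the conductance times the squared
  step is at most the smaller of the two killing rates.\<close>

lemma kappa_dist_lipschitz:
  assumes "x \<in> \<C>" "y \<in> \<C>" "adj a y z"
  shows "\<bar>kappa_dist a \<kappa> x y - kappa_dist a \<kappa> x z\<bar> \<le> step_weight y z"
proof -
  have "z \<in> \<C>" "adj a z y" using assms cluster_adj adj_sym[of a y z] by blast+
  then have 1: "kappa_dist a \<kappa> x y \<le> kappa_dist a \<kappa> x z + step_weight z y"
    using assms by (intro kappa_dist_step) auto
  have 2: "step_weight z y = step_weight y z" by (simp add: insert_commute min.commute)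
  have "\<bar>A - B\<bar> \<le> s" if "B \<le> A + s" "A \<le> B + s" for A B s :: real using that by linarith
  then show ?thesis using kappa_dist_step[OF assms] 1[unfolded 2] .
qed

end

section \<open>Reduction to the jump chain\<close>

lemma jump_chain_fst: "jump_chain x k (u, v) = jump_chain x k (u, v')"
  by (induction k) auto

text \<open>The forward equation for the law of the jump chain after \<open>k\<close> jumps, without
  the cemetery. The probabilities need only be bounded by it from above.\<close>

primrec visit :: "((int ^ 'd) set \<Rightarrow> real) \<Rightarrow> (int ^ 'd \<Rightarrow> real) \<Rightarrow> real \<Rightarrow> int ^ 'd \<Rightarrow> nat \<Rightarrow> int ^ 'd \<Rightarrow> real" where
  "visit a \<kappa> h x 0 y = (if y = x then 1 else 0)"
| "visit a \<kappa> h x (Suc k) y = (\<Sum>z | adj a y z. visit a \<kappa> h x k z * (a {z, y} / exit_rate a \<kappa> h z))"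

locale killed_walk =
  fixes a :: "(int ^ 'd :: finite) set \<Rightarrow> real" and \<kappa> :: "int ^ 'd \<Rightarrow> real" and h :: real
  assumes \<kappa>: "0 < \<kappa> x" and h: "0 < h"
begin

abbreviation "jump_space \<equiv> PiM UNIV (\<lambda>(k :: nat, x). measure_pmf (jump_pmf a \<kappa> h x))"
abbreviation "hold_space \<equiv> PiM (UNIV :: nat set) (\<lambda>k. density lborel (\<lambda>s. ennreal (exponential_density 1 s)))"

text \<open>Killing makes the rate positive even at isolated sites, so the jump probabilities form a
  mass function at every site of the lattice.\<close>

lemma exit_rate_pos: "0 < exit_rate a \<kappa> h x"
proof -
  have "0 \<le> mu a x" unfolding mu_def by (intro sum_nonneg) (auto simp: adj_def open_edges_def)
  then show ?thesis using \<kappa>[of x] h by (simp add: exit_rate_def add_nonneg_pos)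
qed

lemma pmf_jump: "pmf (jump_pmf a \<kappa> h x) s = jump_prob a \<kappa> h x s"
  using \<kappa>[of x] h exit_rate_pos by (intro pmf_jump_pmf) auto

lemma visit_nonneg: "0 \<le> visit a \<kappa> h x k y"
proof (induction k arbitrary: y)
  case (Suc k)
  have "0 \<le> visit a \<kappa> h x k z * (a {z, y} / exit_rate a \<kappa> h z)" if "adj a y z" for z
  proof -
    have "{z, y} = {y, z}" by (rule insert_commute)
    then have "0 < a {z, y}" using that by (simp add: adj_def open_edges_def)
    then show ?thesis using Suc.IH[of z] exit_rate_pos[of z] by (simp add: less_imp_le)
  qed
  then show ?case by (auto intro!: sum_nonneg)
qed simp

lemma measurable_jump_component[measurable]: "(\<lambda>u. u j) \<in> measurable jump_space (count_space UNIV)"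
proof (cases j)
  case (Pair k z)
  show ?thesis
    unfolding Pair by (rule measurable_compose[OF measurable_component_singleton[where i="(k, z)"]]) auto
qed

lemma measurable_fst_component[measurable]: "(\<lambda>w. fst w j) \<in> measurable (walk_space a \<kappa> h) (count_space UNIV)"
  unfolding walk_space_def by (rule measurable_compose[OF measurable_fst measurable_jump_component])

section \<open>The law of the jump chain\<close>

text \<open>The Markov property in a form fit for induction. The set \<open>J\<close> prescribes
  successors for steps not yet taken; each induction step turns the last jump into one more
  prescribed successor, until at \<open>k = 0\<close> only a product of coordinates remains.\<close>

lemma emeasure_cylinder_le:
  assumes "finite J" "\<And>j. j \<in> J \<Longrightarrow> k \<le> fst j"
  shows "emeasure (walk_space a \<kappa> h)
     {w \<in> space (walk_space a \<kappa> h). jump_chain x k w = Some y \<and> (\<forall>j\<in>J. fst w j = s j)}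
    \<le> ennreal (visit a \<kappa> h x k y * (\<Prod>j\<in>J. pmf (jump_pmf a \<kappa> h (snd j)) (s j)))"
  using assms
proof (induction k arbitrary: y J s)
  case 0
  interpret J: product_prob_space "\<lambda>(k :: nat, x). measure_pmf (jump_pmf a \<kappa> h x)" UNIV
  proof (rule product_prob_spaceI)
    fix j :: "nat \<times> (int ^ 'd)"
    show "prob_space (case j of (k, x) \<Rightarrow> measure_pmf (jump_pmf a \<kappa> h x))"
      by (cases j) (simp add: prob_space_measure_pmf)
  qed
  interpret P: prob_space hold_space
    by (intro prob_space_PiM prob_space_exponential_density) simp
  show ?case
  proof (cases "y = x")
    case True
    let ?A = "{u \<in> space jump_space. \<forall>j\<in>J. u j \<in> {s j}}"
    have "{w \<in> space (walk_space a \<kappa> h). jump_chain x 0 w = Some y \<and> (\<forall>j\<in>J. fst w j = s j)} = ?A \<times> space hold_space"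
      using True by (auto simp: walk_space_def space_pair_measure)
    moreover have "?A \<in> sets jump_space"
      using 0(1) by measurable
    ultimately have "emeasure (walk_space a \<kappa> h)
       {w \<in> space (walk_space a \<kappa> h). jump_chain x 0 w = Some y \<and> (\<forall>j\<in>J. fst w j = s j)} = emeasure jump_space ?A"
      by (simp add: walk_space_def P.emeasure_pair_measure_Times P.emeasure_space_1)
    also have "\<dots> = (\<Prod>j\<in>J. emeasure (case j of (k, x) \<Rightarrow> measure_pmf (jump_pmf a \<kappa> h x)) {s j})"
      using 0(1) by (intro J.emeasure_PiM_Collect) (auto split: prod.splits)
    also have "\<dots> = (\<Prod>j\<in>J. ennreal (pmf (jump_pmf a \<kappa> h (snd j)) (s j)))"
      by (intro prod.cong refl) (auto simp: emeasure_pmf_single)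
    also have "\<dots> = ennreal (\<Prod>j\<in>J. pmf (jump_pmf a \<kappa> h (snd j)) (s j))"
      by (rule prod_ennreal) auto
    finally show ?thesis using True by simp
  qed simp
next
  case (Suc k)
  let ?W = "walk_space a \<kappa> h"
  let ?P = "\<Prod>j\<in>J. pmf (jump_pmf a \<kappa> h (snd j)) (s j)"
  \<comment> \<open>Split by the site \<open>z\<close> after \<open>k\<close> jumps. The new index
    \<open>(k, z)\<close> is not in \<open>J\<close>, whose indices start at \<open>Suc k\<close>,
    so its factor separates.\<close>
  define E where "E z = {w \<in> space ?W. jump_chain x k w = Some z \<and>
      (\<forall>j\<in>insert (k, z) J. fst w j = (s((k, z) := Some y)) j)}" for z
  have Emeas: "E z \<in> sets ?W" for z
  proof -
    have [measurable]: "jump_chain x k \<in> measurable ?W (count_space UNIV)" by (rule measurable_jump_chain)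
    show ?thesis unfolding E_def using Suc.prems(1) by measurable
  qed
  have kz: "(k, z) \<notin> J" for z using Suc.prems(2)[of "(k, z)"] by auto
  have E: "emeasure ?W (E z) \<le> ennreal (visit a \<kappa> h x k z * (pmf (jump_pmf a \<kappa> h z) (Some y) * ?P))" for z
  proof -
    have "emeasure ?W (E z) \<le> ennreal (visit a \<kappa> h x k z *
      (\<Prod>j\<in>insert (k, z) J. pmf (jump_pmf a \<kappa> h (snd j)) ((s((k, z) := Some y)) j)))"
      unfolding E_def using Suc.prems by (intro Suc.IH) fastforce+
    also have "(\<Prod>j\<in>insert (k, z) J. pmf (jump_pmf a \<kappa> h (snd j)) ((s((k, z) := Some y)) j))
      = pmf (jump_pmf a \<kappa> h z) (Some y) * (\<Prod>j\<in>J. pmf (jump_pmf a \<kappa> h (snd j)) ((s((k, z) := Some y)) j))"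
      using Suc.prems(1) kz by simp
    also have "(\<Prod>j\<in>J. pmf (jump_pmf a \<kappa> h (snd j)) ((s((k, z) := Some y)) j)) = ?P"
      using kz by (intro prod.cong refl) auto
    finally show ?thesis .
  qed
  have eq: "{w \<in> space ?W. jump_chain x (Suc k) w = Some y \<and> (\<forall>j\<in>J. fst w j = s j)} = (\<Union>z\<in>UNIV. E z)"
    using kz by (fastforce simp: E_def bind_eq_Some_conv)
  have "emeasure ?W (\<Union>z\<in>UNIV. E z) = (\<integral>\<^sup>+z. emeasure ?W (E z) \<partial>count_space UNIV)"
    by (rule emeasure_UN_countable) (use Emeas in \<open>auto simp: disjoint_family_on_def E_def\<close>)
  also have "\<dots> \<le> (\<integral>\<^sup>+z. ennreal (visit a \<kappa> h x k z * (pmf (jump_pmf a \<kappa> h z) (Some y) * ?P)) \<partial>count_space UNIV)"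
    by (intro nn_integral_mono E)
  also have "\<dots> = (\<Sum>z | adj a y z. ennreal (visit a \<kappa> h x k z * (pmf (jump_pmf a \<kappa> h z) (Some y) * ?P)))"
    by (rule nn_integral_count_space')
       (auto simp: finite_adj pmf_jump jump_prob_def adj_sym[of a _ y] split: if_splits)
  also have "\<dots> = ennreal (\<Sum>z | adj a y z. visit a \<kappa> h x k z * (pmf (jump_pmf a \<kappa> h z) (Some y) * ?P))"
    by (intro sum_ennreal mult_nonneg_nonneg visit_nonneg prod_nonneg) auto
  also have "(\<Sum>z | adj a y z. visit a \<kappa> h x k z * (pmf (jump_pmf a \<kappa> h z) (Some y) * ?P)) = visit a \<kappa> h x (Suc k) y * ?P"
    by (simp add: sum_distrib_right)
       (intro sum.cong refl, auto simp: pmf_jump jump_prob_def adj_sym[of a _ y])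
  finally show ?case unfolding eq .
qed

lemma emeasure_jump_chain_le:
  "emeasure (walk_space a \<kappa> h) {w \<in> space (walk_space a \<kappa> h). jump_chain x k w = Some y}
    \<le> ennreal (visit a \<kappa> h x k y)"
  using emeasure_cylinder_le[of "{}" k x y] by simp

section \<open>Occupation times\<close>

lemma nn_integral_hold: "0 < r \<Longrightarrow> (\<integral>\<^sup>+v. ennreal (v k / r) \<partial>hold_space) = ennreal (1 / r)"
proof -
  assume r: "0 < r"
  let ?M = "density lborel (\<lambda>s. ennreal (exponential_density 1 s))"
  have "(\<integral>\<^sup>+v. ennreal (v k / r) \<partial>hold_space) = (\<integral>\<^sup>+s. ennreal (s / r) \<partial>distr hold_space ?M (\<lambda>v. v k))"
    by (subst nn_integral_distr) (auto intro!: measurable_component_singleton)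
  also have "distr hold_space ?M (\<lambda>v. v k) = ?M"
    by (rule distr_PiM_component) (auto intro: prob_space_exponential_density)
  also have "(\<integral>\<^sup>+s. ennreal (s / r) \<partial>?M) = (\<integral>\<^sup>+s. ennreal (exponential_density 1 s) * ennreal (s / r) \<partial>lborel)"
    by (rule nn_integral_density) auto
  also have "\<dots> = (\<integral>\<^sup>+s. ennreal (1 / r) * ennreal (exponential_density 1 s * s ^ 1) \<partial>lborel)"
  proof (intro nn_integral_cong)
    fix s :: real
    show "ennreal (exponential_density 1 s) * ennreal (s / r) = ennreal (1 / r) * ennreal (exponential_density 1 s * s ^ 1)"
    proof (cases "s < 0")
      case True
      then show ?thesis by (simp add: exponential_density_def)
    next
      case False
      then have "0 \<le> s / r" "0 \<le> exponential_density 1 s * s"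
        using r exponential_density_nonneg[of 1 s] by auto
      then show ?thesis using r exponential_density_nonneg[of 1 s]
        by (simp add: ennreal_mult[symmetric] mult.commute del: ennreal_mult)
    qed
  qed
  also have "\<dots> = ennreal (1 / r) * (\<integral>\<^sup>+s. ennreal (exponential_density 1 s * s ^ 1) \<partial>lborel)"
    by (rule nn_integral_cmult) auto
  also have "(\<integral>\<^sup>+s. ennreal (exponential_density 1 s * s ^ 1) \<partial>lborel) = 1"
    using nn_integral_erlang_ith_moment[of 1 0 1] by simp
  finally show ?thesis by simp
qed

text \<open>By Fubini the time integral becomes the expected length of one holding interval on the
  event that the chain sits at \<open>y\<close>. That event depends on the jump variables alone, so
  the exponential time integrates separately to \<open>1 / exit_rate\<close>.\<close>

lemma holding_interval_le:
  "(\<integral>\<^sup>+t\<in>{0..}. emeasure (walk_space a \<kappa> h) {w \<in> space (walk_space a \<kappa> h).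
       jump_chain x k w = Some y \<and> jump_time a \<kappa> h x k w \<le> t \<and> t < jump_time a \<kappa> h x (Suc k) w} \<partial>lborel)
    \<le> ennreal (visit a \<kappa> h x k y / exit_rate a \<kappa> h y)"
proof -
  let ?W = "walk_space a \<kappa> h"
  let ?r = "exit_rate a \<kappa> h y"
  interpret W: prob_space ?W by (rule prob_space_walk_space)
  interpret pair_sigma_finite lborel ?W ..
  interpret P: prob_space hold_space by (intro prob_space_PiM prob_space_exponential_density) simp
  have [measurable]: "jump_chain x k \<in> measurable ?W (count_space UNIV)" by (rule measurable_jump_chain)
  have [measurable]: "jump_time a \<kappa> h x k \<in> borel_measurable ?W" for k by (rule measurable_jump_time)
  define E where "E t w \<longleftrightarrow> jump_chain x k w = Some y \<and> jump_time a \<kappa> h x k w \<le> t \<and> t < jump_time a \<kappa> h x (Suc k) w" for t w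
  have [measurable]: "Measurable.pred (lborel \<Otimes>\<^sub>M ?W) (\<lambda>(t, w). E t w)"
    unfolding E_def by measurable
  have "(\<integral>\<^sup>+t\<in>{0..}. emeasure ?W {w \<in> space ?W. E t w} \<partial>lborel) \<le> (\<integral>\<^sup>+t. emeasure ?W {w \<in> space ?W. E t w} \<partial>lborel)"
    by (intro nn_integral_mono) (auto simp: indicator_def)
  also have "\<dots> = (\<integral>\<^sup>+t. (\<integral>\<^sup>+w. indicator {w \<in> space ?W. E t w} w \<partial>?W) \<partial>lborel)"
    by (intro nn_integral_cong, subst nn_integral_indicator) (auto simp: E_def)
  also have "\<dots> = (\<integral>\<^sup>+t. (\<integral>\<^sup>+w. (if E t w then 1 else 0) \<partial>?W) \<partial>lborel)"
    by (intro nn_integral_cong) (auto simp: indicator_def)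
  also have "\<dots> = (\<integral>\<^sup>+w. (\<integral>\<^sup>+t. (if E t w then 1 else 0) \<partial>lborel) \<partial>?W)"
    by (rule Fubini'[symmetric]) measurable
  also have "\<dots> \<le> (\<integral>\<^sup>+w. (if jump_chain x k w = Some y then ennreal (snd w k / ?r) else 0) \<partial>?W)"
  proof (intro nn_integral_mono)
    fix w
    show "(\<integral>\<^sup>+t. (if E t w then 1 else 0) \<partial>lborel) \<le> (if jump_chain x k w = Some y then ennreal (snd w k / ?r) else 0)"
    proof (cases "jump_chain x k w = Some y")
      case True
      have "(\<integral>\<^sup>+t. (if E t w then 1 else 0) \<partial>lborel)
        = (\<integral>\<^sup>+t. indicator {jump_time a \<kappa> h x k w..<jump_time a \<kappa> h x (Suc k) w} t \<partial>lborel)"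
        using True by (intro nn_integral_cong) (auto simp: E_def indicator_def)
      also have "\<dots> = emeasure lborel {jump_time a \<kappa> h x k w..<jump_time a \<kappa> h x (Suc k) w}" by simp
      also have "\<dots> \<le> ennreal (jump_time a \<kappa> h x (Suc k) w - jump_time a \<kappa> h x k w)"
        \<comment> \<open>Sample points with negative holding times are not excluded; there the
          interval is empty and \<open>ennreal\<close> truncates the difference to 0.\<close>
        by (cases "jump_time a \<kappa> h x k w \<le> jump_time a \<kappa> h x (Suc k) w") auto
      also have "jump_time a \<kappa> h x (Suc k) w - jump_time a \<kappa> h x k w = snd w k / ?r"
        using True by (simp add: jump_time_def)
      finally show ?thesis using True by simp
    qed (simp add: E_def)
  qed
  also have "\<dots> = (\<integral>\<^sup>+u. (\<integral>\<^sup>+v. (if jump_chain x k (u, v) = Some y then ennreal (v k / ?r) else 0) \<partial>hold_space) \<partial>jump_space)"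
  proof -
    have "(\<lambda>w. snd w k) \<in> borel_measurable ?W"
      unfolding walk_space_def
      by (rule measurable_compose[OF measurable_snd])
         (rule measurable_compose[OF measurable_component_singleton[where i=k]], auto)
    then have "(\<lambda>w. if jump_chain x k w = Some y then ennreal (snd w k / ?r) else 0) \<in> borel_measurable ?W"
      by measurable
    then show ?thesis
      unfolding walk_space_def by (subst P.nn_integral_fst[symmetric]) (auto cong: if_cong)
  qed
  also have "\<dots> = (\<integral>\<^sup>+u. (\<integral>\<^sup>+v. (if jump_chain x k (u, v) = Some y then 1 else 0) \<partial>hold_space) * ennreal (1 / ?r) \<partial>jump_space)"
  proof (intro nn_integral_cong)
    fix u
    \<comment> \<open>For fixed jump variables the event is constant in the holding times.\<close>
    obtain b where eq: "jump_chain x k (u, v) = Some y \<longleftrightarrow> b" for v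
      using jump_chain_fst by metis
    show "(\<integral>\<^sup>+v. (if jump_chain x k (u, v) = Some y then ennreal (v k / ?r) else 0) \<partial>hold_space)
      = (\<integral>\<^sup>+v. (if jump_chain x k (u, v) = Some y then 1 else 0) \<partial>hold_space) * ennreal (1 / ?r)"
      unfolding eq using nn_integral_hold[OF exit_rate_pos[of y], of k]
      by (cases b) (auto simp: P.emeasure_space_1)
  qed
  also have "\<dots> = (\<integral>\<^sup>+u. (\<integral>\<^sup>+v. (if jump_chain x k (u, v) = Some y then 1 else 0) \<partial>hold_space) \<partial>jump_space) * ennreal (1 / ?r)"
  proof (rule nn_integral_multc)
    have "(\<lambda>w. if jump_chain x k w = Some y then 1 else 0 :: ennreal) \<in> borel_measurable ?W" by measurable
    then show "(\<lambda>u. \<integral>\<^sup>+v. (if jump_chain x k (u, v) = Some y then 1 else 0) \<partial>hold_space) \<in> borel_measurable jump_space"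
      unfolding walk_space_def by (intro P.borel_measurable_nn_integral) (simp add: case_prod_beta)
  qed
  also have "(\<integral>\<^sup>+u. (\<integral>\<^sup>+v. (if jump_chain x k (u, v) = Some y then 1 else 0) \<partial>hold_space) \<partial>jump_space)
    = (\<integral>\<^sup>+w. (if jump_chain x k w = Some y then 1 else 0) \<partial>?W)"
  proof -
    have "(\<lambda>w. if jump_chain x k w = Some y then 1 else 0 :: ennreal) \<in> borel_measurable ?W" by measurable
    then show ?thesis
      unfolding walk_space_def by (subst P.nn_integral_fst[symmetric]) auto
  qed
  also have "\<dots> = (\<integral>\<^sup>+w. indicator {w \<in> space ?W. jump_chain x k w = Some y} w \<partial>?W)"
    by (intro nn_integral_cong) (auto simp: indicator_def)
  also have "\<dots> = emeasure ?W {w \<in> space ?W. jump_chain x k w = Some y}"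
    by (rule nn_integral_indicator) measurable
  also have "\<dots> * ennreal (1 / ?r) \<le> ennreal (visit a \<kappa> h x k y) * ennreal (1 / ?r)"
    by (intro mult_right_mono emeasure_jump_chain_le) auto
  also have "\<dots> = ennreal (visit a \<kappa> h x k y / ?r)"
    using exit_rate_pos[of y] visit_nonneg by (simp add: ennreal_mult'[symmetric])
  finally show ?thesis by (simp add: E_def)
qed

text \<open>Being at \<open>y\<close> at time \<open>t\<close> means that some holding interval at
  \<open>y\<close> contains \<open>t\<close>. After explosion the walk is in the cemetery, so these
  intervals cover the event.\<close>

lemma green_le_suminf: "green a \<kappa> h x y \<le> (\<Sum>k. ennreal (visit a \<kappa> h x k y / exit_rate a \<kappa> h y))"
proof -
  let ?W = "walk_space a \<kappa> h"
  let ?T = "jump_time a \<kappa> h x"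
  interpret W: prob_space ?W by (rule prob_space_walk_space)
  define A where "A k t = {w \<in> space ?W. jump_chain x k w = Some y \<and> ?T k w \<le> t \<and> t < ?T (Suc k) w}" for k t
  have [measurable]: "jump_chain x k \<in> measurable ?W (count_space UNIV)" for k by (rule measurable_jump_chain)
  have [measurable]: "?T k \<in> borel_measurable ?W" for k by (rule measurable_jump_time)
  have Am: "A k t \<in> sets ?W" for k t unfolding A_def by measurable
  have "emeasure ?W {w \<in> space ?W. walk a \<kappa> h x t w = Some y} \<le> (\<Sum>k. emeasure ?W (A k t))" if t: "0 \<le> t" for t
  proof -
    have "{w \<in> space ?W. walk a \<kappa> h x t w = Some y} \<subseteq> (\<Union>k. A k t)"
    proof
      fix w assume w: "w \<in> {w \<in> space ?W. walk a \<kappa> h x t w = Some y}"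
      define k where "k = (LEAST k. t < ?T (Suc k) w)"
      have ex: "\<exists>k. t < ?T (Suc k) w" and k: "jump_chain x k w = Some y"
        using w by (auto simp: walk_def k_def split: if_splits)
      have "t < ?T (Suc k) w" unfolding k_def using ex by (rule LeastI_ex)
      moreover have "?T k w \<le> t"
      proof (cases k)
        case 0
        then show ?thesis using t by (simp add: jump_time_def)
      next
        case (Suc j)
        then have "j < k" by simp
        then have "\<not> t < ?T (Suc j) w" unfolding k_def by (rule not_less_Least)
        then show ?thesis using Suc by simp
      qed
      ultimately show "w \<in> (\<Union>k. A k t)" using w k by (auto simp: A_def)
    qed
    then have "emeasure ?W {w \<in> space ?W. walk a \<kappa> h x t w = Some y} \<le> emeasure ?W (\<Union>k. A k t)"
      using Am by (intro emeasure_mono) auto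
    also have "\<dots> \<le> (\<Sum>k. emeasure ?W (A k t))"
      using Am by (intro emeasure_subadditive_countably) auto
    finally show ?thesis .
  qed
  then have "green a \<kappa> h x y \<le> (\<integral>\<^sup>+t\<in>{0..}. (\<Sum>k. emeasure ?W (A k t)) \<partial>lborel)"
    unfolding green_def by (intro nn_integral_mono) (auto simp: indicator_def)
  also have "\<dots> = (\<integral>\<^sup>+t. (\<Sum>k. emeasure ?W (A k t) * indicator {0..} t) \<partial>lborel)"
    by simp
  also have "\<dots> = (\<Sum>k. \<integral>\<^sup>+t\<in>{0..}. emeasure ?W (A k t) \<partial>lborel)"
  proof (rule nn_integral_suminf)
    fix k
    have "Measurable.pred (lborel \<Otimes>\<^sub>M ?W) (\<lambda>p. jump_chain x k (snd p) = Some y \<and> ?T k (snd p) \<le> fst p \<and> fst p < ?T (Suc k) (snd p))"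
      by measurable
    then have "{p \<in> space (lborel \<Otimes>\<^sub>M ?W). jump_chain x k (snd p) = Some y \<and> ?T k (snd p) \<le> fst p \<and> fst p < ?T (Suc k) (snd p)}
       \<in> sets (lborel \<Otimes>\<^sub>M ?W)" (is "?S \<in> _") by (simp add: pred_def)
    then have "(\<lambda>t. emeasure ?W (Pair t -` ?S)) \<in> borel_measurable lborel"
      by (rule W.measurable_emeasure_Pair)
    moreover have "Pair t -` ?S = A k t" for t by (auto simp: A_def space_pair_measure)
    ultimately show "(\<lambda>t. emeasure ?W (A k t) * indicator {0..} t) \<in> borel_measurable lborel"
      by simp
  qed
  also have "\<dots> \<le> (\<Sum>k. ennreal (visit a \<kappa> h x k y / exit_rate a \<kappa> h y))"
    unfolding A_def by (intro suminf_le holding_interval_le) auto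
  finally show ?thesis .
qed

end

section \<open>Comparison with kernels of finite balls\<close>

locale killed_cluster = cluster a \<kappa> + killed_walk a \<kappa> h
  for a :: "(int ^ 'd :: finite) set \<Rightarrow> real" and \<kappa> :: "int ^ 'd \<Rightarrow> real" and h :: real
begin

abbreviation "rate \<equiv> exit_rate a \<kappa> h"
abbreviation "nball x n \<equiv> graph_ball a x (real n)"

lemma nball_eq: "nball x n = {y \<in> \<C>. \<rho> x y \<le> n}"
  by (simp add: graph_ball_eq)

lemma finite_nball: "x \<in> \<C> \<Longrightarrow> finite (nball x n)"
proof -
  assume x: "x \<in> \<C>"
  have fin: "finite {y. (adj a ^^ k) x y}" for k
  proof (induction k)
    case (Suc k)
    have "{y. (adj a ^^ Suc k) x y} = (\<Union>z\<in>{z. (adj a ^^ k) x z}. {y. adj a z y})" by auto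
    then show ?case using Suc finite_adj by auto
  qed simp
  have "nball x n \<subseteq> (\<Union>k\<le>n. {y. (adj a ^^ k) x y})"
    using graph_dist_relpowp[OF x] by (auto simp: nball_eq)
  then show ?thesis using fin by (auto intro: finite_subset)
qed

lemma weighted_graph_nball: "x \<in> \<C> \<Longrightarrow> weighted_graph (nball x K) (cond a)"
  by unfold_locales (auto simp: finite_nball cond_nonneg cond_sym)

lemma killed_graph_nball: "x \<in> \<C> \<Longrightarrow> killed_graph (nball x K) (cond a) rate"
proof -
  assume x: "x \<in> \<C>"
  interpret weighted_graph "nball x K" "cond a" by (rule weighted_graph_nball[OF x])
  show ?thesis
  proof
    fix z
    have "(\<Sum>w\<in>nball x K. cond a z w) \<le> mu a z" by (rule sum_cond_le_mu[OF finite_nball[OF x]])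
    also have "\<dots> < rate z" using h \<kappa>[of z] by (simp add: exit_rate_def)
    finally show "(\<Sum>w\<in>nball x K. cond a z w) < rate z" .
  qed
qed

text \<open>The ambient set does not occur in the equations of \<open>finite_green\<close>, so one
  kernel serves all domains and all ambient balls.\<close>

abbreviation "fgreen \<equiv> killed_graph.finite_green (cond a) rate"

lemma visit_eq_0:
  assumes x: "x \<in> \<C>" shows "visit a \<kappa> h x k y \<noteq> 0 \<Longrightarrow> y \<in> \<C> \<and> \<rho> x y \<le> k"
proof (induction k arbitrary: y)
  case 0
  then show ?case using x graph_dist_self by (simp split: if_splits)
next
  case (Suc k)
  then obtain z where z: "adj a y z" "visit a \<kappa> h x k z \<noteq> 0"
    by (auto elim: sum.not_neutral_contains_not_neutral)
  then have "z \<in> \<C>" "\<rho> x z \<le> k" using Suc.IH by auto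
  then show ?case
    using cluster_adj[of z y] graph_dist_lipschitz[OF x, of z y] z adj_sym[of a y z] by auto
qed

text \<open>Fewer than \<open>K + 1\<close> jumps cannot leave the ball of radius \<open>K\<close>,
  so the partial sums of expected visits obey the recursion of the kernel there without boundary
  loss.\<close>

lemma visits_le_fgreen:
  assumes x: "x \<in> \<C>" and "y \<in> nball x K" "n \<le> K"
  shows "(\<Sum>k<n. visit a \<kappa> h x k y) / rate y \<le> fgreen (nball x K) x y"
  using assms(2,3)
proof (induction n arbitrary: y)
  interpret killed_graph "nball x K" "cond a" rate by (rule killed_graph_nball[OF x])
  case 0
  then show ?case by (simp add: finite_green_nonneg)
next
  interpret killed_graph "nball x K" "cond a" rate by (rule killed_graph_nball[OF x])
  case (Suc n)
  define U where "U z = (\<Sum>k<n. visit a \<kappa> h x k z) / rate z" for z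
  have U0: "U z = 0" if "z \<notin> nball x K" for z
  proof -
    have "visit a \<kappa> h x k z = 0" if "k < n" for k
      by (rule ccontr)
         (use visit_eq_0[OF x, of k z] \<open>z \<notin> nball x K\<close> that Suc.prems in \<open>auto simp: nball_eq\<close>)
    then show ?thesis by (simp add: U_def)
  qed
  have "(\<Sum>k<Suc n. visit a \<kappa> h x k y)
    = visit a \<kappa> h x 0 y + (\<Sum>k<n. \<Sum>z | adj a y z. visit a \<kappa> h x k z * (a {z, y} / rate z))"
    by (subst sum.lessThan_Suc_shift) simp
  also have "(\<Sum>k<n. \<Sum>z | adj a y z. visit a \<kappa> h x k z * (a {z, y} / rate z))
    = (\<Sum>z | adj a y z. cond a y z * U z)"
    by (subst sum.swap) (auto simp: U_def cond_def sum_divide_distrib sum_distrib_left insert_commute intro!: sum.cong)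
  also have "\<dots> = (\<Sum>z\<in>{z. adj a y z} \<inter> nball x K. cond a y z * U z)"
    using U0 finite_adj by (intro sum.mono_neutral_right) auto
  also have "\<dots> = (\<Sum>z\<in>nball x K. cond a y z * U z)"
    using finite_nball[OF x] by (intro sum.mono_neutral_left) (auto simp: cond_def)
  also have "\<dots> \<le> (\<Sum>z\<in>nball x K. cond a y z * fgreen (nball x K) x z)"
    unfolding U_def using Suc.prems by (intro sum_mono mult_left_mono Suc.IH cond_nonneg) auto
  finally have "(\<Sum>k<Suc n. visit a \<kappa> h x k y)
    \<le> (if y = x then 1 else 0) + (\<Sum>z\<in>nball x K. cond a y z * fgreen (nball x K) x z)"
    by simp
  also have "\<dots> = rate y * fgreen (nball x K) x y"
    by (rule finite_green_eq[symmetric]) (use Suc.prems in auto)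
  finally show ?case using exit_rate_pos[of y] by (simp add: field_simps)
qed

text \<open>Any bound uniform in large balls passes to the infinite cluster, because each partial
  sum of visits is below the kernel of some such ball.\<close>

lemma green_le_fgreen:
  assumes x: "x \<in> \<C>" and y: "y \<in> \<C>"
    and M: "\<And>K. K0 \<le> K \<Longrightarrow> fgreen (nball x K) x y \<le> M"
  shows "green a \<kappa> h x y \<le> ennreal M"
proof -
  have "(\<Sum>k<n. ennreal (visit a \<kappa> h x k y / rate y)) \<le> ennreal M" for n
  proof -
    define K where "K = max K0 (max n (\<rho> x y))"
    have "(\<Sum>k<n. ennreal (visit a \<kappa> h x k y / rate y)) = ennreal ((\<Sum>k<n. visit a \<kappa> h x k y) / rate y)"
      unfolding sum_divide_distrib
      by (intro sum_ennreal divide_nonneg_pos visit_nonneg exit_rate_pos)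
    also have "\<dots> \<le> ennreal (fgreen (nball x K) x y)"
      by (intro ennreal_leI visits_le_fgreen x) (use y in \<open>auto simp: nball_eq K_def\<close>)
    also have "\<dots> \<le> ennreal M" by (intro ennreal_leI M) (simp add: K_def)
    finally show ?thesis .
  qed
  then have "(\<Sum>k. ennreal (visit a \<kappa> h x k y / rate y)) \<le> ennreal M"
    by (simp add: suminf_eq_SUP SUP_least)
  then show ?thesis using green_le_suminf order_trans by blast
qed

end

section \<open>Mean values on regular scales\<close>

definition conj_exp :: "real \<Rightarrow> real" where
  "conj_exp p = p / (p - 1)"

text \<open>Half the integrability exponent that \<open>energy_Sobolev\<close> yields when only
  \<open>\<nu>\<close> averaged to the power \<open>q\<close> is controlled.\<close>

definition sob_exp :: "real \<Rightarrow> real \<Rightarrow> real" where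
  "sob_exp d' q = 1 / (1 - 2 / d' + 1 / q)"

definition sob_const :: "real \<Rightarrow> real \<Rightarrow> real \<Rightarrow> real \<Rightarrow> real" where
  "sob_const C_S d' q C = (4 * sob_exp d' q * C_S)\<^sup>2 * C"

text \<open>The simplest sum that dominates all three lower bounds on \<open>K\<close> in
  \<open>regular_ball\<close>.\<close>

definition step_const :: "real \<Rightarrow> real \<Rightarrow> real \<Rightarrow> real \<Rightarrow> real \<Rightarrow> real" where
  "step_const C_reg C_S d' q C = 1 + 4 * sob_const C_S d' q C * C + 4 * C_reg"

definition mv_exp :: "real \<Rightarrow> real \<Rightarrow> real \<Rightarrow> real" where
  "mv_exp d' p q = moser_exp (conj_exp p) (sob_exp d' q)"

text \<open>The last factor converts the inverse volume of the large ball into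
  \<open>1 / N ^ d\<close>.\<close>

definition mv_const :: "real \<Rightarrow> real \<Rightarrow> real \<Rightarrow> real \<Rightarrow> real \<Rightarrow> real \<Rightarrow> real" where
  "mv_const C_reg C_S d' p q C = moser_const (step_const C_reg C_S d' q C) (conj_exp p) (sob_exp d' q) * C_reg"

text \<open>What the estimates use at one centre and one scale, with real exponents; thresholds are
  dealt with only once, in \<open>eventually_regular_scale\<close>.\<close>

definition regular_scale :: "((int ^ 'd) set \<Rightarrow> real) \<Rightarrow> (int ^ 'd \<Rightarrow> real) \<Rightarrow> real \<Rightarrow> real \<Rightarrow> real \<Rightarrow> real \<Rightarrow> real \<Rightarrow> real \<Rightarrow>
    int ^ 'd \<Rightarrow> nat \<Rightarrow> bool" where
  "regular_scale a \<kappa> C_reg C_S d' p q C x N \<longleftrightarrow>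
     1 \<le> N \<and>
     inverse C_reg * real N ^ CARD('d) \<le> real (card (graph_ball a x (real N))) \<and>
     real (card (graph_ball a x (real N))) \<le> C_reg * real N ^ CARD('d) \<and>
     (\<forall>u :: int ^ 'd \<Rightarrow> real.
        (\<forall>y\<in>infinite_cluster a - graph_ball a x (real N). u y = 0) \<longrightarrow>
        avg_norm (ereal (d' / (d' - 1))) u (graph_ball a x (real N))
          \<le> C_S * (real N / real (card (graph_ball a x (real N)))) *
            (\<Sum>\<^sub>\<infinity>(y, z)\<in>{(y, z). y \<in> infinite_cluster a \<and> z \<in> infinite_cluster a \<and>
                             {y, z} \<in> open_edges a}. \<bar>u y - u z\<bar>)) \<and>
     avg_norm (ereal p) (mu a) (graph_ball a x (real N)) \<le> C \<and>
     avg_norm (ereal q) (nu a) (graph_ball a x (real N)) \<le> C \<and>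
     avg_norm 1 (\<lambda>y. 1 / \<kappa> y) (graph_ball a x (real N)) \<le> C"

lemma avg_norm_real: "avg_norm (ereal p) f A = ((\<Sum>x\<in>A. \<bar>f x\<bar> powr p) / real (card A)) powr (1 / p)"
  by (simp add: avg_norm_def)

locale regular_params =
  fixes C_reg C_S d' p q C :: real and dim :: nat
  assumes C: "1 \<le> C_reg" "1 \<le> C_S" "1 \<le> C" and dim: "3 \<le> dim" "real dim \<le> d'"
    and pq: "1 < p" "1 < q" "1 / p + 1 / q < 2 / d'"
begin

lemma conj_exp: "1 < conj_exp p" "1 / p + 1 / conj_exp p = 1"
  using pq by (auto simp: conj_exp_def field_simps)

lemma d'_bounds: "3 \<le> d'" "2 / d' \<le> 2 / 3" "0 < 1 / d'"
proof -
  show "3 \<le> d'" using dim by linarith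
  then show "2 / d' \<le> 2 / 3" "0 < 1 / d'" by (auto simp: field_simps)
qed

lemma sob_exp: "1 / sob_exp d' q = 1 - 2 / d' + 1 / q" "1 \<le> sob_exp d' q"
proof -
  show *: "1 / sob_exp d' q = 1 - 2 / d' + 1 / q" by (simp add: sob_exp_def)
  have "0 < 1 / q" "0 < 1 / p" using pq by auto
  then have "0 < 1 - 2 / d' + 1 / q" "1 - 2 / d' + 1 / q \<le> 1" using d'_bounds pq by linarith+
  then show "1 \<le> sob_exp d' q" by (simp add: sob_exp_def)
qed

text \<open>Equivalent to \<open>1 / p + 1 / q < 2 / d'\<close>. It says that one iteration step
  gains more from Sobolev than Hoelder loses.\<close>

lemma conj_less_sob: "conj_exp p < sob_exp d' q"
proof -
  have "1 / sob_exp d' q < 1 / conj_exp p" using sob_exp(1) conj_exp(2) pq by linarith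
  then show ?thesis using sob_exp(2) conj_exp(1) by (simp add: field_simps)
qed

lemma mv_exp_pos: "0 < mv_exp d' p q"
  using conj_less_sob sob_exp(2) conj_exp(1) by (simp add: mv_exp_def moser_exp_def)

lemma sob_const_nonneg: "0 \<le> sob_const C_S d' q C"
  using C by (simp add: sob_const_def)

lemma mv_const_nonneg: "0 \<le> mv_const C_reg C_S d' p q C"
  using C by (simp add: mv_const_def moser_const_def Let_def)

text \<open>The exponent equals \<open>2 / d' - (1 / p + 1 / q) \<le> 2 / d'\<close>, so
  \<open>dim \<le> d'\<close> keeps the power of \<open>N\<close> at most 2.\<close>

lemma volume_exponent:
  assumes "1 \<le> (N :: real)" "0 < b" "b \<le> C_reg * N ^ dim"
  shows "b powr (1 / conj_exp p - 1 / sob_exp d' q) \<le> C_reg * N\<^sup>2"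
proof -
  define e where "e = 1 / conj_exp p - 1 / sob_exp d' q"
  have "e = 2 / d' - (1 / p + 1 / q)" using sob_exp(1) conj_exp(2) by (simp add: e_def)
  moreover have "0 < 1 / q" "0 < 1 / p" using pq by auto
  ultimately have e: "0 < e" "e \<le> 2 / d'" "e \<le> 1" using pq d'_bounds by linarith+
  have "b powr e \<le> (C_reg * N ^ dim) powr e" using assms e by (intro powr_mono2) auto
  also have "\<dots> = C_reg powr e * N powr (real dim * e)"
    using C assms by (simp add: powr_mult powr_powr flip: powr_realpow)
  also have "\<dots> \<le> C_reg powr 1 * N powr 2"
  proof (intro mult_mono powr_mono)
    have "real dim * e \<le> d' * (2 / d')" using dim e d'_bounds by (intro mult_mono) auto
    then show "real dim * e \<le> 2" using d'_bounds by simp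
  qed (use C assms e in auto)
  finally show ?thesis using C assms by (simp add: e_def)
qed

end

locale regular_cluster = killed_cluster a \<kappa> h + regular_params C_reg C_S d' p q C "CARD('d)"
  for a :: "(int ^ 'd :: finite) set \<Rightarrow> real" and \<kappa> :: "int ^ 'd \<Rightarrow> real" and h :: real
    and C_reg C_S d' p q C :: real
begin

abbreviation "regular \<equiv> regular_scale a \<kappa> C_reg C_S d' p q C"

section \<open>Transfer of the lattice hypotheses to finite balls\<close>

text \<open>An edge that meets the support of \<open>u\<close> stays in the ball with radius larger
  by one, hence \<open>N + 1 \<le> K\<close>.\<close>

lemma gradient_sum_eq:
  assumes x: "x \<in> \<C>" and K: "N + 1 \<le> K" and u: "\<And>y. y \<notin> nball x N \<Longrightarrow> u y = 0"
  shows "(\<Sum>\<^sub>\<infinity>(y, z)\<in>{(y, z). y \<in> \<C> \<and> z \<in> \<C> \<and> {y, z} \<in> open_edges a}. \<bar>u y - u z\<bar>)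
    = (\<Sum>y\<in>nball x K. \<Sum>z\<in>nball x K. if 0 < cond a y z then \<bar>u y - u z\<bar> else (0 :: real))"
proof -
  let ?V = "nball x K"
  have fin: "finite ?V" by (rule finite_nball[OF x])
  have sub: "nball x N \<subseteq> ?V" using K by (auto simp: nball_eq)
  have near: "z \<in> ?V" if "y \<in> nball x N" "adj a y z" for y z
    using that K graph_dist_lipschitz[OF x, of y z] cluster_adj[of y z] by (auto simp: nball_eq)
  have "(\<Sum>\<^sub>\<infinity>(y, z)\<in>{(y, z). y \<in> \<C> \<and> z \<in> \<C> \<and> {y, z} \<in> open_edges a}. \<bar>u y - u z\<bar>)
     = (\<Sum>\<^sub>\<infinity>(y, z)\<in>?V \<times> ?V. if 0 < cond a y z then \<bar>u y - u z\<bar> else 0)"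
  proof (rule infsum_cong_neutral)
    fix yz assume "yz \<in> ?V \<times> ?V - {(y, z). y \<in> \<C> \<and> z \<in> \<C> \<and> {y, z} \<in> open_edges a}"
    then show "(case yz of (y, z) \<Rightarrow> if 0 < cond a y z then \<bar>u y - u z\<bar> else 0) = 0"
      by (auto simp: cond_pos_iff adj_def nball_eq split: if_splits)
  next
    fix yz assume *: "yz \<in> {(y, z). y \<in> \<C> \<and> z \<in> \<C> \<and> {y, z} \<in> open_edges a} - ?V \<times> ?V"
    obtain y z where yz: "yz = (y, z)" by (cases yz)
    have adj: "adj a y z" "adj a z y" and out: "\<not> (y \<in> ?V \<and> z \<in> ?V)"
      using * adj_sym[of a y z] unfolding yz by (auto simp: adj_def)
    then have "y \<notin> nball x N" "z \<notin> nball x N" using near[of y z] near[of z y] sub by blast+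
    then show "(case yz of (y, z) \<Rightarrow> \<bar>u y - u z\<bar>) = 0" using u by (simp add: yz)
  next
    fix yz assume "yz \<in> {(y, z). y \<in> \<C> \<and> z \<in> \<C> \<and> {y, z} \<in> open_edges a} \<inter> ?V \<times> ?V"
    then show "(case yz of (y, z) \<Rightarrow> \<bar>u y - u z\<bar>) = (case yz of (y, z) \<Rightarrow> if 0 < cond a y z then \<bar>u y - u z\<bar> else 0)"
      by (auto simp: cond_pos_iff adj_def)
  qed
  also have "\<dots> = (\<Sum>(y, z)\<in>?V \<times> ?V. if 0 < cond a y z then \<bar>u y - u z\<bar> else 0)"
    using fin by (intro infsum_finite) auto
  finally show ?thesis by (simp add: sum.cartesian_product)
qed

lemma self_in_nball: "x \<in> \<C> \<Longrightarrow> x \<in> nball x N"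
  using graph_dist_self[of x] by (simp add: nball_eq)

lemma card_nball_pos: "x \<in> \<C> \<Longrightarrow> 0 < card (nball x N)"
  using self_in_nball[of x N] finite_nball[of x N] by (auto simp: card_gt_0_iff)

lemma regular_ball_nball:
  assumes x: "x \<in> \<C>" and reg: "regular x N" and K: "N + 1 \<le> K"
  shows "regular_ball (nball x K) (cond a) (nball x N) (real N) (real (card (nball x N))) p (conj_exp p) (sob_exp d' q)
     (sob_const C_S d' q C) C C_reg (step_const C_reg C_S d' q C)"
proof -
  interpret weighted_graph "nball x K" "cond a" by (rule weighted_graph_nball[OF x])
  let ?B = "nball x N" and ?V = "nball x K"
  let ?b = "real (card ?B)"
  have N: "1 \<le> real N" using reg by (simp add: regular_scale_def)
  have b: "0 < ?b" using card_nball_pos[OF x] by simp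
  have fin: "finite ?V" by (rule finite_nball[OF x])
  have mono_norm: "((\<Sum>y\<in>?B. f y powr r) / ?b) powr (1 / r) \<le> C"
    if "avg_norm (ereal r) g ?B \<le> C" "1 < r" "\<And>y. 0 \<le> f y" "\<And>y. f y \<le> g y" for f g r
  proof -
    have "((\<Sum>y\<in>?B. f y powr r) / ?b) powr (1 / r) \<le> ((\<Sum>y\<in>?B. \<bar>g y\<bar> powr r) / ?b) powr (1 / r)"
    proof (intro powr_mono2 divide_right_mono sum_mono)
      show "f y \<le> \<bar>g y\<bar>" for y using that(4)[of y] by simp
    qed (use that in \<open>auto intro!: divide_nonneg_nonneg sum_nonneg\<close>)
    then show ?thesis using that(1) by (simp add: avg_norm_real)
  qed
  have nu_bound: "((\<Sum>y\<in>?B. (\<Sum>z\<in>?V. 1 / cond a y z) powr q) / ?b) powr (1 / q) \<le> C"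
    using reg pq sum_inverse_cond_le_nu[OF fin] cond_nonneg
    by (intro mono_norm[of q "nu a"]) (auto simp: regular_scale_def intro!: sum_nonneg)
  have Sob: "((\<Sum>y\<in>?B. \<bar>v y\<bar> powr (d' / (d' - 1))) / ?b) powr (1 / (d' / (d' - 1)))
      \<le> C_S * (real N / ?b) * (\<Sum>y\<in>?V. \<Sum>z\<in>?V. if 0 < cond a y z then \<bar>v y - v z\<bar> else 0)"
    if "\<And>y. y \<notin> ?B \<Longrightarrow> v y = 0" for v
  proof -
    have "avg_norm (ereal (d' / (d' - 1))) v ?B \<le> C_S * (real N / ?b) *
       (\<Sum>\<^sub>\<infinity>(y, z)\<in>{(y, z). y \<in> \<C> \<and> z \<in> \<C> \<and> {y, z} \<in> open_edges a}. \<bar>v y - v z\<bar>)"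
      using reg that by (simp add: regular_scale_def)
    also have "(\<Sum>\<^sub>\<infinity>(y, z)\<in>{(y, z). y \<in> \<C> \<and> z \<in> \<C> \<and> {y, z} \<in> open_edges a}. \<bar>v y - v z\<bar>)
      = (\<Sum>y\<in>?V. \<Sum>z\<in>?V. if 0 < cond a y z then \<bar>v y - v z\<bar> else 0)"
      by (rule gradient_sum_eq[OF x K that])
    finally show ?thesis unfolding avg_norm_real .
  qed
  show ?thesis
  proof unfold_locales
    show "?B \<subseteq> ?V" using K by (auto simp: nball_eq)
    show "?B \<noteq> {}" using self_in_nball[OF x] by blast
    show "((\<Sum>y\<in>?B. (\<Sum>z\<in>?V. cond a y z) powr p) / ?b) powr (1 / p) \<le> C"
      using reg pq sum_cond_le_mu[OF fin] cond_nonneg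
      by (intro mono_norm[of p "mu a"]) (auto simp: regular_scale_def intro!: sum_nonneg)
    show "?b powr (1 / conj_exp p - 1 / sob_exp d' q) \<le> C_reg * (real N)\<^sup>2"
      using reg by (intro volume_exponent N b) (simp add: regular_scale_def)
    show "((\<Sum>y\<in>?B. \<bar>w y\<bar> powr (2 * sob_exp d' q)) / ?b) powr (1 / sob_exp d' q)
       \<le> sob_const C_S d' q C * ((real N)\<^sup>2 / ?b) * energy w" if w: "\<And>y. y \<notin> ?B \<Longrightarrow> w y = 0" for w
      unfolding sob_const_def using C d'_bounds N
      by (intro energy_Sobolev[OF \<open>?B \<subseteq> ?V\<close> \<open>?B \<noteq> {}\<close> _ pq(2) sob_exp refl _ _ _ Sob nu_bound w]) auto
  qed (use N conj_exp conj_less_sob pq C sob_const_nonneg in \<open>auto simp: step_const_def\<close>)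
qed

text \<open>The ball around \<open>x0\<close> need only lie inside the regular ball of
  \<open>x\<close>. The factor \<open>N / R\<close> compensates for averaging over a small ball
  while dividing by the large volume.\<close>

lemma mean_value_nball:
  assumes x: "x \<in> \<C>" and reg: "regular x N" and K: "N + 1 \<le> K"
    and x0: "x0 \<in> \<C>" "real (\<rho> x x0) + R \<le> real N" and R: "0 < R"
    and u: "\<And>y. y \<in> nball x K \<Longrightarrow> 0 \<le> u y"
    and sub: "\<And>y. y \<in> \<C> \<Longrightarrow> real (\<rho> x0 y) \<le> R \<Longrightarrow> 0 \<le> weighted_graph.laplace (nball x K) (cond a) u y"
  shows "u x0 \<le> mv_const C_reg C_S d' p q C * (real N / R) powr mv_exp d' p q / real N ^ CARD('d)
    * (\<Sum>y\<in>graph_ball a x0 R. u y)"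
proof -
  let ?B = "nball x N" and ?V = "nball x K"
  let ?b = "real (card ?B)" and ?m = "moser_const (step_const C_reg C_S d' q C) (conj_exp p) (sob_exp d' q)"
  have near: "y \<in> ?B" if "y \<in> \<C>" "real (\<rho> x0 y) \<le> R" for y
    using that graph_dist_triangle[OF x x0(1) that(1)] x0(2) by (simp add: nball_eq)
  have BV: "?B \<subseteq> ?V" using K by (auto simp: nball_eq)
  interpret regular_ball ?V "cond a" ?B "real N" ?b p "conj_exp p" "sob_exp d' q"
     "sob_const C_S d' q C" C C_reg "step_const C_reg C_S d' q C"
    by (rule regular_ball_nball[OF x reg K])
  interpret subharmonic ?V "cond a" ?B "real N" ?b p "conj_exp p" "sob_exp d' q"
     "sob_const C_S d' q C" C C_reg "step_const C_reg C_S d' q C" "\<lambda>y. real (\<rho> x0 y)" u R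
    using R x0 u sub near graph_dist_lipschitz[OF x0(1)]
    by unfold_locales (auto simp: nball_eq cond_pos_iff)
  have S: "S R = graph_ball a x0 R" unfolding S_def using near BV by (auto simp: graph_ball_eq nball_eq)
  have sum0: "0 \<le> (\<Sum>y\<in>graph_ball a x0 R. u y)"
    unfolding S[symmetric] using u by (intro sum_nonneg) (auto simp: S_def)
  have N: "0 < real N" using reg by (simp add: regular_scale_def)
  have bN: "real N ^ CARD('d) \<le> C_reg * ?b"
    using reg C by (simp add: regular_scale_def field_simps)
  have b: "0 < ?b" by (rule b_pos)
  have "u x0 \<le> ?m * (real N / R) powr mv_exp d' p q
    * ((\<Sum>y\<in>graph_ball a x0 R. u y) / ?b)"
    unfolding S[symmetric] mv_exp_def
    by (rule mean_value) (use graph_dist_self[OF x0(1)] near[OF x0(1)] BV R x0 in auto)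
  also have "\<dots> \<le> ?m * (real N / R) powr mv_exp d' p q
    * (C_reg * (\<Sum>y\<in>graph_ball a x0 R. u y) / real N ^ CARD('d))"
  proof (intro mult_left_mono)
    have "(\<Sum>y\<in>graph_ball a x0 R. u y) * real N ^ CARD('d) \<le> (\<Sum>y\<in>graph_ball a x0 R. u y) * (C_reg * ?b)"
      using bN sum0 by (intro mult_left_mono) auto
    then show "(\<Sum>y\<in>graph_ball a x0 R. u y) / ?b \<le> C_reg * (\<Sum>y\<in>graph_ball a x0 R. u y) / real N ^ CARD('d)"
      using b N by (simp add: field_simps)
  qed (auto simp: moser_const_def Let_def)
  finally show ?thesis by (simp add: mv_const_def field_simps)
qed

text \<open>The second variable is treated first, with the first frozen at \<open>x0\<close>; then
  every term of the resulting sum is a value in the first variable. Hence subharmonicity in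
  \<open>w\<close> is asked of \<open>H x0\<close> only.\<close>

lemma two_sided_mean_value:
  assumes x: "x \<in> \<C>" and reg: "regular x N" and K: "N + 1 \<le> K"
    and x0: "x0 \<in> \<C>" "real (\<rho> x x0) + R \<le> real N" "0 < R"
    and y0: "y0 \<in> \<C>" "real (\<rho> x y0) + R' \<le> real N" "0 < R'"
    and H: "\<And>z w. 0 \<le> H z w"
    and sub1: "\<And>z w. z \<in> graph_ball a x0 R \<Longrightarrow> w \<in> graph_ball a y0 R' \<Longrightarrow>
      0 \<le> weighted_graph.laplace (nball x K) (cond a) (\<lambda>z. H z w) z"
    and sub2: "\<And>w. w \<in> graph_ball a y0 R' \<Longrightarrow>
      0 \<le> weighted_graph.laplace (nball x K) (cond a) (H x0) w"
  shows "H x0 y0 \<le> (mv_const C_reg C_S d' p q C / real N ^ CARD('d))\<^sup>2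
     * ((real N / R) * (real N / R')) powr mv_exp d' p q
     * (\<Sum>z\<in>graph_ball a x0 R. \<Sum>w\<in>graph_ball a y0 R'. H z w)"
proof -
  define M where "M r = mv_const C_reg C_S d' p q C * (real N / r) powr mv_exp d' p q / real N ^ CARD('d)" for r
  have M: "0 \<le> M r" for r using mv_const_nonneg by (simp add: M_def)
  have "H x0 y0 \<le> M R' * (\<Sum>w\<in>graph_ball a y0 R'. H x0 w)"
    unfolding M_def by (rule mean_value_nball[OF x reg K y0 H]) (use sub2 in \<open>auto simp: graph_ball_eq\<close>)
  also have "\<dots> \<le> M R' * (\<Sum>w\<in>graph_ball a y0 R'. M R * (\<Sum>z\<in>graph_ball a x0 R. H z w))"
  proof (intro mult_left_mono sum_mono M)
    fix w assume w: "w \<in> graph_ball a y0 R'"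
    show "H x0 w \<le> M R * (\<Sum>z\<in>graph_ball a x0 R. H z w)"
      unfolding M_def by (rule mean_value_nball[OF x reg K x0, where u = "\<lambda>z. H z w"])
        (use sub1 w H in \<open>auto simp: graph_ball_eq\<close>)
  qed
  also have "\<dots> = M R' * M R * (\<Sum>w\<in>graph_ball a y0 R'. \<Sum>z\<in>graph_ball a x0 R. H z w)"
    by (simp add: sum_distrib_left mult.assoc)
  also have "(\<Sum>w\<in>graph_ball a y0 R'. \<Sum>z\<in>graph_ball a x0 R. H z w)
    = (\<Sum>z\<in>graph_ball a x0 R. \<Sum>w\<in>graph_ball a y0 R'. H z w)"
    by (rule sum.swap)
  also have "M R' * M R = (mv_const C_reg C_S d' p q C / real N ^ CARD('d))\<^sup>2
     * ((real N / R) * (real N / R')) powr mv_exp d' p q"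
    using x0(3) y0(3) unfolding M_def by (subst powr_mult) (simp_all add: power2_eq_square)
  finally show ?thesis .
qed

end

section \<open>The two regimes of the killing rate\<close>

text \<open>The decay rate in the theorem. It satisfies
  \<open>3 * lam\<^sup>2 * 3 ^ d \<le> 1\<close>, the absorption condition of Agmon's estimate: one
  3 comes from \<open>exp_diff_squared_le\<close>, and \<open>3 ^ d\<close> bounds the
  degree.\<close>

definition Agmon_rate :: "nat \<Rightarrow> real" where
  "Agmon_rate d = 1 / (2 * 3 ^ d)"

lemma Agmon_rate: "0 < Agmon_rate d" "Agmon_rate d < 1" "3 * (Agmon_rate d)\<^sup>2 * 3 ^ d \<le> 1"
proof -
  have *: "(1 :: real) \<le> 3 ^ d" by simp
  have "(1 :: real) < 2 * 3 ^ d" "(3 :: real) \<le> 4 * 3 ^ d" using * by linarith+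
  then show "0 < Agmon_rate d" "Agmon_rate d < 1" "3 * (Agmon_rate d)\<^sup>2 * 3 ^ d \<le> 1"
    by (auto simp: Agmon_rate_def power2_eq_square field_simps)
qed

text \<open>\<open>256 = 16 * 16\<close> comes from averaging over radii \<open>s / 8\<close> and
  \<open>l / 8\<close> inside radius \<open>2 * l\<close>, and \<open>2 * exp 1\<close> from Agmon's
  estimate with a weight at least \<open>exp (-1)\<close> near \<open>x\<close>.\<close>

definition large_const :: "real \<Rightarrow> real \<Rightarrow> real \<Rightarrow> real \<Rightarrow> real \<Rightarrow> real \<Rightarrow> real" where
  "large_const C_reg C_S d' p q C =
     2 * exp 1 * (mv_const C_reg C_S d' p q C)\<^sup>2 * (C * C_reg) * 256 powr mv_exp d' p q"

text \<open>The kernel of the intermediate ball contributes the first summand, with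
  \<open>128 = 2 * 4 ^ 2 * 2 ^ 2\<close> from the radius \<open>4 * R\<close> and
  \<open>R \<le> 2 * l * \<tau>\<close>; the harmonic remainder contributes the second, with
  \<open>16 = 4 * 4\<close>.\<close>

definition small_const :: "real \<Rightarrow> real \<Rightarrow> real \<Rightarrow> real \<Rightarrow> real \<Rightarrow> real \<Rightarrow> real" where
  "small_const C_reg C_S d' p q C =
     128 * (mv_const C_reg C_S d' p q C)\<^sup>2 * 256 powr mv_exp d' p q * sob_const C_S d' q C * C_reg
     + 2 * (C * C_reg) * (mv_const C_reg C_S d' p q C)\<^sup>2 * 16 powr mv_exp d' p q"

context regular_cluster
begin

abbreviation "c_large \<equiv> large_const C_reg C_S d' p q C"
abbreviation "c_small \<equiv> small_const C_reg C_S d' p q C"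

abbreviation "M \<equiv> mv_const C_reg C_S d' p q C"
abbreviation "k \<equiv> mv_exp d' p q"
abbreviation "Sb \<equiv> sob_const C_S d' q C"

lemma graph_dist_near:
  assumes "x \<in> \<C>" "y \<in> \<C>" "w \<in> \<C>"
  shows "\<rho> x w \<le> \<rho> x y + \<rho> y w" "\<rho> x y \<le> \<rho> x w + \<rho> y w"
  using assms graph_dist_triangle[of x y w] graph_dist_triangle[of x w y] graph_dist_sym[of y w] by auto

lemma nball_mono: "N \<le> K \<Longrightarrow> nball x N \<subseteq> nball x K"
  by (auto simp: nball_eq)

lemma regular_volume: "regular x N \<Longrightarrow> real (card (nball x N)) \<le> C_reg * real N ^ CARD('d)"
  by (simp add: regular_scale_def)

text \<open>Jensen lowers the exponent in the energy Sobolev inequality to 2; the volume then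
  cancels.\<close>

lemma Poincare:
  assumes x: "x \<in> \<C>" and reg: "regular x N" and K: "N + 1 \<le> K" and f: "\<And>y. y \<notin> nball x N \<Longrightarrow> f y = 0"
  shows "(\<Sum>y\<in>nball x N. (f y)\<^sup>2) \<le> Sb * (real N)\<^sup>2 * weighted_graph.energy (nball x K) (cond a) f"
proof -
  let ?b = "real (card (nball x N))"
  interpret regular_ball "nball x K" "cond a" "nball x N" "real N" ?b p "conj_exp p" "sob_exp d' q"
     Sb C C_reg "step_const C_reg C_S d' q C"
    by (rule regular_ball_nball[OF x reg K])
  have "(\<Sum>y\<in>nball x N. (f y)\<^sup>2) / ?b
    \<le> ((\<Sum>y\<in>nball x N. (f y)\<^sup>2 powr sob_exp d' q) / ?b) powr (1 / sob_exp d' q)"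
    using b_pos sob_exp by (intro avg_powr_le_avg_powr finite_B) auto
  also have "(\<Sum>y\<in>nball x N. (f y)\<^sup>2 powr sob_exp d' q) = (\<Sum>y\<in>nball x N. \<bar>f y\<bar> powr (2 * sob_exp d' q))"
  proof (intro sum.cong refl)
    fix y
    have "(f y)\<^sup>2 = \<bar>f y\<bar> powr 2" by (cases "f y = 0") (auto simp: powr_numeral)
    then show "(f y)\<^sup>2 powr sob_exp d' q = \<bar>f y\<bar> powr (2 * sob_exp d' q)" by (simp only: powr_powr)
  qed
  also have "(\<dots> / ?b) powr (1 / sob_exp d' q) \<le> Sb * ((real N)\<^sup>2 / ?b) * energy f"
    by (rule Sobolev[OF f])
  finally show ?thesis using b_pos by (simp add: field_simps)
qed

lemma inverse_killing_sum:
  assumes "regular x N" "X \<subseteq> nball x N" "x \<in> \<C>"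
  shows "(\<Sum>y\<in>X. 1 / \<kappa> y) \<le> C * C_reg * real N ^ CARD('d)"
proof -
  let ?b = "real (card (nball x N))"
  have b: "0 < ?b" using card_nball_pos[OF assms(3)] by simp
  have "avg_norm (ereal 1) (\<lambda>y. 1 / \<kappa> y) (nball x N) \<le> C"
    using assms(1) by (simp add: regular_scale_def one_ereal_def)
  then have "(\<Sum>y\<in>nball x N. 1 / \<kappa> y) / ?b \<le> C"
    unfolding avg_norm_real using \<kappa> by (simp add: sum_nonneg less_imp_le)
  then have "(\<Sum>y\<in>nball x N. 1 / \<kappa> y) \<le> C * ?b" using b by (simp add: field_simps)
  also have "\<dots> \<le> C * (C_reg * real N ^ CARD('d))"
    using regular_volume[OF assms(1)] C by (intro mult_left_mono) auto
  finally have "(\<Sum>y\<in>nball x N. 1 / \<kappa> y) \<le> C * C_reg * real N ^ CARD('d)" by simp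
  moreover have "(\<Sum>y\<in>X. 1 / \<kappa> y) \<le> (\<Sum>y\<in>nball x N. 1 / \<kappa> y)"
    using assms \<kappa> finite_nball by (intro sum_mono2) (auto simp: less_imp_le)
  ultimately show ?thesis by simp
qed

text \<open>The weight is \<open>exp (- \<psi>)\<close>. Its gradient is dominated by the killing
  because the conductance cancels the denominator of \<open>step_weight\<close>. Leaving
  \<open>\<psi>\<close> free allows a distance in one regime and zero in the other.\<close>

lemma fgreen_sum_le_Agmon:
  assumes x: "x \<in> \<C>" and reg: "regular x N" and K: "N \<le> K" and h1: "h \<le> 1"
    and XY: "X \<subseteq> nball x N" "Y \<subseteq> nball x N"
    and \<psi>: "\<And>y z. y \<in> \<C> \<Longrightarrow> adj a y z \<Longrightarrow> \<bar>\<psi> y - \<psi> z\<bar> \<le> Agmon_rate CARD('d) * sqrt h * step_weight y z"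
    and \<alpha>: "\<And>z. z \<in> X \<Longrightarrow> \<psi> z \<le> \<alpha>" and \<beta>: "\<And>z. z \<in> Y \<Longrightarrow> \<beta> \<le> \<psi> z"
  shows "(\<Sum>z\<in>X. \<Sum>w\<in>Y. fgreen (nball x K) w z) \<le> 2 * exp (\<alpha> - \<beta>) * (C * C_reg * real N ^ CARD('d)) / h"
proof -
  let ?V = "nball x K"
  interpret killed_graph ?V "cond a" rate by (rule killed_graph_nball[OF x])
  define \<phi> where "\<phi> z = exp (- \<psi> z)" for z
  define \<theta> where "\<theta> z = h * \<kappa> z" for z
  define T where "T = C * C_reg * real N ^ CARD('d)"
  have T: "0 \<le> T" using C by (simp add: T_def)
  have NV: "nball x N \<subseteq> ?V" using K by (rule nball_mono)
  have grad: "cond a y z * (\<phi> y - \<phi> z)\<^sup>2 \<le> 3 * (Agmon_rate CARD('d))\<^sup>2 * min (\<theta> y) (\<theta> z) * (\<phi> y * \<phi> z)"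
    if yz: "y \<in> ?V" for y z
  proof (cases "adj a y z")
    case False
    then show ?thesis using \<kappa> h by (auto simp: cond_def \<theta>_def \<phi>_def less_imp_le)
  next
    case True
    let ?m = "min (\<kappa> y) (\<kappa> z)"
    have apos: "0 < a {y, z}" using True by (rule adj_pos)
    have m: "0 < ?m" using \<kappa> by simp
    have sw: "0 \<le> step_weight y z" "step_weight y z \<le> 1" using step_weight_bounds[OF True] by auto
    have lip: "\<bar>- \<psi> y - (- \<psi> z)\<bar> \<le> Agmon_rate CARD('d) * sqrt h * step_weight y z"
      using \<psi>[of y z] yz True by (simp add: nball_eq abs_minus_commute)
    also have "\<dots> \<le> 1 * 1 * 1"
      using sw Agmon_rate[of "CARD('d)"] h h1 by (intro mult_mono) auto
    finally have "\<bar>- \<psi> y - (- \<psi> z)\<bar> \<le> 1" by simp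
    then have "(\<phi> y - \<phi> z)\<^sup>2 \<le> 3 * (- \<psi> y - (- \<psi> z))\<^sup>2 * (\<phi> y * \<phi> z)"
      unfolding \<phi>_def by (rule exp_diff_squared_le)
    also have "\<dots> \<le> 3 * (Agmon_rate CARD('d) * sqrt h * step_weight y z)\<^sup>2 * (\<phi> y * \<phi> z)"
      using power_mono[OF lip, of 2] by (intro mult_right_mono mult_left_mono) (auto simp: \<phi>_def)
    finally have "cond a y z * (\<phi> y - \<phi> z)\<^sup>2 \<le> a {y, z} * (3 * (Agmon_rate CARD('d) * sqrt h * step_weight y z)\<^sup>2 * (\<phi> y * \<phi> z))"
      using True apos by (simp add: cond_def)
    also have "\<dots> = 3 * (Agmon_rate CARD('d))\<^sup>2 * (h * (a {y, z} * (step_weight y z)\<^sup>2)) * (\<phi> y * \<phi> z)"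
      using h by (simp add: power_mult_distrib)
    also have "\<dots> \<le> 3 * (Agmon_rate CARD('d))\<^sup>2 * (h * ?m) * (\<phi> y * \<phi> z)"
    proof (intro mult_right_mono mult_left_mono)
      have "0 \<le> min 1 (?m / a {y, z})" using m apos by simp
      then have "(step_weight y z)\<^sup>2 = min 1 (?m / a {y, z})" by (rule real_sqrt_pow2)
      also have "\<dots> \<le> ?m / a {y, z}" by (rule min.cobounded2)
      finally show "a {y, z} * (step_weight y z)\<^sup>2 \<le> ?m" using apos by (simp add: field_simps)
    qed (use h in \<open>auto simp: \<phi>_def\<close>)
    also have "h * ?m = min (\<theta> y) (\<theta> z)" using h by (simp add: \<theta>_def min_mult_distrib_left)
    finally show ?thesis .
  qed
  have deg: "real (card {z \<in> ?V. 0 < cond a y z}) \<le> 3 ^ CARD('d)" for y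
  proof -
    have "card {z \<in> ?V. 0 < cond a y z} \<le> card {z. adj a y z}"
      using finite_adj by (intro card_mono) (auto simp: cond_pos_iff)
    also have "\<dots> \<le> 3 ^ CARD('d)" by (rule card_adj_le)
    finally show ?thesis by (metis of_nat_le_iff of_nat_numeral of_nat_power)
  qed
  have "(\<Sum>z\<in>X. potential ?V Y z)\<^sup>2
    \<le> 4 * (\<Sum>y\<in>Y. (\<phi> y)\<^sup>2 / \<theta> y) * (\<Sum>z\<in>X. 1 / ((\<phi> z)\<^sup>2 * \<theta> z))"
  proof (rule potential_sum_le_Agmon[OF _ _ _ grad deg _ Agmon_rate(3)])
    show "\<theta> z + (\<Sum>w\<in>?V. cond a z w) \<le> rate z" if "z \<in> ?V" for z
      using sum_cond_le_mu[OF finite_V, of a z] by (simp add: \<theta>_def exit_rate_def)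
  qed (use h \<kappa> XY NV in \<open>auto simp: \<theta>_def \<phi>_def\<close>)
  also have "\<dots> \<le> 4 * (exp (- 2 * \<beta>) / h * T) * (exp (2 * \<alpha>) / h * T)"
  proof -
    have Y: "(\<Sum>y\<in>Y. (\<phi> y)\<^sup>2 / \<theta> y) \<le> exp (- 2 * \<beta>) / h * T"
    proof -
      have "(\<Sum>y\<in>Y. (\<phi> y)\<^sup>2 / \<theta> y) \<le> (\<Sum>y\<in>Y. exp (- 2 * \<beta>) / h * (1 / \<kappa> y))"
      proof (intro sum_mono)
        fix y assume "y \<in> Y"
        then have "(\<phi> y)\<^sup>2 \<le> exp (- 2 * \<beta>)" using \<beta>[of y] by (simp add: \<phi>_def exp_double[symmetric] flip: exp_of_nat_mult)
        then show "(\<phi> y)\<^sup>2 / \<theta> y \<le> exp (- 2 * \<beta>) / h * (1 / \<kappa> y)"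
          using h \<kappa>[of y] by (simp add: \<theta>_def divide_right_mono)
      qed
      also have "\<dots> = exp (- 2 * \<beta>) / h * (\<Sum>y\<in>Y. 1 / \<kappa> y)" by (simp only: sum_distrib_left)
      also have "\<dots> \<le> exp (- 2 * \<beta>) / h * T"
        unfolding T_def using h by (intro mult_left_mono inverse_killing_sum[OF reg XY(2) x]) auto
      finally show ?thesis .
    qed
    have X: "(\<Sum>z\<in>X. 1 / ((\<phi> z)\<^sup>2 * \<theta> z)) \<le> exp (2 * \<alpha>) / h * T"
    proof -
      have "(\<Sum>z\<in>X. 1 / ((\<phi> z)\<^sup>2 * \<theta> z)) \<le> (\<Sum>z\<in>X. exp (2 * \<alpha>) / h * (1 / \<kappa> z))"
      proof (intro sum_mono)
        fix z assume "z \<in> X"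
        have "1 / (\<phi> z)\<^sup>2 = exp (2 * \<psi> z)"
          by (simp add: \<phi>_def exp_minus power_inverse divide_inverse flip: exp_double)
        also have "\<dots> \<le> exp (2 * \<alpha>)" using \<alpha>[OF \<open>z \<in> X\<close>] by simp
        finally have "1 / (\<phi> z)\<^sup>2 / \<theta> z \<le> exp (2 * \<alpha>) / \<theta> z"
          using h \<kappa>[of z] by (intro divide_right_mono) (auto simp: \<theta>_def)
        then show "1 / ((\<phi> z)\<^sup>2 * \<theta> z) \<le> exp (2 * \<alpha>) / h * (1 / \<kappa> z)"
          by (simp add: \<theta>_def)
      qed
      also have "\<dots> = exp (2 * \<alpha>) / h * (\<Sum>z\<in>X. 1 / \<kappa> z)" by (simp only: sum_distrib_left)
      also have "\<dots> \<le> exp (2 * \<alpha>) / h * T"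
        unfolding T_def using h by (intro mult_left_mono inverse_killing_sum[OF reg XY(1) x]) auto
      finally show ?thesis .
    qed
    have \<theta>0: "0 \<le> \<theta> z" for z using h \<kappa>[of z] by (simp add: \<theta>_def)
    show ?thesis using X Y T h \<theta>0 by (intro mult_mono) (auto intro!: sum_nonneg)
  qed
  also have "\<dots> = (2 * exp (\<alpha> - \<beta>) * T / h)\<^sup>2"
  proof -
    have exps: "exp (- 2 * \<beta>) = (exp (- \<beta>))\<^sup>2" "exp (2 * \<alpha>) = (exp \<alpha>)\<^sup>2"
      "exp (\<alpha> - \<beta>) = exp \<alpha> * exp (- \<beta>)"
      using exp_double[of "- \<beta>"] exp_double[of \<alpha>] by (simp_all add: exp_add[symmetric])
    have "4 * (B\<^sup>2 / h * T) * (A\<^sup>2 / h * T) = (2 * (A * B) * T / h)\<^sup>2" for A B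
      by (simp add: power2_eq_square)
    then show ?thesis unfolding exps .
  qed
  finally have "(\<Sum>z\<in>X. potential ?V Y z) \<le> 2 * exp (\<alpha> - \<beta>) * T / h"
    by (rule power2_le_imp_le) (use T h in auto)
  then show ?thesis by (simp add: potential_def T_def)
qed

section \<open>Strong killing: \<open>r \<ge> 1\<close>\<close>

text \<open>\<open>?X\<close> lies within \<open>l / 8\<close> of \<open>x\<close> and
  \<open>?Y\<close> beyond \<open>7 * l / 8\<close>, so the kernel meets no pole. On
  \<open>?X\<close> the exponent \<open>\<psi>\<close> is at most 1, while on \<open>?Y\<close> the
  truncated distance equals \<open>D\<close>; the difference is the asserted decay.\<close>

lemma fgreen_le_large:
  assumes xy: "x \<in> \<C>" "y \<in> \<C>" and l: "l = \<rho> x y" "1 \<le> l" and reg: "regular x (2 * l)" and K: "2 * l + 1 \<le> K"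
    and h1: "h \<le> 1" and r: "r = h * (real l)\<^sup>2" "1 \<le> r"
    and D: "0 \<le> D" "\<And>z. z \<in> \<C> - graph_ball a x (real l / 4) \<Longrightarrow> D \<le> kappa_dist a \<kappa> x z"
  shows "fgreen (nball x K) x y \<le> c_large * r powr (k / 2) * real l powr (2 - real CARD('d)) * exp (- Agmon_rate CARD('d) * sqrt h * D)"
proof -
  let ?V = "nball x K"
  interpret killed_graph ?V "cond a" rate by (rule killed_graph_nball[OF xy(1)])
  define s where "s = 1 / sqrt h"
  define H where "H z w = fgreen ?V w z" for z w
  let ?X = "graph_ball a x (s / 8)" and ?Y = "graph_ball a y (real l / 8)"
  define \<psi> where "\<psi> z = Agmon_rate CARD('d) * sqrt h * min (kappa_dist a \<kappa> x z) D" for z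
  have s: "0 < s" using h by (simp add: s_def)
  have sqr: "sqrt r = sqrt h * real l" using h by (simp add: r real_sqrt_mult)
  have "1 \<le> sqrt r" using r by simp
  then have sl: "s \<le> real l" using h by (simp add: s_def sqr field_simps)
  have xx: "\<rho> x x = 0" using xy graph_dist_self by blast
  have Xsub: "?X \<subseteq> nball x (2 * l)" using sl by (auto simp: graph_ball_eq)
  note tri = graph_dist_near[OF xy, folded l(1)]
  have Ysub: "?Y \<subseteq> nball x (2 * l)" using tri by (fastforce simp: graph_ball_eq)
  have disj: "z \<noteq> w" if "z \<in> ?X" "w \<in> ?Y" for z w
    using that tri(2)[of w] sl l(2) by (auto simp: graph_ball_eq)
  have harm: "0 \<le> laplace (\<lambda>z. fgreen ?V w z) z" if "z \<in> ?V" "z \<noteq> w" for z w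
    using finite_green_eq[of ?V z w] that finite_green_nonneg by (intro laplace_nonneg_of_harmonic) auto
  have "nball x (2 * l) \<subseteq> ?V" using K by (intro nball_mono) simp
  then have XV: "?X \<subseteq> ?V" "?Y \<subseteq> ?V" using Xsub Ysub by blast+
  have "H x y \<le> (M / real (2 * l) ^ CARD('d))\<^sup>2
     * ((real (2 * l) / (s / 8)) * (real (2 * l) / (real l / 8))) powr k
     * (\<Sum>z\<in>?X. \<Sum>w\<in>?Y. H z w)"
  proof (rule two_sided_mean_value[OF xy(1) reg K xy(1) _ _ xy(2)])
    show "0 \<le> laplace (\<lambda>z. H z w) z" if "z \<in> ?X" "w \<in> ?Y" for z w
      unfolding H_def using that XV disj by (intro harm) auto
    show "0 \<le> laplace (H x) w" if w: "w \<in> ?Y" for w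
    proof -
      have "H x = (\<lambda>w. fgreen ?V x w)" unfolding H_def by (intro ext finite_green_commute) simp
      moreover have "x \<noteq> w" using disj[of x w] w xx s xy by (auto simp: graph_ball_eq)
      ultimately show ?thesis using w XV harm[of w x] by auto
    qed
  qed (use sl s l xx in \<open>auto simp: H_def finite_green_nonneg\<close>)
  \<comment> \<open>The short radius costs \<open>16 * sqrt r\<close>, the other one 16; hence the
    power \<open>r powr (k / 2)\<close>.\<close>
  also have "(real (2 * l) / (s / 8)) * (real (2 * l) / (real l / 8)) = 256 * sqrt r"
    using l(2) h by (simp add: sqr s_def)
  also have "(256 * sqrt r) powr k = 256 powr k * r powr (k / 2)"
  proof -
    have "sqrt r = r powr (1 / 2)" using r(2) by (simp add: powr_half_sqrt)
    then have "sqrt r powr k = r powr (k / 2)" by (simp only: powr_powr) simp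
    then show ?thesis using r(2) by (simp add: powr_mult)
  qed
  also have "(M / real (2 * l) ^ CARD('d))\<^sup>2 * (256 powr k * r powr (k / 2)) * (\<Sum>z\<in>?X. \<Sum>w\<in>?Y. H z w)
    \<le> (M / real (2 * l) ^ CARD('d))\<^sup>2 * (256 powr k * r powr (k / 2))
      * (2 * exp (1 - Agmon_rate CARD('d) * sqrt h * D) * (C * C_reg * real (2 * l) ^ CARD('d)) / h)"
    unfolding H_def
  proof (intro mult_left_mono fgreen_sum_le_Agmon[OF xy(1) reg _ h1 Xsub Ysub])
    fix y z assume yz: "y \<in> \<C>" "adj a y z"
    have "\<bar>\<psi> y - \<psi> z\<bar> = Agmon_rate CARD('d) * sqrt h * \<bar>min (kappa_dist a \<kappa> x y) D - min (kappa_dist a \<kappa> x z) D\<bar>"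
      using Agmon_rate(1)[of "CARD('d)"] h by (simp add: \<psi>_def abs_mult flip: right_diff_distrib)
    also have "\<dots> \<le> Agmon_rate CARD('d) * sqrt h * \<bar>kappa_dist a \<kappa> x y - kappa_dist a \<kappa> x z\<bar>"
      using Agmon_rate(1)[of "CARD('d)"] h by (intro mult_left_mono) auto
    also have "\<dots> \<le> Agmon_rate CARD('d) * sqrt h * step_weight y z"
      using Agmon_rate(1)[of "CARD('d)"] h yz xy by (intro mult_left_mono kappa_dist_lipschitz) auto
    finally show "\<bar>\<psi> y - \<psi> z\<bar> \<le> Agmon_rate CARD('d) * sqrt h * step_weight y z" .
  next
    fix z assume z: "z \<in> ?X"
    then have "min (kappa_dist a \<kappa> x z) D \<le> s / 8"
      using kappa_dist_le_graph_dist[OF xy(1), of z] by (auto simp: graph_ball_eq)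
    then have "\<psi> z \<le> Agmon_rate CARD('d) * sqrt h * (s / 8)"
      unfolding \<psi>_def using Agmon_rate(1)[of "CARD('d)"] h by (intro mult_left_mono) auto
    also have "\<dots> \<le> 1" using Agmon_rate[of "CARD('d)"] h by (simp add: s_def)
    finally show "\<psi> z \<le> 1" .
  next
    fix z assume z: "z \<in> ?Y"
    then have "z \<in> \<C> - graph_ball a x (real l / 4)"
      using tri(2)[of z] l(2) by (auto simp: graph_ball_eq)
    then show "Agmon_rate CARD('d) * sqrt h * D \<le> \<psi> z" using D by (simp add: \<psi>_def)
  qed (use K in auto)
  also have "\<dots> = c_large * r powr (k / 2) * exp (- Agmon_rate CARD('d) * sqrt h * D) * (1 / (h * real (2 * l) ^ CARD('d)))"
  proof -
    have exps: "exp (1 - Agmon_rate CARD('d) * sqrt h * D) = exp 1 * exp (- Agmon_rate CARD('d) * sqrt h * D)"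
      by (simp add: exp_add[symmetric])
    have *: "(M / Q)\<^sup>2 * (256 powr k * r powr (k / 2)) * (2 * (exp 1 * A) * (C * C_reg * Q) / h)
      = c_large * r powr (k / 2) * A * (1 / (h * Q))" if "0 < Q" for A Q
      using that h by (simp add: large_const_def power2_eq_square mult_ac)
    have "0 < real (2 * l) ^ CARD('d)" using l(2) by simp
    then show ?thesis unfolding exps by (rule *)
  qed
  also have "\<dots> \<le> c_large * r powr (k / 2) * exp (- Agmon_rate CARD('d) * sqrt h * D) * real l powr (2 - real CARD('d))"
  proof (intro mult_left_mono)
    have "1 / (h * real (2 * l) ^ CARD('d)) \<le> 1 / (h * real l ^ CARD('d))"
      using h l(2) by (intro divide_left_mono mult_left_mono power_mono) auto
    \<comment> \<open>Strong killing turns \<open>1 / h\<close> into \<open>l ^ 2\<close>, since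
      \<open>h * l ^ 2 \<ge> 1\<close>.\<close>
    also have "\<dots> \<le> (real l)\<^sup>2 / real l ^ CARD('d)"
      using h r l(2) by (simp add: field_simps)
    also have "\<dots> = real l powr (2 - real CARD('d))"
      using l(2) by (simp add: powr_diff powr_realpow)
    finally show "1 / (h * real (2 * l) ^ CARD('d)) \<le> real l powr (2 - real CARD('d))" .
  qed (use C in \<open>auto simp: large_const_def\<close>)
  also have "H x y = fgreen ?V x y" unfolding H_def by (rule finite_green_commute) simp
  finally show ?thesis by (simp add: mult_ac)
qed

section \<open>Weak killing: \<open>r \<le> 1\<close>\<close>

lemma fgreen_sum_le_Poincare:
  assumes x: "x \<in> \<C>" and reg: "regular x N" and K: "N + 1 \<le> K"
    and XY: "X \<subseteq> nball x N" "Y \<subseteq> nball x N"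
    and card: "real (card X) \<le> B" "real (card Y) \<le> B"
  shows "(\<Sum>z\<in>X. \<Sum>w\<in>Y. killed_graph.finite_green (cond a) rate (nball x N) w z) \<le> 2 * (Sb * (real N)\<^sup>2) * B"
proof -
  let ?V = "nball x K" and ?W = "nball x N"
  interpret killed_graph ?V "cond a" rate by (rule killed_graph_nball[OF x])
  have WV: "?W \<subseteq> ?V" using K by (auto simp: nball_eq)
  have P0: "0 \<le> Sb * (real N)\<^sup>2" using sob_const_nonneg by simp
  have "(\<Sum>z\<in>X. potential ?W Y z)\<^sup>2 \<le> 4 * (Sb * (real N)\<^sup>2)\<^sup>2 * real (card X) * real (card Y)"
    using P0 by (intro potential_sum_le_Poincare WV XY Poincare[OF x reg K]) (auto simp: potential_outside[OF WV])
  also have "\<dots> \<le> 4 * (Sb * (real N)\<^sup>2)\<^sup>2 * B * B"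
    using card by (intro mult_mono) auto
  also have "\<dots> = (2 * (Sb * (real N)\<^sup>2) * B)\<^sup>2" by (simp add: power2_eq_square)
  finally have "(\<Sum>z\<in>X. potential ?W Y z) \<le> 2 * (Sb * (real N)\<^sup>2) * B"
    by (rule power2_le_imp_le) (use P0 card in auto)
  then show ?thesis by (simp add: potential_def)
qed

text \<open>For \<open>r \<le> 1\<close> the Green function of the ball of radius \<open>4 R\<close>, with the intermediate scale
  \<open>R\<close> about \<open>l r\<^sup>-\<^sup>1\<^sup>/\<^sup>4\<close>, is controlled by the Poincare inequality, and the remainder, which is
  harmonic in the whole ball, by the killing.\<close>

lemma fgreen_le_small:
  assumes xy: "x \<in> \<C>" "y \<in> \<C>" and l: "l = \<rho> x y" "1 \<le> l" and reg: "\<And>N. l \<le> N \<Longrightarrow> regular x N"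
    and h1: "h \<le> 1" and r: "r = h * (real l)\<^sup>2" "r \<le> 1" and K: "4 * nat \<lceil>real l * r powr (- 1 / 4)\<rceil> + 1 \<le> K"
  shows "fgreen (nball x K) x y \<le> c_small * r powr (- 1 / 2) * real l powr (2 - real CARD('d))"
proof -
  define R where "R = nat \<lceil>real l * r powr (- 1 / 4)\<rceil>"
  let ?V = "nball x K" and ?W = "nball x (4 * R)"
  interpret killed_graph ?V "cond a" rate by (rule killed_graph_nball[OF xy(1)])
  have WV: "?W \<subseteq> ?V" using K unfolding R_def[symmetric] by (intro nball_mono) simp
  have r0: "0 < r" using h l(2) by (simp add: r)
  define \<tau> where "\<tau> = r powr (- 1 / 4)"
  have "r powr 0 \<le> \<tau>" unfolding \<tau>_def using r0 r(2) by (intro powr_mono') auto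
  then have \<tau>: "1 \<le> \<tau>" using r0 by simp
  have \<tau>2: "\<tau>\<^sup>2 = r powr (- 1 / 2)" by (simp add: \<tau>_def power2_eq_square powr_add[symmetric])
  have \<tau>4: "\<tau>\<^sup>2 * \<tau>\<^sup>2 = 1 / r" using r0 unfolding \<tau>2 by (simp add: powr_add[symmetric] powr_minus_divide)
  have l\<tau>: "real l \<le> real l * \<tau>" using \<tau> by (simp add: mult_le_cancel_left1)
  have R1: "real l * \<tau> \<le> real R" unfolding R_def \<tau>_def by linarith
  have R2: "real R \<le> 2 * (real l * \<tau>)" using l\<tau> l(2) unfolding R_def \<tau>_def[symmetric] by linarith
  have lR: "l \<le> R" using l\<tau> R1 by linarith
  have K4: "4 * R + 1 \<le> K" using K by (simp add: R_def)
  have regR: "regular x (4 * R)" using lR by (intro reg) auto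
  have xx: "\<rho> x x = 0" using xy graph_dist_self by blast
  note tri = graph_dist_near[OF xy, folded l(1)]
  have W: "fgreen ?W x y \<le> 128 * M\<^sup>2 * 256 powr k * Sb * C_reg * (\<tau>\<^sup>2 * real l powr (2 - real CARD('d)))"
  proof -
    define H where "H z w = fgreen ?W w z" for z w
    let ?X = "graph_ball a x (real l / 8)" and ?Y = "graph_ball a y (real l / 8)"
    have H0: "0 \<le> H z w" for z w unfolding H_def by (rule finite_green_nonneg[OF WV])
    have Xsub: "?X \<subseteq> nball x (2 * l)" by (auto simp: graph_ball_eq)
    have Ysub: "?Y \<subseteq> nball x (2 * l)" using tri by (fastforce simp: graph_ball_eq)
    have lW: "nball x (2 * l) \<subseteq> ?W" using lR by (intro nball_mono) simp
    have disj: "z \<noteq> w" if "z \<in> ?X" "w \<in> ?Y" for z w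
      using that tri(2)[of w] l(2) by (auto simp: graph_ball_eq)
    have harm: "0 \<le> laplace (\<lambda>z. fgreen ?W w z) z" if "z \<in> ?W" "z \<noteq> w" for z w
      using finite_green_eq[OF WV that(1), of w] that finite_green_nonneg[OF WV] WV
      by (intro laplace_nonneg_of_harmonic) auto
    have K2: "2 * l + 1 \<le> K" using K lR by (simp add: R_def)
    have "H x y \<le> (M / real (2 * l) ^ CARD('d))\<^sup>2
       * ((real (2 * l) / (real l / 8)) * (real (2 * l) / (real l / 8))) powr k
       * (\<Sum>z\<in>?X. \<Sum>w\<in>?Y. H z w)"
    proof (rule two_sided_mean_value[OF xy(1) _ K2 xy(1) _ _ xy(2)])
      show "regular x (2 * l)" by (intro reg) simp
    next
      show "0 \<le> laplace (\<lambda>z. H z w) z" if "z \<in> ?X" "w \<in> ?Y" for z w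
        unfolding H_def using that Xsub lW disj by (intro harm) auto
      show "0 \<le> laplace (H x) w" if w: "w \<in> ?Y" for w
      proof -
        have "H x = (\<lambda>w. fgreen ?W x w)" unfolding H_def by (intro ext finite_green_commute WV)
        moreover have "x \<noteq> w" using disj[of x w] w xx xy l by (auto simp: graph_ball_eq)
        ultimately show ?thesis using w Ysub lW harm[of w x] by auto
      qed
    qed (use l xx in \<open>auto intro: H0\<close>)
    also have "(real (2 * l) / (real l / 8)) * (real (2 * l) / (real l / 8)) = 256"
      using l(2) by simp
    also have "(M / real (2 * l) ^ CARD('d))\<^sup>2 * 256 powr k * (\<Sum>z\<in>?X. \<Sum>w\<in>?Y. H z w)
      \<le> (M / real (2 * l) ^ CARD('d))\<^sup>2 * 256 powr k
        * (2 * (Sb * (real (4 * R))\<^sup>2) * (C_reg * real (2 * l) ^ CARD('d)))"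
    proof (rule mult_left_mono)
      have "real (card A) \<le> C_reg * real (2 * l) ^ CARD('d)" if "A \<subseteq> nball x (2 * l)" for A
      proof -
        have "card A \<le> card (nball x (2 * l))" using finite_nball[OF xy(1)] that by (rule card_mono)
        moreover have "real (card (nball x (2 * l))) \<le> C_reg * real (2 * l) ^ CARD('d)"
          by (intro regular_volume reg) simp
        ultimately show ?thesis by linarith
      qed
      from this[OF Xsub] this[OF Ysub]
      show "(\<Sum>z\<in>?X. \<Sum>w\<in>?Y. H z w) \<le> 2 * (Sb * (real (4 * R))\<^sup>2) * (C_reg * real (2 * l) ^ CARD('d))"
        unfolding H_def
        by (rule fgreen_sum_le_Poincare[OF xy(1) regR K4 subset_trans[OF Xsub lW] subset_trans[OF Ysub lW]])
    qed simp
    also have "\<dots> = 32 * M\<^sup>2 * 256 powr k * Sb * C_reg * ((real R)\<^sup>2 / real (2 * l) ^ CARD('d))"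
      using l(2) by (simp add: power2_eq_square)
    also have "\<dots> \<le> 32 * M\<^sup>2 * 256 powr k * Sb * C_reg * (4 * (\<tau>\<^sup>2 * real l powr (2 - real CARD('d))))"
    proof (intro mult_left_mono)
      have "(real R)\<^sup>2 / real (2 * l) ^ CARD('d) \<le> (2 * (real l * \<tau>))\<^sup>2 / real l ^ CARD('d)"
        using R2 l(2) by (intro frac_le power_mono) auto
      also have "\<dots> = 4 * (\<tau>\<^sup>2 * ((real l)\<^sup>2 / real l ^ CARD('d)))" by (simp add: power_mult_distrib)
      also have "(real l)\<^sup>2 / real l ^ CARD('d) = real l powr (2 - real CARD('d))"
        using l(2) by (simp add: powr_diff powr_realpow)
      finally show "(real R)\<^sup>2 / real (2 * l) ^ CARD('d) \<le> 4 * (\<tau>\<^sup>2 * real l powr (2 - real CARD('d)))" .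
    qed (use C sob_const_nonneg in auto)
    also have "H x y = fgreen ?W x y" unfolding H_def by (rule finite_green_commute[OF WV])
    finally show ?thesis by simp
  qed
  have V: "fgreen ?V x y - fgreen ?W x y
    \<le> 2 * (C * C_reg) * M\<^sup>2 * 16 powr k * (\<tau>\<^sup>2 * real l powr (2 - real CARD('d)))"
  proof -
    define H where "H z w = fgreen ?V w z - fgreen ?W w z" for z w
    let ?X = "graph_ball a x (real R)" and ?Y = "graph_ball a y (real R)"
    have Xsub: "?X \<subseteq> ?W" by (auto simp: graph_ball_eq)
    have Ysub: "?Y \<subseteq> ?W" using tri lR by (fastforce simp: graph_ball_eq)
    have H0: "0 \<le> H z w" for z w
      using finite_green_mono[OF WV, of w z] by (simp add: H_def)
    \<comment> \<open>The unit sources of the two kernels cancel, so no point of \<open>?W\<close>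
      is excluded and the balls \<open>?X\<close> and \<open>?Y\<close> may overlap.\<close>
    have harm: "0 \<le> laplace (\<lambda>z. H z w) z" if z: "z \<in> ?W" for z w
    proof (rule laplace_nonneg_of_harmonic)
      show "z \<in> ?V" using z WV by auto
      then show "rate z * H z w = (\<Sum>v\<in>?V. cond a z v * H v w)"
        using finite_green_eq[OF WV z, of w] finite_green_eq[of ?V z w]
        by (simp add: H_def right_diff_distrib sum_subtractf)
    qed (rule H0)
    have Hsym: "H z w = H w z" for z w
      unfolding H_def using finite_green_commute[OF WV, of w z] finite_green_commute[of ?V w z] by simp
    have RR: "0 < real R" using lR l(2) by simp
    have "H x y \<le> (M / real (4 * R) ^ CARD('d))\<^sup>2
       * ((real (4 * R) / real R) * (real (4 * R) / real R)) powr k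
       * (\<Sum>z\<in>?X. \<Sum>w\<in>?Y. H z w)"
    proof (rule two_sided_mean_value[OF xy(1) regR K4 xy(1) _ RR xy(2) _ RR H0])
      show "0 \<le> laplace (\<lambda>z. H z w) z" if "z \<in> ?X" for z w
        using that Xsub by (intro harm) auto
      show "0 \<le> laplace (H x) w" if w: "w \<in> ?Y" for w
      proof -
        have "H x = (\<lambda>w. H w x)" by (intro ext Hsym)
        then show ?thesis using w Ysub harm[of w x] by auto
      qed
    qed (use lR l xx in auto)
    also have "(real (4 * R) / real R) * (real (4 * R) / real R) = 16" using RR by simp
    also have "(M / real (4 * R) ^ CARD('d))\<^sup>2 * 16 powr k * (\<Sum>z\<in>?X. \<Sum>w\<in>?Y. H z w)
      \<le> (M / real (4 * R) ^ CARD('d))\<^sup>2 * 16 powr k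
        * (2 * exp (0 - 0) * (C * C_reg * real (4 * R) ^ CARD('d)) / h)"
    proof (intro mult_left_mono)
      have "(\<Sum>z\<in>?X. \<Sum>w\<in>?Y. H z w) \<le> (\<Sum>z\<in>?X. \<Sum>w\<in>?Y. fgreen ?V w z)"
        unfolding H_def using finite_green_nonneg[OF WV] by (intro sum_mono) simp
      also have "\<dots> \<le> 2 * exp (0 - 0) * (C * C_reg * real (4 * R) ^ CARD('d)) / h"
        using K4 step_weight_bounds Agmon_rate(1)[of "CARD('d)"] h
        by (intro fgreen_sum_le_Agmon[OF xy(1) regR _ h1 Xsub Ysub, where \<psi> = "\<lambda>_. 0"]) auto
      finally show "(\<Sum>z\<in>?X. \<Sum>w\<in>?Y. H z w) \<le> 2 * exp (0 - 0) * (C * C_reg * real (4 * R) ^ CARD('d)) / h" .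
    qed auto
    also have "\<dots> = 2 * (C * C_reg) * M\<^sup>2 * 16 powr k * (1 / (h * real (4 * R) ^ CARD('d)))"
      using RR h by (simp add: power2_eq_square mult_ac)
    also have "\<dots> \<le> 2 * (C * C_reg) * M\<^sup>2 * 16 powr k * (\<tau>\<^sup>2 * real l powr (2 - real CARD('d)))"
    proof (intro mult_left_mono)
      have ll: "0 < real l" using l(2) by simp
      \<comment> \<open>Of the \<open>d\<close> powers of \<open>4 * R\<close>, two are kept at the
        intermediate scale and the other \<open>e\<close> are reduced to \<open>l\<close>; together
        with \<open>1 / r\<close> from \<open>1 / h\<close> this leaves
        \<open>\<tau>\<^sup>2 = r powr (-1/2)\<close>.\<close>
      obtain e where e: "CARD('d) = 2 + e" using dim by (metis le_Suc_ex numeral_3_eq_3 numeral_2_eq_2 Suc_leD)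
      have "\<tau>\<^sup>2 * (real l)\<^sup>2 * real l ^ e \<le> real (4 * R) ^ CARD('d)"
      proof -
        have "\<tau>\<^sup>2 * (real l)\<^sup>2 * real l ^ e = (real l * \<tau>)\<^sup>2 * real l ^ e" by (simp add: power_mult_distrib)
        also have "\<dots> \<le> real (4 * R) ^ 2 * real (4 * R) ^ e"
          using R1 \<tau> lR by (intro mult_mono power_mono) auto
        finally show ?thesis by (simp only: e power_add)
      qed
      then have "1 / (h * real (4 * R) ^ CARD('d)) \<le> 1 / (h * (\<tau>\<^sup>2 * (real l)\<^sup>2 * real l ^ e))"
        using h \<tau> ll RR by (intro divide_left_mono mult_left_mono) auto
      also have "\<dots> = (1 / r) / (\<tau>\<^sup>2 * real l ^ e)"
        using ll h \<tau> by (simp add: r)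
      also have "\<dots> = \<tau>\<^sup>2 * (1 / real l ^ e)"
      proof -
        have *: "T * T / (T * X) = T * (1 / X)" if "T \<noteq> 0" for T X :: real using that by simp
        show ?thesis unfolding \<tau>4[symmetric] by (rule *) (use \<tau> in simp)
      qed
      also have "1 / real l ^ e = real l powr (2 - real CARD('d))"
        using ll by (simp add: e powr_minus_divide powr_realpow)
      finally show "1 / (h * real (4 * R) ^ CARD('d)) \<le> \<tau>\<^sup>2 * real l powr (2 - real CARD('d))" .
    qed (use C in auto)
    also have "H x y = fgreen ?V x y - fgreen ?W x y"
      unfolding H_def using finite_green_commute[OF WV, of x y] finite_green_commute[of ?V x y] by simp
    finally show ?thesis .
  qed
  have "fgreen ?V x y \<le> (128 * M\<^sup>2 * 256 powr k * Sb * C_reg + 2 * (C * C_reg) * M\<^sup>2 * 16 powr k)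
    * (\<tau>\<^sup>2 * real l powr (2 - real CARD('d)))"
    using V W by (simp only: distrib_right)
  then show ?thesis by (simp add: small_const_def \<tau>2)
qed

end

section \<open>Real exponents and the extraction of regular scales\<close>

lemma avg_norm_le_Max:
  assumes A: "finite A" "A \<noteq> {}" and p: "0 < p"
  shows "avg_norm (ereal p) f A \<le> avg_norm \<infinity> f A"
proof -
  define m where "m = Max ((\<lambda>x. \<bar>f x\<bar>) ` A)"
  have m: "\<bar>f x\<bar> \<le> m" if "x \<in> A" for x unfolding m_def using A that by (intro Max_ge) auto
  have m0: "0 \<le> m" using m A(2) by (metis abs_ge_zero all_not_in_conv order_trans)
  have "(\<Sum>x\<in>A. \<bar>f x\<bar> powr p) \<le> (\<Sum>x\<in>A. m powr p)"
    using m p by (intro sum_mono powr_mono2) auto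
  then have "(\<Sum>x\<in>A. \<bar>f x\<bar> powr p) / real (card A) \<le> m powr p"
    using A by (simp add: field_simps card_gt_0_iff)
  then have "((\<Sum>x\<in>A. \<bar>f x\<bar> powr p) / real (card A)) powr (1 / p) \<le> (m powr p) powr (1 / p)"
    using p by (intro powr_mono2) (auto intro!: divide_nonneg_nonneg sum_nonneg)
  also have "\<dots> = m" using p m0 by (simp add: powr_powr)
  finally show ?thesis by (simp add: avg_norm_real) (simp add: avg_norm_def m_def)
qed

text \<open>An infinite exponent is traded for a large real one, so that the estimates need no
  separate case; the strict inequality between the exponents leaves the room
  \<open>t\<close>.\<close>

lemma finite_exponent:
  fixes p :: ereal and t :: real
  assumes "1 < p" "0 < t"
  obtains p' :: real where "1 < p'" "ereal (1 / p') < 1 / p + ereal t"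
    "\<And>f (A :: 'a set). finite A \<Longrightarrow> A \<noteq> {} \<Longrightarrow> avg_norm (ereal p') f A \<le> avg_norm p f A"
proof (cases p)
  case (real r)
  then have "1 < r" using assms by (simp add: one_ereal_def)
  then show ?thesis using that[of r] assms real by (simp add: one_ereal_def)
next
  case PInf
  define r where "r = max 2 (2 / t)"
  have "1 / r \<le> 1 / (2 / t)" unfolding r_def using assms by (intro divide_left_mono) auto
  also have "\<dots> < t" using assms by simp
  finally have "ereal (1 / r) < 1 / p + ereal t" using PInf by simp
  moreover have r: "1 < r" by (simp add: r_def)
  moreover have "avg_norm (ereal r) f A \<le> avg_norm p f A" if "finite A" "A \<noteq> {}" for f :: "'a \<Rightarrow> real" and A
    using avg_norm_le_Max[OF that, of r f] r PInf by simp
  ultimately show ?thesis using that by blast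
qed (use assms in auto)

lemma finite_exponents:
  fixes p q :: ereal and e :: real
  assumes "1 < p" "1 < q" "1 / p + 1 / q < ereal e"
  obtains p' q' :: real where "1 < p'" "1 < q'" "1 / p' + 1 / q' < e"
    "\<And>f (A :: 'a set). finite A \<Longrightarrow> A \<noteq> {} \<Longrightarrow> avg_norm (ereal p') f A \<le> avg_norm p f A"
    "\<And>f (A :: 'a set). finite A \<Longrightarrow> A \<noteq> {} \<Longrightarrow> avg_norm (ereal q') f A \<le> avg_norm q f A"
proof -
  have inv: "\<exists>s. 1 / r = ereal s" if "1 < r" for r :: ereal
    using that by (cases r) (auto simp: one_ereal_def zero_ereal_def)
  obtain s1 s2 where s: "1 / p = ereal s1" "1 / q = ereal s2" using inv assms by blast
  \<comment> \<open>Half of the slack for each of the two exponents.\<close>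
  define t where "t = (e - (s1 + s2)) / 2"
  have t: "0 < t" using assms(3) s by (simp add: t_def)
  obtain p' where p': "1 < p'" "ereal (1 / p') < 1 / p + ereal t"
    "\<And>f (A :: 'a set). finite A \<Longrightarrow> A \<noteq> {} \<Longrightarrow> avg_norm (ereal p') f A \<le> avg_norm p f A"
    using finite_exponent[OF assms(1) t] by metis
  obtain q' where q': "1 < q'" "ereal (1 / q') < 1 / q + ereal t"
    "\<And>f (A :: 'a set). finite A \<Longrightarrow> A \<noteq> {} \<Longrightarrow> avg_norm (ereal q') f A \<le> avg_norm q f A"
    using finite_exponent[OF assms(2) t] by metis
  have "1 / p' < s1 + t" "1 / q' < s2 + t" using p'(2) q'(2) s by auto
  moreover have "2 * t = e - (s1 + s2)" by (simp add: t_def)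
  ultimately have "1 / p' + 1 / q' < e" by linarith
  then show ?thesis using that p' q' by blast
qed

lemma eventually_regular_scale:
  assumes vol: "volume_Sobolev_regular a C_reg C_S d'" and int: "integrable_config a \<kappa> p q C_int"
    and C: "C_int \<le> C" and x: "x \<in> infinite_cluster a"
    and p': "\<And>f (A :: (int ^ 'd) set). finite A \<Longrightarrow> A \<noteq> {} \<Longrightarrow> avg_norm (ereal p') f A \<le> avg_norm p f A"
    and q': "\<And>f (A :: (int ^ 'd) set). finite A \<Longrightarrow> A \<noteq> {} \<Longrightarrow> avg_norm (ereal q') f A \<le> avg_norm q f A"
  shows "\<exists>N0. \<forall>N\<ge>N0. regular_scale a \<kappa> C_reg C_S d' p' q' C (x :: int ^ 'd) N"
proof -
  obtain N1 where N1: "\<And>n. N1 \<le> n \<Longrightarrow>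
      inverse C_reg * real n ^ CARD('d) \<le> real (card (graph_ball a x (real n))) \<and>
      real (card (graph_ball a x (real n))) \<le> C_reg * real n ^ CARD('d)"
    using vol x unfolding volume_Sobolev_regular_def by meson
  obtain N2 where N2: "\<And>n (u :: int ^ 'd \<Rightarrow> real). N2 \<le> n \<Longrightarrow>
      (\<forall>y\<in>infinite_cluster a - graph_ball a x (real n). u y = 0) \<Longrightarrow>
      avg_norm (ereal (d' / (d' - 1))) u (graph_ball a x (real n))
        \<le> C_S * (real n / real (card (graph_ball a x (real n)))) *
          (\<Sum>\<^sub>\<infinity>(y, z)\<in>{(y, z). y \<in> infinite_cluster a \<and> z \<in> infinite_cluster a \<and>
                           {y, z} \<in> open_edges a}. \<bar>u y - u z\<bar>)"
    using vol x unfolding volume_Sobolev_regular_def by meson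
  obtain N3 where N3: "(SUP n\<in>{N3..}. ereal (Max {avg_norm p (mu a) (graph_ball a x (real n)),
        avg_norm q (nu a) (graph_ball a x (real n)), avg_norm p \<kappa> (graph_ball a x (real n)),
        avg_norm 1 (\<lambda>y. 1 / \<kappa> y) (graph_ball a x (real n))})) \<le> ereal C_int"
    using int x unfolding integrable_config_def by meson
  have reg: "regular_scale a \<kappa> C_reg C_S d' p' q' C x N" if N: "max (max N1 N2) (max N3 1) \<le> N" for N
  proof -
    let ?B = "graph_ball a x (real N)"
    have "ereal (Max {avg_norm p (mu a) ?B, avg_norm q (nu a) ?B, avg_norm p \<kappa> ?B, avg_norm 1 (\<lambda>y. 1 / \<kappa> y) ?B})
      \<le> ereal C_int"
      using N3 N by (simp only: SUP_le_iff) auto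
    then have norms: "avg_norm p (mu a) ?B \<le> C" "avg_norm q (nu a) ?B \<le> C" "avg_norm 1 (\<lambda>y. 1 / \<kappa> y) ?B \<le> C"
      using C by auto
    have "1 \<le> C_reg" using vol by (simp add: volume_Sobolev_regular_def)
    \<comment> \<open>A positive \<open>card\<close> gives finiteness and nonemptiness of the ball
      at once.\<close>
    then have "0 < inverse C_reg * real N ^ CARD('d)" using N by simp
    then have "0 < card ?B" using N1[of N] N by linarith
    then have B: "finite ?B" "?B \<noteq> {}" by (simp_all add: card_gt_0_iff)
    have "avg_norm (ereal p') (mu a) ?B \<le> C" "avg_norm (ereal q') (nu a) ?B \<le> C"
      using p'[OF B] q'[OF B] norms by (meson order_trans)+
    then show ?thesis unfolding regular_scale_def using N N1[of N] N2[of N] norms by auto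
  qed
  then show ?thesis by blast
qed

section \<open>Assembly of the two regimes\<close>

context regular_cluster
begin

text \<open>The regime \<open>r \<ge> 1\<close> needs the power \<open>k / 2\<close> of
  \<open>1 + r\<close>; adding 2 makes the exponent exceed 1 for every \<open>k > 0\<close>. The
  factor \<open>exp 1\<close> pays for an almost optimal \<open>z\<close> in that regime and for the
  exponential itself in the other.\<close>

lemma green_le:
  assumes xy: "x \<in> \<C>" "y \<in> \<C>" and l: "l = \<rho> x y" "1 \<le> l" and reg: "\<And>N. l \<le> N \<Longrightarrow> regular x N" and h1: "h \<le> 1"
  shows "green a \<kappa> h x y \<le> ennreal (exp 1 * (c_large + c_small + 1)) * F (k / 2 + 2) (h * real l ^ 2)
     * ennreal (real l powr (2 - real CARD('d)))
     * (SUP z\<in>\<C> - graph_ball a x (real l / 4). ennreal (exp (- Agmon_rate CARD('d) * sqrt h * kappa_dist a \<kappa> x z)))"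
proof -
  define r where "r = h * real l ^ 2"
  define lp where "lp = real l powr (2 - real CARD('d))"
  define Fr where "Fr = (1 + r) powr (k / 2 + 2) * (1 + 1 / r) powr (1 / 2)"
  define E where "E z = exp (- Agmon_rate CARD('d) * sqrt h * kappa_dist a \<kappa> x z)" for z
  have r0: "0 < r" using h l(2) by (simp add: r_def)
  have F: "F (k / 2 + 2) (h * real l ^ 2) = ennreal Fr" unfolding r_def[symmetric] using r0 by (simp add: F_def Fr_def)
  have k0: "0 < k" by (rule mv_exp_pos)
  have cl: "0 \<le> c_large" "0 \<le> c_small" "0 \<le> lp"
    using C sob_const_nonneg by (auto simp: large_const_def small_const_def lp_def)
  have outside: "y \<in> \<C> - graph_ball a x (real l / 4)" using xy l by (simp add: graph_ball_eq)
  have "\<exists>z\<in>\<C> - graph_ball a x (real l / 4). green a \<kappa> h x y \<le> ennreal (exp 1 * (c_large + c_small + 1) * Fr * lp * E z)"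
  proof (cases "1 \<le> r")
    case True
    define D where "D = Inf (kappa_dist a \<kappa> x ` (\<C> - graph_ball a x (real l / 4)))"
    have bdd: "bdd_below (kappa_dist a \<kappa> x ` (\<C> - graph_ball a x (real l / 4)))"
      by (rule bdd_belowI[of _ 0]) (use kappa_dist_nonneg[OF xy(1)] in auto)
    have D: "D \<le> kappa_dist a \<kappa> x z" if "z \<in> \<C> - graph_ball a x (real l / 4)" for z
      unfolding D_def using that by (intro cInf_lower bdd imageI)
    have D0: "0 \<le> D"
      unfolding D_def using outside kappa_dist_nonneg[OF xy(1)] by (intro cInf_greatest) auto
    \<comment> \<open>The infimum need not be attained. A slack of 1 costs at most
      \<open>exp 1\<close>, since the rate times \<open>sqrt h\<close> is at most 1.\<close>
    obtain z where z: "z \<in> \<C> - graph_ball a x (real l / 4)" "kappa_dist a \<kappa> x z < D + 1"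
      using cInf_lessD[of "kappa_dist a \<kappa> x ` (\<C> - graph_ball a x (real l / 4))" "D + 1"] outside
      unfolding D_def by auto
    have ED: "exp (- Agmon_rate CARD('d) * sqrt h * D) \<le> exp 1 * E z"
    proof -
      have "Agmon_rate CARD('d) * sqrt h * (kappa_dist a \<kappa> x z - D) \<le> 1 * 1 * 1"
        using Agmon_rate[of "CARD('d)"] h h1 z D[OF z(1)] by (intro mult_mono) auto
      then have "- Agmon_rate CARD('d) * sqrt h * D \<le> 1 + - Agmon_rate CARD('d) * sqrt h * kappa_dist a \<kappa> x z"
        by (simp add: algebra_simps)
      then show ?thesis unfolding E_def exp_add[symmetric] by simp
    qed
    have rF: "r powr (k / 2) \<le> Fr"
    proof -
      have "r powr (k / 2) \<le> (1 + r) powr (k / 2)" using r0 k0 by (intro powr_mono2) auto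
      also have "\<dots> \<le> (1 + r) powr (k / 2 + 2)" using r0 by (intro powr_mono) auto
      also have "\<dots> * 1 \<le> Fr"
        unfolding Fr_def using r0 by (intro mult_left_mono ge_one_powr_ge_zero) auto
      finally show ?thesis by simp
    qed
    have "green a \<kappa> h x y \<le> ennreal (exp 1 * (c_large + c_small + 1) * Fr * lp * E z)"
    proof (rule green_le_fgreen[OF xy, of "2 * l + 1"])
      fix K assume K: "2 * l + 1 \<le> K"
      have "fgreen (nball x K) x y \<le> c_large * r powr (k / 2) * lp * exp (- Agmon_rate CARD('d) * sqrt h * D)"
        unfolding lp_def by (rule fgreen_le_large[OF xy l _ K h1 r_def True D0 D]) (use reg in auto)
      also have "\<dots> \<le> (c_large + c_small + 1) * Fr * lp * (exp 1 * E z)"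
        using cl rF by (intro mult_mono ED) (auto simp: Fr_def)
      finally show "fgreen (nball x K) x y \<le> exp 1 * (c_large + c_small + 1) * Fr * lp * E z"
        by (simp add: mult_ac)
    qed
    then show ?thesis using z(1) by blast
  next
    case False
    have rF: "r powr (- 1 / 2) \<le> Fr"
    proof -
      have "r powr (- 1 / 2) = (1 / r) powr (1 / 2)" using r0 by (simp add: powr_divide powr_minus_divide)
      also have "\<dots> \<le> (1 + 1 / r) powr (1 / 2)" using r0 by (intro powr_mono2) auto
      also have "1 * \<dots> \<le> Fr"
        unfolding Fr_def using r0 k0 by (intro mult_right_mono ge_one_powr_ge_zero) auto
      finally show ?thesis by simp
    qed
    \<comment> \<open>Here \<open>y\<close> itself competes in the supremum, and its exponent is at
      most \<open>sqrt r \<le> 1\<close>.\<close>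
    have Ey: "1 \<le> exp 1 * E y"
    proof -
      have "kappa_dist a \<kappa> x y \<le> real l" using kappa_dist_le_graph_dist[OF xy] l by simp
      then have "Agmon_rate CARD('d) * (sqrt h * kappa_dist a \<kappa> x y) \<le> 1 * (sqrt h * real l)"
        using Agmon_rate[of "CARD('d)"] h kappa_dist_nonneg[OF xy] by (intro mult_mono) auto
      also have "\<dots> = sqrt r" by (simp add: r_def real_sqrt_mult)
      also have "\<dots> \<le> 1" using False by simp
      finally have "0 \<le> 1 + - Agmon_rate CARD('d) * sqrt h * kappa_dist a \<kappa> x y" by simp
      then show ?thesis unfolding E_def exp_add[symmetric] by simp
    qed
    have "green a \<kappa> h x y \<le> ennreal (exp 1 * (c_large + c_small + 1) * Fr * lp * E y)"
    proof (rule green_le_fgreen[OF xy, of "4 * nat \<lceil>real l * r powr (- 1 / 4)\<rceil> + 1"])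
      fix K assume K: "4 * nat \<lceil>real l * r powr (- 1 / 4)\<rceil> + 1 \<le> K"
      have "fgreen (nball x K) x y \<le> c_small * r powr (- 1 / 2) * lp * 1"
        unfolding lp_def mult_1_right by (rule fgreen_le_small[OF xy l reg h1 r_def _ K]) (use False in auto)
      also have "\<dots> \<le> (c_large + c_small + 1) * Fr * lp * (exp 1 * E y)"
        using cl rF by (intro mult_mono Ey) (auto simp: Fr_def)
      finally show "fgreen (nball x K) x y \<le> exp 1 * (c_large + c_small + 1) * Fr * lp * E y"
        by (simp add: mult_ac)
    qed
    then show ?thesis using outside by blast
  qed
  then obtain z where z: "z \<in> \<C> - graph_ball a x (real l / 4)"
    and bound: "green a \<kappa> h x y \<le> ennreal (exp 1 * (c_large + c_small + 1) * Fr * lp * E z)" by blast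
  note bound
  also have "ennreal (exp 1 * (c_large + c_small + 1) * Fr * lp * E z)
    = ennreal (exp 1 * (c_large + c_small + 1)) * ennreal Fr * ennreal lp * ennreal (E z)"
    using cl by (simp add: ennreal_mult Fr_def E_def)
  also have "\<dots> \<le> ennreal (exp 1 * (c_large + c_small + 1)) * ennreal Fr * ennreal lp
      * (SUP z\<in>\<C> - graph_ball a x (real l / 4). ennreal (E z))"
    using z by (intro mult_left_mono SUP_upper) auto
  finally show ?thesis unfolding F lp_def E_def .
qed

end

lemma green_bound_far:
  fixes a :: "(int ^ 'd :: finite) set \<Rightarrow> real" and C_reg C_S d' p' q' C :: real
  defines "c \<equiv> exp 1 * (large_const C_reg C_S d' p' q' C + small_const C_reg C_S d' p' q' C + 1)"
    and "\<gamma> \<equiv> mv_exp d' p' q' / 2 + 2"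
  assumes params: "regular_params C_reg C_S d' p' q' C CARD('d)" and c: "0 < c"
    and conf: "configuration a \<kappa>" and x: "x \<in> infinite_cluster a"
    and reg: "\<exists>N0. \<forall>N\<ge>N0. regular_scale a \<kappa> C_reg C_S d' p' q' C x N"
  shows "\<exists>N :: nat. \<forall>y\<in>infinite_cluster a.
    N \<le> graph_dist a x y \<longrightarrow>
    (\<forall>h\<in>{0..1}.
      green a \<kappa> h x y
        \<le> ennreal c * F \<gamma> (h * real (graph_dist a x y) ^ 2)
          * ennreal (real (graph_dist a x y) powr (2 - real CARD('d)))
          * (SUP z\<in>infinite_cluster a - graph_ball a x (real (graph_dist a x y) / 4).
              ennreal (exp (- Agmon_rate CARD('d) * sqrt h * kappa_dist a \<kappa> x z))))"
proof -
  interpret regular_params C_reg C_S d' p' q' C "CARD('d)" by (rule params)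
  interpret cluster a \<kappa> by unfold_locales (rule conf)
  obtain N0 where N0: "\<And>N. N0 \<le> N \<Longrightarrow> regular_scale a \<kappa> C_reg C_S d' p' q' C x N"
    using reg by blast
  show ?thesis
  proof (intro exI[of _ "max N0 1"] ballI impI, goal_cases)
    case (1 y h)
    define l where "l = graph_dist a x y"
    have l: "1 \<le> l" "N0 \<le> l" using 1(2) by (auto simp: l_def)
    show ?case
    proof (cases "h = 0")
      case True
      have "y \<in> infinite_cluster a - graph_ball a x (real l / 4)"
        using 1(1) l by (simp add: graph_ball_eq l_def)
      then have "(SUP z\<in>infinite_cluster a - graph_ball a x (real l / 4). (1 :: ennreal)) = 1"
        by (intro SUP_eq_const) auto
      then show ?thesis
        unfolding l_def[symmetric] using c l True by (simp add: F_def ennreal_mult_top ennreal_top_mult)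
    next
      case False
      then have h01: "0 < h" "h \<le> 1" using 1(3) by auto
      interpret regular_cluster a \<kappa> h C_reg C_S d' p' q' C
        by unfold_locales (use \<kappa>_pos h01 in auto)
      show ?thesis
        unfolding c_def \<gamma>_def l_def[symmetric]
        using N0 l by (intro green_le[OF x 1(1) l_def l(1) _ h01(2)]) auto
    qed
  qed
qed

theorem theorem3p8:
  assumes "3 \<le> CARD('d::finite)"
  shows "\<exists>lam\<in>{0<..<1}. \<forall>C_reg\<ge>1. \<forall>C_S\<ge>1. \<forall>d'\<ge>real CARD('d). \<forall>p>1. \<forall>q>1.
    1 / p + 1 / q < ereal (2 / d') \<longrightarrow>
    (\<exists>\<gamma>>1. \<forall>C_int :: real. \<exists>c>0.
      \<forall>(a :: (int ^ 'd) set \<Rightarrow> real) \<kappa>.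
        configuration a \<kappa> \<longrightarrow>
        volume_Sobolev_regular a C_reg C_S d' \<longrightarrow>
        integrable_config a \<kappa> p q C_int \<longrightarrow>
        (\<forall>x\<in>infinite_cluster a. \<exists>N :: nat. \<forall>y\<in>infinite_cluster a.
           N \<le> graph_dist a x y \<longrightarrow>
           (\<forall>h\<in>{0..1}.
              green a \<kappa> h x y
                \<le> ennreal c * F \<gamma> (h * real (graph_dist a x y) ^ 2)
                   * ennreal (real (graph_dist a x y) powr (2 - real CARD('d)))
                   * (SUP z\<in>infinite_cluster a - graph_ball a x (real (graph_dist a x y) / 4).
                        ennreal (exp (- lam * sqrt h * kappa_dist a \<kappa> x z))))))"
proof (intro bexI[of _ "Agmon_rate CARD('d)"] allI impI, goal_cases)
  case (1 C_reg C_S d' p q)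
  \<comment> \<open>Chosen from \<open>d'\<close>, \<open>p\<close> and \<open>q\<close> before
    \<open>C_int\<close> appears, so that \<open>\<gamma>\<close> depends on nothing else.\<close>
  obtain p' q' where pq': "1 < p'" "1 < q'" "1 / p' + 1 / q' < 2 / d'"
    "\<And>f (A :: (int ^ 'd) set). finite A \<Longrightarrow> A \<noteq> {} \<Longrightarrow> avg_norm (ereal p') f A \<le> avg_norm p f A"
    "\<And>f (A :: (int ^ 'd) set). finite A \<Longrightarrow> A \<noteq> {} \<Longrightarrow> avg_norm (ereal q') f A \<le> avg_norm q f A"
    using finite_exponents[OF 1(4-6)] by metis
  \<comment> \<open>\<open>C_int\<close> may be any real number, whereas the constants are built for
    a bound of at least 1.\<close>
  have params: "regular_params C_reg C_S d' p' q' (max 1 C_int) CARD('d)" for C_int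
    using 1(1-3) pq' assms by unfold_locales auto
  have "0 < mv_exp d' p' q'" using params by (rule regular_params.mv_exp_pos)
  then have \<gamma>: "1 < mv_exp d' p' q' / 2 + 2" by simp
  show ?case
  proof (rule exI, rule conjI[OF \<gamma>], rule allI, goal_cases)
    case (1 C_int)
    define C where "C = max 1 C_int"
    interpret regular_params C_reg C_S d' p' q' C "CARD('d)" unfolding C_def by (rule params)
    have "0 \<le> large_const C_reg C_S d' p' q' C" "0 \<le> small_const C_reg C_S d' p' q' C"
      using C sob_const_nonneg by (auto simp: large_const_def small_const_def)
    then have c: "0 < exp 1 * (large_const C_reg C_S d' p' q' C + small_const C_reg C_S d' p' q' C + 1)"
      by simp
    show ?case
    proof (rule exI, rule conjI[OF c], intro allI impI ballI, goal_cases)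
      case (1 a \<kappa> x)
      have "regular_params C_reg C_S d' p' q' C CARD('d)" ..
      then show ?case
        using c 1(1,4)
        by (rule green_bound_far) (rule eventually_regular_scale[OF 1(2,3) _ 1(4) pq'(4,5)], simp_all add: C_def)
    qed
  qed
qed (use Agmon_rate in simp)

end
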